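(* For any commutative ring $R$ with unity of Krull dimension $\leq d$, every finitely generated stably free module over $R[X,X^{-1}]$ of rank $>d$ is free.
   Context: All rings are commutative with unity (not assumed Noetherian). $R[X,X^{-1}]$ is the Laurent polynomial ring in one variable. *)

theory Defs
  imports
    "HOL-Algebra.Ideal"
    "HOL-Library.Extended_Real"
    "Jordan_Normal_Form.Missing_VectorSpace"
begin

section \<open>Krull dimension\<close>

text \<open>
  The supremum of the lengths \<open>n\<close> of strict chains \<open>P 0 \<subset> \<dots> \<subset> P n\<close> of prime ideals.
  The value is \<open>- \<infinity>\<close> for the zero ring, which has no prime ideals.
\<close>

definition prime_chain :: "('a, 'b) ring_scheme \<Rightarrow> nat \<Rightarrow> (nat \<Rightarrow> 'a set) \<Rightarrow> bool" where
  "prime_chain R n P \<longleftrightarrow> (\<forall>i\<le>n. primeideal (P i) R) \<and> (\<forall>i<n. P i \<subset> P (Suc i))"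

definition krull_dim :: "('a, 'b) ring_scheme \<Rightarrow> ereal" where
  "krull_dim R = Sup {ereal (real n) | n. \<exists>P. prime_chain R n P}"


section \<open>The Laurent polynomial ring\<close>

text \<open>
  A Laurent polynomial is given by its coefficient function: \<open>f\<close> stands for the sum of the
  terms \<open>f k * X ^ k\<close> over the finitely many integers \<open>k\<close> with \<open>f k\<close> nonzero.
\<close>

definition laurent_carrier :: "('a, 'b) ring_scheme \<Rightarrow> (int \<Rightarrow> 'a) set" where
  "laurent_carrier R = {f. range f \<subseteq> carrier R \<and> finite {k. f k \<noteq> \<zero>\<^bsub>R\<^esub>}}"

definition laurent_ring :: "('a, 'b) ring_scheme \<Rightarrow> (int \<Rightarrow> 'a) ring" where
  "laurent_ring R = \<lparr>
     carrier = laurent_carrier R,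
     mult = (\<lambda>f g k. \<Oplus>\<^bsub>R\<^esub>i\<in>{i. f i \<noteq> \<zero>\<^bsub>R\<^esub>}. f i \<otimes>\<^bsub>R\<^esub> g (k - i)),
     one = (\<lambda>k. if k = 0 then \<one>\<^bsub>R\<^esub> else \<zero>\<^bsub>R\<^esub>),
     zero = (\<lambda>k. \<zero>\<^bsub>R\<^esub>),
     add = (\<lambda>f g k. f k \<oplus>\<^bsub>R\<^esub> g k)\<rparr>"

context cring
begin

lemma laurent_carrierD:
  assumes "f \<in> laurent_carrier R"
  shows "f k \<in> carrier R" "finite {k. f k \<noteq> \<zero>}"
  using assms by (auto simp: laurent_carrier_def)

lemma laurent_carrierI:
  assumes "\<And>k. f k \<in> carrier R" "finite A" "\<And>k. k \<notin> A \<Longrightarrow> f k = \<zero>"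
  shows "f \<in> laurent_carrier R"
proof -
  have "{k. f k \<noteq> \<zero>} \<subseteq> A" using assms(3) by auto
  then show ?thesis
    using assms(1,2) by (auto simp: laurent_carrier_def intro: finite_subset)
qed

lemma laurent_mult_eq:
  assumes f: "f \<in> laurent_carrier R" and g: "g \<in> laurent_carrier R"
    and A: "finite A" "{i. f i \<noteq> \<zero>} \<subseteq> A"
  shows "(f \<otimes>\<^bsub>laurent_ring R\<^esub> g) k = (\<Oplus>i\<in>A. f i \<otimes> g (k - i))"
proof -
  have "(\<Oplus>i\<in>{i. f i \<noteq> \<zero>}. f i \<otimes> g (k - i)) = (\<Oplus>i\<in>A. f i \<otimes> g (k - i))"
    by (rule add.finprod_mono_neutral_cong_left)
      (use A laurent_carrierD(1)[OF f] laurent_carrierD(1)[OF g] in auto)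
  then show ?thesis by (simp add: laurent_ring_def)
qed

lemma laurent_mult_closed:
  assumes f: "f \<in> laurent_carrier R" and g: "g \<in> laurent_carrier R"
  shows "f \<otimes>\<^bsub>laurent_ring R\<^esub> g \<in> laurent_carrier R"
proof (rule laurent_carrierI)
  let ?A = "{i. f i \<noteq> \<zero>}" and ?B = "{i. g i \<noteq> \<zero>}"
  note fc = laurent_carrierD[OF f] and gc = laurent_carrierD[OF g]
  show "(f \<otimes>\<^bsub>laurent_ring R\<^esub> g) k \<in> carrier R" for k
    by (subst laurent_mult_eq[OF f g fc(2) subset_refl]) (use fc gc in auto)
  show "finite ((\<lambda>(i, j). i + j) ` (?A \<times> ?B))" using fc gc by simp
  show "(f \<otimes>\<^bsub>laurent_ring R\<^esub> g) k = \<zero>" if k: "k \<notin> (\<lambda>(i, j). i + j) ` (?A \<times> ?B)" for k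
  proof -
    have "f i \<otimes> g (k - i) = \<zero>" if "i \<in> ?A" for i
    proof -
      have "g (k - i) = \<zero>"
      proof (rule ccontr)
        assume "g (k - i) \<noteq> \<zero>"
        then have "(i, k - i) \<in> ?A \<times> ?B" using that by simp
        then have "i + (k - i) \<in> (\<lambda>(i, j). i + j) ` (?A \<times> ?B)" by (rule rev_image_eqI) simp
        then show False using k by simp
      qed
      then show ?thesis using fc by simp
    qed
    then show ?thesis
      by (subst laurent_mult_eq[OF f g fc(2) subset_refl]) (rule add.finprod_one_eqI)
  qed
qed

lemma laurent_mult_comm:
  assumes f: "f \<in> laurent_carrier R" and g: "g \<in> laurent_carrier R"
  shows "f \<otimes>\<^bsub>laurent_ring R\<^esub> g = g \<otimes>\<^bsub>laurent_ring R\<^esub> f"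
proof
  fix k
  note fc = laurent_carrierD[OF f] and gc = laurent_carrierD[OF g]
  define A where "A = {i. f i \<noteq> \<zero>} \<union> (\<lambda>i. k - i) ` {i. g i \<noteq> \<zero>}"
  have A: "finite A" "{i. f i \<noteq> \<zero>} \<subseteq> A" using fc gc by (auto simp: A_def)
  have B: "finite ((\<lambda>i. k - i) ` A)" "{i. g i \<noteq> \<zero>} \<subseteq> (\<lambda>i. k - i) ` A"
    using A by (auto simp: A_def image_Un image_image)
  have "(g \<otimes>\<^bsub>laurent_ring R\<^esub> f) k = (\<Oplus>i\<in>(\<lambda>i. k - i) ` A. g i \<otimes> f (k - i))"
    by (rule laurent_mult_eq[OF g f B])
  also have "\<dots> = (\<Oplus>i\<in>A. g (k - i) \<otimes> f (k - (k - i)))"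
    by (rule add.finprod_reindex) (use fc gc in \<open>auto simp: inj_on_def\<close>)
  also have "\<dots> = (\<Oplus>i\<in>A. f i \<otimes> g (k - i))"
    by (rule finsum_cong') (use fc gc in \<open>auto simp: m_comm\<close>)
  also have "\<dots> = (f \<otimes>\<^bsub>laurent_ring R\<^esub> g) k"
    by (rule laurent_mult_eq[OF f g A, symmetric])
  finally show "(f \<otimes>\<^bsub>laurent_ring R\<^esub> g) k = (g \<otimes>\<^bsub>laurent_ring R\<^esub> f) k" ..
qed

lemma finsum_swap:
  assumes "finite A" "finite B" "\<And>i j. i \<in> A \<Longrightarrow> j \<in> B \<Longrightarrow> F i j \<in> carrier R"
  shows "(\<Oplus>i\<in>A. \<Oplus>j\<in>B. F i j) = (\<Oplus>j\<in>B. \<Oplus>i\<in>A. F i j)"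
  using assms(1,3)
proof (induction A rule: finite_induct)
  case empty
  then show ?case by (simp add: add.finprod_one)
next
  case (insert a A)
  have "(\<Oplus>i\<in>insert a A. \<Oplus>j\<in>B. F i j) = (\<Oplus>j\<in>B. F a j) \<oplus> (\<Oplus>i\<in>A. \<Oplus>j\<in>B. F i j)"
    by (rule finsum_insert) (use insert in \<open>auto intro!: finsum_closed\<close>)
  also have "(\<Oplus>i\<in>A. \<Oplus>j\<in>B. F i j) = (\<Oplus>j\<in>B. \<Oplus>i\<in>A. F i j)"
    using insert by simp
  also have "(\<Oplus>j\<in>B. F a j) \<oplus> \<dots> = (\<Oplus>j\<in>B. F a j \<oplus> (\<Oplus>i\<in>A. F i j))"
    by (rule finsum_addf[symmetric]) (use insert in \<open>auto intro!: finsum_closed\<close>)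
  also have "\<dots> = (\<Oplus>j\<in>B. \<Oplus>i\<in>insert a A. F i j)"
    by (rule finsum_cong')
      (use insert in \<open>auto intro!: finsum_closed finsum_insert[symmetric]\<close>)
  finally show ?case .
qed

lemma laurent_mult_assoc:
  assumes f: "f \<in> laurent_carrier R" and g: "g \<in> laurent_carrier R"
    and h: "h \<in> laurent_carrier R"
  shows "(f \<otimes>\<^bsub>laurent_ring R\<^esub> g) \<otimes>\<^bsub>laurent_ring R\<^esub> h
    = f \<otimes>\<^bsub>laurent_ring R\<^esub> (g \<otimes>\<^bsub>laurent_ring R\<^esub> h)"
proof
  fix k
  note fc = laurent_carrierD[OF f] and gc = laurent_carrierD[OF g]
    and hc = laurent_carrierD[OF h]
  define A where "A = {i. f i \<noteq> \<zero>}"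
  define B where "B = {i. g i \<noteq> \<zero>}"
  have fin: "finite A" "finite B" using fc gc by (auto simp: A_def B_def)
  define N where "N = {i. (f \<otimes>\<^bsub>laurent_ring R\<^esub> g) i \<noteq> \<zero>} \<union> (\<lambda>(i, j). i + j) ` (A \<times> B)"
  have N: "finite N" "{i. (f \<otimes>\<^bsub>laurent_ring R\<^esub> g) i \<noteq> \<zero>} \<subseteq> N"
    using fin laurent_carrierD(2)[OF laurent_mult_closed[OF f g]] by (auto simp: N_def)
  have eq: "(\<Oplus>n\<in>N. g (n - i) \<otimes> h (k - n)) = (g \<otimes>\<^bsub>laurent_ring R\<^esub> h) (k - i)"
    if i: "i \<in> A" for i
  proof -
    have "B \<subseteq> (\<lambda>n. n - i) ` N"
    proof
      fix j assume "j \<in> B"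
      then have "(i, j) \<in> A \<times> B" using i by simp
      then have "i + j \<in> N" unfolding N_def by (intro UnI2 rev_image_eqI) auto
      then show "j \<in> (\<lambda>n. n - i) ` N" by (rule rev_image_eqI) simp
    qed
    then have "(g \<otimes>\<^bsub>laurent_ring R\<^esub> h) (k - i) = (\<Oplus>j\<in>(\<lambda>n. n - i) ` N. g j \<otimes> h (k - i - j))"
      by (intro laurent_mult_eq[OF g h]) (use N in \<open>auto simp: B_def\<close>)
    also have "\<dots> = (\<Oplus>n\<in>N. g (n - i) \<otimes> h (k - i - (n - i)))"
      by (rule add.finprod_reindex) (use gc hc in \<open>auto simp: inj_on_def\<close>)
    finally show ?thesis by simp
  qed
  have "((f \<otimes>\<^bsub>laurent_ring R\<^esub> g) \<otimes>\<^bsub>laurent_ring R\<^esub> h) k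
      = (\<Oplus>n\<in>N. (f \<otimes>\<^bsub>laurent_ring R\<^esub> g) n \<otimes> h (k - n))"
    by (rule laurent_mult_eq[OF laurent_mult_closed[OF f g] h N])
  also have "\<dots> = (\<Oplus>n\<in>N. \<Oplus>i\<in>A. f i \<otimes> (g (n - i) \<otimes> h (k - n)))"
  proof (rule finsum_cong'[OF refl])
    fix n
    have "(f \<otimes>\<^bsub>laurent_ring R\<^esub> g) n = (\<Oplus>i\<in>A. f i \<otimes> g (n - i))"
      by (rule laurent_mult_eq[OF f g fin(1)]) (simp add: A_def)
    then have "(f \<otimes>\<^bsub>laurent_ring R\<^esub> g) n \<otimes> h (k - n) = (\<Oplus>i\<in>A. f i \<otimes> g (n - i) \<otimes> h (k - n))"
      using finsum_ldistr[OF fin(1), of "h (k - n)" "\<lambda>i. f i \<otimes> g (n - i)"] fc gc hc by auto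
    also have "\<dots> = (\<Oplus>i\<in>A. f i \<otimes> (g (n - i) \<otimes> h (k - n)))"
      by (rule finsum_cong') (use fc gc hc in \<open>auto simp: m_assoc\<close>)
    finally show "(f \<otimes>\<^bsub>laurent_ring R\<^esub> g) n \<otimes> h (k - n)
      = (\<Oplus>i\<in>A. f i \<otimes> (g (n - i) \<otimes> h (k - n)))" .
  qed (use fc gc hc in \<open>auto intro!: finsum_closed\<close>)
  also have "\<dots> = (\<Oplus>i\<in>A. \<Oplus>n\<in>N. f i \<otimes> (g (n - i) \<otimes> h (k - n)))"
    by (rule finsum_swap) (use N fin fc gc hc in auto)
  also have "\<dots> = (\<Oplus>i\<in>A. f i \<otimes> (g \<otimes>\<^bsub>laurent_ring R\<^esub> h) (k - i))"
  proof (rule finsum_cong'[OF refl])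
    fix i assume i: "i \<in> A"
    have "f i \<otimes> (\<Oplus>n\<in>N. g (n - i) \<otimes> h (k - n))
      = (\<Oplus>n\<in>N. f i \<otimes> (g (n - i) \<otimes> h (k - n)))"
      by (rule finsum_rdistr) (use N fc gc hc in auto)
    then show "(\<Oplus>n\<in>N. f i \<otimes> (g (n - i) \<otimes> h (k - n)))
      = f i \<otimes> (g \<otimes>\<^bsub>laurent_ring R\<^esub> h) (k - i)"
      by (simp add: eq[OF i])
  qed (use fc laurent_carrierD(1)[OF laurent_mult_closed[OF g h]] in auto)
  also have "\<dots> = (f \<otimes>\<^bsub>laurent_ring R\<^esub> (g \<otimes>\<^bsub>laurent_ring R\<^esub> h)) k"
    by (rule laurent_mult_eq[OF f laurent_mult_closed[OF g h] fin(1), symmetric])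
      (simp add: A_def)
  finally show "((f \<otimes>\<^bsub>laurent_ring R\<^esub> g) \<otimes>\<^bsub>laurent_ring R\<^esub> h) k
    = (f \<otimes>\<^bsub>laurent_ring R\<^esub> (g \<otimes>\<^bsub>laurent_ring R\<^esub> h)) k" .
qed

lemma laurent_add_closed:
  assumes f: "f \<in> laurent_carrier R" and g: "g \<in> laurent_carrier R"
  shows "(\<lambda>k. f k \<oplus> g k) \<in> laurent_carrier R"
  by (rule laurent_carrierI[where A = "{k. f k \<noteq> \<zero>} \<union> {k. g k \<noteq> \<zero>}"])
    (use laurent_carrierD[OF f] laurent_carrierD[OF g] in auto)

lemma laurent_one_closed: "(\<lambda>k. if k = 0 then \<one> else \<zero>) \<in> laurent_carrier R"
  by (rule laurent_carrierI[where A = "{0}"]) auto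

lemma laurent_l_one:
  assumes f: "f \<in> laurent_carrier R"
  shows "\<one>\<^bsub>laurent_ring R\<^esub> \<otimes>\<^bsub>laurent_ring R\<^esub> f = f"
proof
  fix k
  have one: "\<one>\<^bsub>laurent_ring R\<^esub> = (\<lambda>k. if k = 0 then \<one> else \<zero>)"
    by (simp add: laurent_ring_def)
  have "(\<one>\<^bsub>laurent_ring R\<^esub> \<otimes>\<^bsub>laurent_ring R\<^esub> f) k
      = (\<Oplus>i\<in>{0}. (if i = 0 then \<one> else \<zero>) \<otimes> f (k - i))"
    unfolding one by (rule laurent_mult_eq[OF laurent_one_closed f]) auto
  then show "(\<one>\<^bsub>laurent_ring R\<^esub> \<otimes>\<^bsub>laurent_ring R\<^esub> f) k = f k"
    using laurent_carrierD(1)[OF f] by simp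
qed

lemma laurent_l_distr:
  assumes f: "f \<in> laurent_carrier R" and g: "g \<in> laurent_carrier R"
    and h: "h \<in> laurent_carrier R"
  shows "(f \<oplus>\<^bsub>laurent_ring R\<^esub> g) \<otimes>\<^bsub>laurent_ring R\<^esub> h
    = (f \<otimes>\<^bsub>laurent_ring R\<^esub> h) \<oplus>\<^bsub>laurent_ring R\<^esub> (g \<otimes>\<^bsub>laurent_ring R\<^esub> h)"
proof
  fix k
  note fc = laurent_carrierD[OF f] and gc = laurent_carrierD[OF g]
    and hc = laurent_carrierD[OF h]
  define A where "A = {k. f k \<noteq> \<zero>} \<union> {k. g k \<noteq> \<zero>}"
  have A: "finite A" "{k. f k \<noteq> \<zero>} \<subseteq> A" "{k. g k \<noteq> \<zero>} \<subseteq> A" "{k. f k \<oplus> g k \<noteq> \<zero>} \<subseteq> A"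
    using fc gc by (auto simp: A_def)
  have add: "F \<oplus>\<^bsub>laurent_ring R\<^esub> G = (\<lambda>k. F k \<oplus> G k)" for F G
    by (simp add: laurent_ring_def)
  have "((\<lambda>k. f k \<oplus> g k) \<otimes>\<^bsub>laurent_ring R\<^esub> h) k = (\<Oplus>i\<in>A. (f i \<oplus> g i) \<otimes> h (k - i))"
    by (rule laurent_mult_eq[OF laurent_add_closed[OF f g] h A(1,4)])
  also have "\<dots> = (\<Oplus>i\<in>A. f i \<otimes> h (k - i) \<oplus> g i \<otimes> h (k - i))"
    by (rule finsum_cong') (use fc gc hc in \<open>auto simp: l_distr\<close>)
  also have "\<dots> = (\<Oplus>i\<in>A. f i \<otimes> h (k - i)) \<oplus> (\<Oplus>i\<in>A. g i \<otimes> h (k - i))"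
    by (rule finsum_addf) (use fc gc hc in auto)
  also have "\<dots> = (f \<otimes>\<^bsub>laurent_ring R\<^esub> h) k \<oplus> (g \<otimes>\<^bsub>laurent_ring R\<^esub> h) k"
    using laurent_mult_eq[OF f h A(1,2)] laurent_mult_eq[OF g h A(1,3)] by simp
  finally show "((f \<oplus>\<^bsub>laurent_ring R\<^esub> g) \<otimes>\<^bsub>laurent_ring R\<^esub> h) k
    = ((f \<otimes>\<^bsub>laurent_ring R\<^esub> h) \<oplus>\<^bsub>laurent_ring R\<^esub> (g \<otimes>\<^bsub>laurent_ring R\<^esub> h)) k"
    by (simp add: add)
qed

theorem laurent_ring_cring: "cring (laurent_ring R)"
proof (rule cringI)
  have carr: "carrier (laurent_ring R) = laurent_carrier R"
    and add: "F \<oplus>\<^bsub>laurent_ring R\<^esub> G = (\<lambda>k. F k \<oplus> G k)"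
    and zero: "\<zero>\<^bsub>laurent_ring R\<^esub> = (\<lambda>k. \<zero>)"
    and one: "\<one>\<^bsub>laurent_ring R\<^esub> = (\<lambda>k. if k = 0 then \<one> else \<zero>)" for F G
    by (simp_all add: laurent_ring_def)
  show "abelian_group (laurent_ring R)"
  proof (rule abelian_groupI, unfold carr add zero)
    show "(\<lambda>k. \<zero>) \<in> laurent_carrier R" by (rule laurent_carrierI[where A = "{}"]) auto
    fix f assume f: "f \<in> laurent_carrier R"
    show "\<exists>g\<in>laurent_carrier R. (\<lambda>k. g k \<oplus> f k) = (\<lambda>k. \<zero>)"
    proof
      show "(\<lambda>k. \<ominus> f k) \<in> laurent_carrier R"
        by (rule laurent_carrierI[where A = "{k. f k \<noteq> \<zero>}"])
          (use laurent_carrierD[OF f] in auto)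
      show "(\<lambda>k. \<ominus> f k \<oplus> f k) = (\<lambda>k. \<zero>)"
        using laurent_carrierD(1)[OF f] by (simp add: l_neg)
    qed
  qed (auto simp: laurent_add_closed laurent_carrierD(1) a_ac fun_eq_iff)
  show "comm_monoid (laurent_ring R)"
  proof (rule comm_monoidI, unfold carr)
    show "\<one>\<^bsub>laurent_ring R\<^esub> \<in> laurent_carrier R"
      unfolding one by (rule laurent_one_closed)
  qed (fact laurent_mult_closed laurent_mult_assoc laurent_l_one laurent_mult_comm)+
qed (simp add: laurent_l_distr laurent_ring_def[THEN arg_cong, of carrier, simplified])

end


section \<open>Free and stably free modules\<close>

definition finitely_generated_module ::
    "('a, 'b) ring_scheme \<Rightarrow> ('a, 'm, 'c) module_scheme \<Rightarrow> bool" where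
  "finitely_generated_module A M \<longleftrightarrow>
     (\<exists>S. finite S \<and> S \<subseteq> carrier M \<and> module.span A M S = carrier M)"

definition free_module ::
    "('a, 'b) ring_scheme \<Rightarrow> ('a, 'm, 'c) module_scheme \<Rightarrow> bool" where
  "free_module A M \<longleftrightarrow>
     (\<exists>B. B \<subseteq> carrier M \<and> \<not> module.lin_dep A M B \<and> module.span A M B = carrier M)"

definition module_isomorphic ::
    "('a, 'b) ring_scheme \<Rightarrow> ('a, 'm, 'c) module_scheme \<Rightarrow> ('a, 'n, 'd) module_scheme \<Rightarrow> bool"
  where "module_isomorphic A M N \<longleftrightarrow>
     (\<exists>f. f \<in> module_hom A M N \<and> bij_betw f (carrier M) (carrier N))"

text \<open>
  \<open>M\<close> is stably free of rank \<open>r\<close> if the direct sum of \<open>M\<close> and \<open>A ^ m\<close> is isomorphic to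
  \<open>A ^ (m + r)\<close> for some \<open>m\<close>; here \<open>ring.func_space A {..<n}\<close> is \<open>A ^ n\<close>.
\<close>

definition stably_free_of_rank ::
    "('a, 'b) ring_scheme \<Rightarrow> ('a, 'm, 'c) module_scheme \<Rightarrow> nat \<Rightarrow> bool" where
  "stably_free_of_rank A M r \<longleftrightarrow>
     (\<exists>m::nat. module_isomorphic A
        (direct_sum M (ring.func_space A {..<m})) (ring.func_space A {..<m + r}))"

end

theory Submission
  imports Defs "HOL-Computational_Algebra.Polynomial" "HOL-Library.Poly_Mapping"
begin

text \<open>
  Let \<open>A\<close> be the Laurent polynomial ring over \<open>R\<close>. A module \<open>M\<close> with \<open>M \<oplus> A ^ m\<close> isomorphic to
  \<open>A ^ (m + r)\<close> is freed from its free summand one coordinate at a time: the last basis vector of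
  \<open>A ^ m\<close> goes to a unimodular row \<open>v\<close> of length \<open>n = m + r\<close>, and if some automorphism of \<open>A ^ n\<close>
  moves \<open>v\<close> to a basis vector, that coordinate can be dropped on both sides
  (\<open>cancel_free_summand\<close>). As \<open>r > d\<close>, only rows of length at least \<open>d + 2\<close> occur, so it suffices
  that all of these can be completed to a basis (\<open>laurent_unimodular_completable\<close>).

  Multiplied by a power of \<open>X\<close>, such a row consists of polynomials \<open>F 0, \<dots>, F (n - 1)\<close> that
  generate an ideal containing a power of \<open>X\<close>. The reduction has two parts.

  The first part makes the last entry monic with constant term one (\<open>good_if_unimodular\<close>). Adding
  the other entries, shifted by different powers of \<open>X\<close>, to \<open>F 0\<close> produces an entry \<open>f\<close> whose
  coefficients generate the unit ideal. A prime of \<open>R[X]\<close> that contains \<open>f\<close> is not extended from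
  \<open>R\<close>, so chains of such primes contract to strict chains in \<open>R\<close> although \<open>R[X]\<close> itself can have
  dimension up to \<open>2 * d + 1\<close>. Moreover, over a maximal ideal of \<open>R\<close> such a prime contains a
  polynomial \<open>X ^ t * g\<close> with \<open>g\<close> monic of constant term one, because over a field every nonzero
  polynomial divides one of these. Hence the primes that contain \<open>f\<close> and no such polynomial form
  chains of length less than \<open>d\<close> (\<open>no_long_chain_double_monic\<close>), and the stable range theorem for
  this set of primes (\<open>stable_range\<close>) gives multiples of the last entry whose addition to the
  entries strictly between the first and the last makes all entries but the last generate some
  \<open>X ^ t * g\<close>. Adding a suitable multiple of \<open>X ^ t * g\<close> to the last entry makes that entry, up to
  a power of \<open>X\<close>, monic with constant term one.

  The second part is Suslin's theorem on unimodular rows over \<open>R[X]\<close> with a monic entry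
  (\<open>good_if_monic\<close>): such a row is equivalent to its value at \<open>0\<close>. The elements \<open>c\<close> of \<open>R\<close> for
  which substitutions congruent modulo \<open>c\<close> give equivalent rows form an ideal. It lies in no
  maximal ideal \<open>m\<close>: modulo \<open>m\<close> some combination \<open>w\<close> of the entries is coprime to the monic one,
  Nakayama's lemma then yields a constant outside \<open>m\<close> in the ideal generated by \<open>w\<close> and the monic
  entry, and an explicit matrix of determinant one shows that this constant belongs to the ideal.
  The constant term of the monic entry is one, so the value at \<open>0\<close> is equivalent to a basis vector.

  All computations with polynomials take place over the free commutative ring on the elements of
  \<open>R\<close>, modulo the ideal \<open>I\<close> of relations of \<open>R\<close>. This ring is a type, so that polynomials over it
  are again a type; only the final transfer deals with carrier sets.
\<close>

section \<open>Ideals, primes and chains of primes\<close>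

definition ideal_set :: "'t::comm_ring_1 set \<Rightarrow> bool" where
  "ideal_set J \<longleftrightarrow> 0 \<in> J \<and> (\<forall>x\<in>J. \<forall>y\<in>J. x + y \<in> J) \<and> (\<forall>x\<in>J. \<forall>r. r * x \<in> J)"

definition prime_set :: "'t::comm_ring_1 set \<Rightarrow> bool" where
  "prime_set P \<longleftrightarrow> ideal_set P \<and> 1 \<notin> P \<and> (\<forall>x y. x * y \<in> P \<longrightarrow> x \<in> P \<or> y \<in> P)"

definition adjoin :: "'t::comm_ring_1 set \<Rightarrow> 'i set \<Rightarrow> ('i \<Rightarrow> 't) \<Rightarrow> 't set" where
  "adjoin J A F = {x. \<exists>q. x - (\<Sum>i\<in>A. q i * F i) \<in> J}"

text \<open>
  The primes of the localization at \<open>U\<close> of the quotient by \<open>J\<close>, in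
  terms of the original ring.
\<close>
definition primes_over :: "'t::comm_ring_1 set \<Rightarrow> 't set \<Rightarrow> 't set set" where
  "primes_over J U = {P. prime_set P \<and> J \<subseteq> P \<and> P \<inter> U = {}}"

definition strict_chain :: "'t set set \<Rightarrow> nat \<Rightarrow> (nat \<Rightarrow> 't set) \<Rightarrow> bool" where
  "strict_chain X k P \<longleftrightarrow> (\<forall>i\<le>k. P i \<in> X) \<and> (\<forall>i<k. P i \<subset> P (Suc i))"

lemma ideal_setD:
  assumes "ideal_set J"
  shows "0 \<in> J" "x \<in> J \<Longrightarrow> y \<in> J \<Longrightarrow> x + y \<in> J" "x \<in> J \<Longrightarrow> r * x \<in> J" "x \<in> J \<Longrightarrow> x * r \<in> J"
    "x \<in> J \<Longrightarrow> - x \<in> J" "x \<in> J \<Longrightarrow> y \<in> J \<Longrightarrow> x - y \<in> J"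
proof -
  show 0: "0 \<in> J" and add: "\<And>x y. x \<in> J \<Longrightarrow> y \<in> J \<Longrightarrow> x + y \<in> J"
    and mult: "\<And>x r. x \<in> J \<Longrightarrow> r * x \<in> J"
    using assms by (auto simp: ideal_set_def)
  show "x * r \<in> J" if "x \<in> J" for x r using mult[OF that, of r] by (simp add: mult.commute)
  show neg: "- x \<in> J" if "x \<in> J" for x using mult[OF that, of "-1"] by simp
  show "x - y \<in> J" if "x \<in> J" "y \<in> J" for x y
    using add[OF that(1) neg[OF that(2)]] by simp
qed

lemma ideal_set_diff_iff:
  assumes "ideal_set J" "x - y \<in> J"
  shows "x \<in> J \<longleftrightarrow> y \<in> J"
  using ideal_setD(2)[OF assms, of y] ideal_setD(6)[OF assms(1) _ assms(2), of x] by auto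

lemma ideal_set_sum:
  assumes "ideal_set J" "\<And>i. i \<in> A \<Longrightarrow> f i \<in> J"
  shows "sum f A \<in> J"
  using assms(2)
  by (induction A rule: infinite_finite_induct) (auto intro: ideal_setD[OF assms(1)])

lemma prime_setD:
  assumes "prime_set P"
  shows "ideal_set P" "1 \<notin> P" "x * y \<in> P \<Longrightarrow> x \<in> P \<or> y \<in> P" "x ^ k \<in> P \<Longrightarrow> x \<in> P"
proof -
  show 1: "1 \<notin> P" and 2: "x * y \<in> P \<Longrightarrow> x \<in> P \<or> y \<in> P" and "ideal_set P" for x y
    using assms by (auto simp: prime_set_def)
  show "x ^ k \<in> P \<Longrightarrow> x \<in> P"
    by (induction k) (use 1 2 in auto)
qed

lemma ideal_adjoin:
  assumes J: "ideal_set J"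
  shows "ideal_set (adjoin J A F)"
  unfolding ideal_set_def
proof (intro conjI ballI allI)
  show "0 \<in> adjoin J A F"
    unfolding adjoin_def by (rule CollectI, rule exI[of _ "\<lambda>_. 0"]) (simp add: ideal_setD[OF J])
  fix x assume "x \<in> adjoin J A F"
  then obtain q where q: "x - (\<Sum>i\<in>A. q i * F i) \<in> J" by (auto simp: adjoin_def)
  show "r * x \<in> adjoin J A F" for r
    unfolding adjoin_def using ideal_setD(3)[OF J q, of r]
    by (intro CollectI exI[of _ "\<lambda>i. r * q i"]) (simp add: algebra_simps sum_distrib_left)
  fix y assume "y \<in> adjoin J A F"
  then obtain q' where q': "y - (\<Sum>i\<in>A. q' i * F i) \<in> J" by (auto simp: adjoin_def)
  show "x + y \<in> adjoin J A F"
    unfolding adjoin_def using ideal_setD(2)[OF J q q']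
    by (intro CollectI exI[of _ "\<lambda>i. q i + q' i"]) (simp add: algebra_simps sum.distrib)
qed

lemma adjoin_base: "ideal_set J \<Longrightarrow> J \<subseteq> adjoin J A F"
  unfolding adjoin_def by (rule subsetI, rule CollectI, rule exI[of _ "\<lambda>_. 0"]) simp

lemma adjoin_gen:
  assumes J: "ideal_set J" and "finite A" "i \<in> A"
  shows "F i \<in> adjoin J A F"
proof -
  have "(\<Sum>j\<in>A. (if j = i then 1 else 0) * F j) = F i"
    using assms by (simp add: if_distrib[of "\<lambda>u. u * _"] cong: if_cong)
  then show ?thesis
    unfolding adjoin_def
    by (intro CollectI exI[of _ "\<lambda>j. if j = i then 1 else 0"]) (simp add: ideal_setD[OF J])
qed

lemma adjoin_least:
  assumes P: "ideal_set P" and "J \<subseteq> P" "\<And>i. i \<in> A \<Longrightarrow> F i \<in> P"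
  shows "adjoin J A F \<subseteq> P"
proof
  fix x assume "x \<in> adjoin J A F"
  then obtain q where q: "x - (\<Sum>i\<in>A. q i * F i) \<in> J" by (auto simp: adjoin_def)
  have "(\<Sum>i\<in>A. q i * F i) \<in> P" using assms by (intro ideal_set_sum ideal_setD(3)) auto
  then have "x - (\<Sum>i\<in>A. q i * F i) + (\<Sum>i\<in>A. q i * F i) \<in> P"
    using q assms(2) by (intro ideal_setD(2)[OF P]) auto
  then show "x \<in> P" by simp
qed

text \<open>
  An ideal \<open>P\<close> that is maximal among those disjoint from \<open>S\<close> is
  prime: if \<open>x\<close> and \<open>y\<close> are not in \<open>P\<close>, then
  \<open>P\<close> enlarged by \<open>x\<close> and \<open>P\<close> enlarged by
  \<open>y\<close> both meet \<open>S\<close>, so the product of two elements of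
  \<open>S\<close> lies in \<open>P\<close> enlarged by \<open>x * y\<close>. The maximality
  is kept in the conclusion because it makes \<open>P\<close> a maximal ideal when
  \<open>S\<close> is \<open>{1}\<close>.
\<close>
theorem ideal_disjoint_prime:
  assumes J: "ideal_set J" and S: "1 \<in> S" "\<And>x y. x \<in> S \<Longrightarrow> y \<in> S \<Longrightarrow> x * y \<in> S"
    and disj: "J \<inter> S = {}"
  obtains P where "prime_set P" "J \<subseteq> P" "P \<inter> S = {}"
    "\<And>K. ideal_set K \<Longrightarrow> P \<subseteq> K \<Longrightarrow> K \<inter> S = {} \<Longrightarrow> K = P"
proof -
  define X where "X = {K. ideal_set K \<and> J \<subseteq> K \<and> K \<inter> S = {}}"
  have "\<exists>P\<in>X. \<forall>K\<in>X. P \<subseteq> K \<longrightarrow> K = P"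
  proof (rule subset_Zorn_nonempty)
    show "X \<noteq> {}" using J disj by (auto simp: X_def)
    fix C assume C: "C \<noteq> {}" "subset.chain X C"
    then have CX: "C \<subseteq> X" and tot: "\<And>K L. K \<in> C \<Longrightarrow> L \<in> C \<Longrightarrow> K \<subseteq> L \<or> L \<subseteq> K"
      by (auto simp: subset.chain_def)
    have id: "ideal_set K" if "K \<in> C" for K using that CX by (auto simp: X_def)
    have "ideal_set (\<Union>C)"
      unfolding ideal_set_def
    proof (intro conjI ballI allI)
      show "0 \<in> \<Union>C" using C(1) id ideal_setD(1) by fastforce
      fix x assume "x \<in> \<Union>C"
      then obtain K where K: "K \<in> C" "x \<in> K" by auto
      show "r * x \<in> \<Union>C" for r using K id ideal_setD(3) by blast
      fix y assume "y \<in> \<Union>C"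
      then obtain L where L: "L \<in> C" "y \<in> L" by auto
      show "x + y \<in> \<Union>C"
        using tot[OF K(1) L(1)] K L ideal_setD(2)[OF id] by blast
    qed
    then show "\<Union>C \<in> X" using C(1) CX by (fastforce simp: X_def)
  qed
  then obtain P where P: "P \<in> X" and max: "\<And>K. K \<in> X \<Longrightarrow> P \<subseteq> K \<Longrightarrow> K = P" by blast
  have idP: "ideal_set P" "J \<subseteq> P" "P \<inter> S = {}" using P by (auto simp: X_def)
  have meet: "\<exists>s\<in>S. \<exists>a. s - a * x \<in> P" if "x \<notin> P" for x
  proof (rule ccontr)
    assume no: "\<not> ?thesis"
    let ?K = "adjoin P {()} (\<lambda>_. x)"
    have "?K \<inter> S = {}" using no by (auto simp: adjoin_def)
    then have "?K \<in> X"
      using ideal_adjoin[OF idP(1), of "{()}" "\<lambda>_. x"] idP(2)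
        adjoin_base[OF idP(1), of "{()}" "\<lambda>_. x"]
      by (auto simp: X_def)
    then have "?K = P" using max adjoin_base[OF idP(1)] by blast
    then show False using adjoin_gen[OF idP(1), of "{()}" "()" "\<lambda>_. x"] that by auto
  qed
  have "prime_set P"
    unfolding prime_set_def
  proof (intro conjI allI impI)
    show "1 \<notin> P" using idP(3) S(1) by auto
    fix x y assume xy: "x * y \<in> P"
    show "x \<in> P \<or> y \<in> P"
    proof (rule ccontr)
      assume "\<not> ?thesis"
      then obtain s a t b where s: "s \<in> S" "s - a * x \<in> P" and t: "t \<in> S" "t - b * y \<in> P"
        using meet by meson
      have "s * t = t * (s - a * x) + (a * x) * (t - b * y) + (a * b) * (x * y)"
        by (simp add: algebra_simps)
      also have "\<dots> \<in> P" using s t xy idP(1) by (meson ideal_setD(2,3))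
      finally show False using S(2)[OF s(1) t(1)] idP(3) by auto
    qed
  qed (fact idP)
  then show thesis using that[of P] idP max by (auto simp: X_def)
qed

lemma ideal_in_prime:
  assumes "ideal_set K" "1 \<notin> K"
  shows "\<exists>Q. prime_set Q \<and> K \<subseteq> Q"
  by (rule ideal_disjoint_prime[of K "{1}"]) (use assms in auto)

lemma ideal_in_maximal:
  assumes "ideal_set J" "1 \<notin> J"
  shows "\<exists>m. prime_set m \<and> J \<subseteq> m \<and> (\<forall>K. ideal_set K \<longrightarrow> m \<subseteq> K \<longrightarrow> 1 \<notin> K \<longrightarrow> K = m)"
proof (rule ideal_disjoint_prime[of J "{1}"])
  fix P assume P: "prime_set P" "J \<subseteq> P"
    and max: "\<And>K. ideal_set K \<Longrightarrow> P \<subseteq> K \<Longrightarrow> K \<inter> {1} = {} \<Longrightarrow> K = P"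
  have "K = P" if "ideal_set K" "P \<subseteq> K" "1 \<notin> K" for K using max[OF that(1,2)] that(3) by simp
  then show ?thesis using P by blast
qed (use assms in auto)

lemma strict_chain_prefix: "strict_chain X k P \<Longrightarrow> j \<le> k \<Longrightarrow> strict_chain X j P"
  by (auto simp: strict_chain_def)

section \<open>The stable range theorem\<close>

text \<open>
  Induction on the chain length, following the proof of Bass' stable range theorem without
  Noetherian hypothesis. Let \<open>Z\<close> be the annihilator of \<open>a k\<close>
  modulo the intersection of all primes in question. A prime that contains both
  \<open>a k\<close> and \<open>Z\<close> is not minimal, so enlarging \<open>J\<close> to
  the ideal \<open>N\<close> generated by \<open>Z\<close> and \<open>a k\<close> shortens
  all chains by one. The induction hypothesis for \<open>N\<close> writes some
  \<open>u * b ^ j\<close> with \<open>u\<close> in \<open>U\<close> as a combination of the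
  \<open>a i + h i * b\<close> for \<open>i < k\<close>, of \<open>a k\<close>, and of an
  element \<open>z\<close> of \<open>Z\<close>. This \<open>z\<close> is the last
  multiplier: every prime in question contains \<open>z * a k\<close>, hence
  \<open>z\<close> or \<open>a k\<close>, and if it contains \<open>a k + z * b\<close> but
  not \<open>b\<close>, then it contains both, hence also \<open>u * b ^ j\<close>, and
  therefore \<open>b\<close>.
\<close>
lemma stable_range:
  assumes "ideal_set J" and U: "1 \<in> U" "\<And>x y. x \<in> U \<Longrightarrow> y \<in> U \<Longrightarrow> x * y \<in> U"
    and "\<nexists>P. strict_chain (primes_over J U) k P"
  shows "\<exists>h. \<forall>P\<in>primes_over J U. (\<forall>i<k. a i + h i * b \<in> P) \<longrightarrow> b \<in> P"
  using assms(1,4)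
proof (induction k arbitrary: J)
  case 0
  then have "primes_over J U = {}" by (auto simp: strict_chain_def)
  then show ?case by simp
next
  case (Suc k)
  note J = Suc.prems(1)
  define Z where "Z = {z. \<forall>P\<in>primes_over J U. z * a k \<in> P}"
  define N where "N = adjoin Z {()} (\<lambda>_. a k)"
  have pr: "prime_set P" "ideal_set P" "J \<subseteq> P" "P \<inter> U = {}" if "P \<in> primes_over J U" for P
    using that prime_setD by (auto simp: primes_over_def)
  have Z: "ideal_set Z"
    unfolding ideal_set_def Z_def
    using pr(2) by (auto simp: distrib_right mult.assoc intro: ideal_setD)
  have JZ: "J \<subseteq> Z" using pr by (auto simp: Z_def intro!: ideal_setD)
  have N: "ideal_set N" "Z \<subseteq> N" "a k \<in> N"
    using ideal_adjoin[OF Z, of "{()}" "\<lambda>_. a k"] adjoin_base[OF Z, of "{()}" "\<lambda>_. a k"]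
      adjoin_gen[OF Z, of "{()}" "()" "\<lambda>_. a k"]
    by (auto simp: N_def)
  have sub: "primes_over N U \<subseteq> primes_over J U" using JZ N(2) by (auto simp: primes_over_def)
  have "\<nexists>Q. strict_chain (primes_over N U) k Q"
  proof
    assume "\<exists>Q. strict_chain (primes_over N U) k Q"
    then obtain Q where Q: "strict_chain (primes_over N U) k Q" ..
    then have "Q 0 \<in> primes_over N U" by (auto simp: strict_chain_def)
    then have Q0: "prime_set (Q 0)" "N \<subseteq> Q 0" "Q 0 \<inter> U = {}" by (auto simp: primes_over_def)
    \<comment> \<open>A prime that contains \<open>J\<close> and is disjoint from \<open>S\<close> lies
      inside \<open>Q 0\<close> and avoids \<open>a k\<close>, so it extends the chain
      downwards.\<close>
    define S where "S = {z * a k ^ j | z j. z \<notin> Q 0}"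
    have "1 = 1 * a k ^ 0" by simp
    then have S1: "1 \<in> S" using prime_setD(2)[OF Q0(1)] unfolding S_def by blast
    have Smult: "x * y \<in> S" if xy: "x \<in> S" "y \<in> S" for x y
    proof -
      obtain z j z' j' where z: "x = z * a k ^ j" "z \<notin> Q 0" "y = z' * a k ^ j'" "z' \<notin> Q 0"
        using xy by (auto simp: S_def)
      then have "x * y = (z * z') * a k ^ (j + j')" by (simp add: power_add algebra_simps)
      moreover have "z * z' \<notin> Q 0" using z prime_setD(3)[OF Q0(1)] by blast
      ultimately show ?thesis unfolding S_def by blast
    qed
    have disj: "J \<inter> S = {}"
    proof (rule ccontr)
      assume "J \<inter> S \<noteq> {}"
      then obtain z j where z: "z \<notin> Q 0" "z * a k ^ j \<in> J" by (auto simp: S_def)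
      have "z * a k \<in> P" if P: "P \<in> primes_over J U" for P
      proof -
        have "z * a k ^ j \<in> P" using z pr(3)[OF P] by auto
        then have "z \<in> P \<or> a k \<in> P" using prime_setD(3,4)[OF pr(1)[OF P]] by blast
        then show ?thesis using ideal_setD[OF pr(2)[OF P]] by blast
      qed
      then have "z \<in> Z" by (auto simp: Z_def)
      then show False using z(1) N(2) Q0(2) by auto
    qed
    obtain P where P: "prime_set P" "J \<subseteq> P" "P \<inter> S = {}"
      using ideal_disjoint_prime[OF J S1 Smult disj] by metis
    have PS: "z * a k ^ j \<notin> P" if "z \<notin> Q 0" for z j
      using P(3) that by (auto simp: S_def)
    have "P \<subseteq> Q 0" using PS[of _ 0] by auto
    moreover have "a k \<notin> P" using PS[of 1 1] prime_setD(2)[OF Q0(1)] by simp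
    ultimately have lt: "P \<subset> Q 0" using N(3) Q0(2) by blast
    then have "P \<in> primes_over J U" using P Q0(3) by (auto simp: primes_over_def)
    then have "strict_chain (primes_over J U) (Suc k) (case_nat P Q)"
      using Q lt sub unfolding strict_chain_def by (auto split: nat.split)
    then show False using Suc.prems(2) by blast
  qed
  then obtain h where h: "\<And>P. P \<in> primes_over N U \<Longrightarrow> (\<forall>i<k. a i + h i * b \<in> P) \<Longrightarrow> b \<in> P"
    using Suc.IH[OF N(1)] by blast
  define K where "K = adjoin N {..<k} (\<lambda>i. a i + h i * b)"
  \<comment> \<open>A prime that contains \<open>K\<close> and avoids \<open>S\<close> would contradict
    the choice of \<open>h\<close>.\<close>
  define S where "S = {u * b ^ j | u j. u \<in> U}"
  have idK: "ideal_set K" and NK: "N \<subseteq> K" and aK: "\<And>i. i < k \<Longrightarrow> a i + h i * b \<in> K"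
    using ideal_adjoin[OF N(1), of "{..<k}" "\<lambda>i. a i + h i * b"]
      adjoin_base[OF N(1), of "{..<k}" "\<lambda>i. a i + h i * b"]
      adjoin_gen[OF N(1), of "{..<k}" _ "\<lambda>i. a i + h i * b"] by (auto simp: K_def)
  have "1 = 1 * b ^ 0" "b = 1 * b ^ 1" by simp_all
  then have S1: "1 \<in> S" "b \<in> S" using U(1) unfolding S_def by blast+
  have US: "u \<in> S" if "u \<in> U" for u using that unfolding S_def by (intro CollectI exI[of _ u] exI[of _ 0]) simp
  have Smult: "x * y \<in> S" if xy: "x \<in> S" "y \<in> S" for x y
  proof -
    obtain u j u' j' where u: "x = u * b ^ j" "u \<in> U" "y = u' * b ^ j'" "u' \<in> U"
      using xy by (auto simp: S_def)
    then have "x * y = (u * u') * b ^ (j + j')" by (simp add: power_add algebra_simps)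
    then show ?thesis using U(2) u unfolding S_def by blast
  qed
  have "K \<inter> S \<noteq> {}"
  proof
    assume disj: "K \<inter> S = {}"
    obtain P where P: "prime_set P" "K \<subseteq> P" "P \<inter> S = {}"
      using ideal_disjoint_prime[OF idK S1(1) Smult disj] by metis
    then have "P \<in> primes_over N U" using NK US by (auto simp: primes_over_def)
    then have "b \<in> P" using h aK P(2) by blast
    then show False using P(3) S1(2) by auto
  qed
  then obtain u j where u: "u \<in> U" "u * b ^ j \<in> K" by (auto simp: S_def)
  then obtain q where "u * b ^ j - (\<Sum>i<k. q i * (a i + h i * b)) \<in> N" by (auto simp: K_def adjoin_def)
  then obtain y where z: "u * b ^ j - (\<Sum>i<k. q i * (a i + h i * b)) - y * a k \<in> Z"
    by (auto simp: N_def adjoin_def)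
  define z where "z = u * b ^ j - (\<Sum>i<k. q i * (a i + h i * b)) - y * a k"
  show ?case
  proof (intro exI[of _ "h(k := z)"] ballI impI)
    fix P assume P: "P \<in> primes_over J U" and gen: "\<forall>i<Suc k. a i + (h(k := z)) i * b \<in> P"
    note id = ideal_setD[OF pr(2)[OF P]] and prm = prime_setD[OF pr(1)[OF P]]
    have "a i + h i * b \<in> P" if "i < k" for i using gen[rule_format, of i] that by simp
    then have gens: "(\<Sum>i<k. q i * (a i + h i * b)) \<in> P"
      by (intro ideal_set_sum[OF pr(2)[OF P]] id(3)) auto
    have last: "a k + z * b \<in> P" using gen by auto
    have both: "b \<in> P" if "z \<in> P" "a k \<in> P"
    proof -
      have "z + (\<Sum>i<k. q i * (a i + h i * b)) + y * a k \<in> P"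
        using that gens by (intro id(2) id(3))
      then have "u * b ^ j \<in> P" by (simp add: z_def)
      then show ?thesis using prm(3,4) u(1) pr(4)[OF P] by blast
    qed
    have "z * a k \<in> P" using z P by (auto simp: Z_def z_def)
    then consider "z \<in> P" | "a k \<in> P" using prm(3) by blast
    then show "b \<in> P"
    proof cases
      case 1
      then have "a k + z * b - z * b \<in> P" using last by (intro id(6) id(4))
      then show ?thesis using both 1 by simp
    next
      case 2
      then have "a k + z * b - a k \<in> P" using last by (intro id(6))
      then have "z \<in> P \<or> b \<in> P" using prm(3) by simp
      then show ?thesis using both 2 by blast
    qed
  qed
qed

section \<open>Prime ideals of a polynomial ring\<close>

text \<open>
  The extension of \<open>I\<close> to the polynomial ring, that is, the kernel of the
  reduction of coefficients modulo \<open>I\<close>.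
\<close>
definition coeff_ideal :: "'r::comm_ring_1 set \<Rightarrow> 'r poly set" where
  "coeff_ideal I = {f. \<forall>i. coeff f i \<in> I}"

definition contraction :: "'r::comm_ring_1 poly set \<Rightarrow> 'r set" where
  "contraction P = {c. [:c:] \<in> P}"

lemma ideal_coeff_ideal:
  assumes I: "ideal_set I"
  shows "ideal_set (coeff_ideal I)"
  unfolding ideal_set_def coeff_ideal_def
  by (auto simp: coeff_mult intro!: ideal_set_sum[OF I] ideal_setD(1,2,3)[OF I])

lemma coeff_ideal_mono: "I \<subseteq> K \<Longrightarrow> coeff_ideal I \<subseteq> coeff_ideal K"
  by (auto simp: coeff_ideal_def)

lemma prime_contraction:
  assumes "prime_set P"
  shows "prime_set (contraction P)"
proof -
  note id = ideal_setD[OF prime_setD(1)[OF assms]]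
  have "[:x + y:] \<in> P" if "[:x:] \<in> P" "[:y:] \<in> P" for x y
    using id(2)[OF that] by simp
  moreover have "[:r * x:] \<in> P" if "[:x:] \<in> P" for r x
    using id(3)[OF that, of "[:r:]"] by (simp add: mult.commute)
  moreover have "[:x:] \<in> P \<or> [:y:] \<in> P" if "[:x * y:] \<in> P" for x y
    using prime_setD(3)[OF assms, of "[:x:]" "[:y:]"] that by (simp add: mult.commute)
  ultimately show ?thesis
    using id(1) prime_setD(2)[OF assms]
    by (auto simp: prime_set_def ideal_set_def contraction_def one_pCons)
qed

lemma poly_in_ideal_if_monoms:
  assumes J: "ideal_set J" and "\<And>i. monom (coeff f i) i \<in> J"
  shows "f \<in> J"
  using ideal_set_sum[OF J, of "{..degree f}" "\<lambda>i. monom (coeff f i) i"] assms(2)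
  by (simp add: poly_as_sum_of_monoms)

lemma coeff_ideal_contraction:
  assumes P: "ideal_set P"
  shows "coeff_ideal (contraction P) \<subseteq> P"
proof
  fix f assume f: "f \<in> coeff_ideal (contraction P)"
  have "monom (coeff f i) i \<in> P" for i
  proof -
    have "[:coeff f i:] * monom 1 i \<in> P"
      using f by (intro ideal_setD(4)[OF P]) (simp add: coeff_ideal_def contraction_def)
    then show ?thesis by (simp add: smult_monom)
  qed
  then show "f \<in> P" by (rule poly_in_ideal_if_monoms[OF P])
qed

text \<open>
  Leading terms with coefficient in \<open>p\<close> can be dropped one after the other.
\<close>
lemma leading_part_mod_coeff_ideal:
  assumes p: "ideal_set p"
  shows "\<exists>f'. f - f' \<in> coeff_ideal p \<and> degree f' \<le> degree f \<and> (f' = 0 \<or> lead_coeff f' \<notin> p)"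
proof (induction "degree f" arbitrary: f rule: less_induct)
  case less
  note ext = ideal_setD[OF ideal_coeff_ideal[OF p]]
  let ?n = "degree f"
  show ?case
  proof (cases "f = 0 \<or> lead_coeff f \<notin> p")
    case True
    then show ?thesis using ext(1) by (intro exI[of _ f]) auto
  next
    case False
    define g where "g = f - monom (lead_coeff f) ?n"
    have fg: "f - g \<in> coeff_ideal p"
      using False ideal_setD(1)[OF p] by (auto simp: g_def coeff_ideal_def)
    show ?thesis
    proof (cases "?n = 0")
      case True
      then have "f = monom (lead_coeff f) ?n" by (auto simp: monom_0 elim: degree_eq_zeroE)
      then have "f \<in> coeff_ideal p" using fg by (simp add: g_def)
      then show ?thesis by (intro exI[of _ 0]) auto
    next
      case n: False
      have "degree g \<le> ?n"
        unfolding g_def by (intro degree_diff_le order.refl degree_monom_le)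
      then have "degree g < ?n"
        using eq_zero_or_degree_less[of g ?n] n by (auto simp: g_def)
      then obtain g' where g': "g - g' \<in> coeff_ideal p" "degree g' \<le> degree g"
        "g' = 0 \<or> lead_coeff g' \<notin> p" using less by blast
      have "f - g' \<in> coeff_ideal p" using ext(2)[OF fg g'(1)] by simp
      then show ?thesis using g' \<open>degree g < ?n\<close> by (intro exI[of _ g']) auto
    qed
  qed
qed

text \<open>
  Over the residue field of the common contraction \<open>p\<close>, the primes
  \<open>P\<close> and \<open>Q\<close> correspond to primes of a polynomial ring in one
  variable over a field, and \<open>P\<close> to a nonzero one, hence to a maximal one. The
  Euclidean argument behind this is carried out with pseudo-division by polynomials whose
  leading coefficient is not in \<open>p\<close>.
\<close>
lemma primes_incomparable:
  assumes P: "prime_set P" and Q: "prime_set Q" and PQ: "P \<subseteq> Q"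
    and contr: "contraction Q \<subseteq> contraction P"
    and f: "f \<in> P" "f \<notin> coeff_ideal (contraction P)"
  shows "Q \<subseteq> P"
proof (rule ccontr)
  assume nQP: "\<not> Q \<subseteq> P"
  define p where "p = contraction P"
  define E where "E = coeff_ideal p"
  have p: "prime_set p" "ideal_set p" using prime_contraction[OF P] prime_setD(1) by (auto simp: p_def)
  note idP = ideal_setD[OF prime_setD(1)[OF P]] and idQ = ideal_setD[OF prime_setD(1)[OF Q]]
  have E: "ideal_set E" "E \<subseteq> P"
    using ideal_coeff_ideal[OF p(2)] coeff_ideal_contraction[OF prime_setD(1)[OF P]]
    by (auto simp: E_def p_def)
  note idE = ideal_setD[OF E(1)]
  have cP: "[:c:] \<in> P \<longleftrightarrow> c \<in> p" for c by (simp add: p_def contraction_def)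
  have cQ: "[:c:] \<in> Q \<Longrightarrow> c \<in> p" for c using contr by (auto simp: p_def contraction_def)
  \<comment> \<open>\<open>f1\<close> has least degree in \<open>P - E\<close> and \<open>g1\<close> has
    least degree in \<open>Q - P\<close>; both are chosen with leading coefficient outside
    \<open>p\<close>.\<close>
  obtain f0 where f0: "f0 \<in> P" "f0 \<notin> E"
    and f0min: "\<And>g. g \<in> P \<Longrightarrow> g \<notin> E \<Longrightarrow> degree f0 \<le> degree g"
    using ex_has_least_nat[of "\<lambda>f. f \<in> P \<and> f \<notin> E" f degree] f by (auto simp: E_def p_def)
  obtain f1 where f1: "f0 - f1 \<in> E" "degree f1 \<le> degree f0" "f1 = 0 \<or> lead_coeff f1 \<notin> p"
    using leading_part_mod_coeff_ideal[OF p(2), of f0] by (auto simp: E_def)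
  have f1P: "f1 \<in> P"
    using ideal_set_diff_iff[OF prime_setD(1)[OF P], of f0 f1] f0(1) f1(1) E(2) by auto
  have "f1 \<noteq> 0" using f1(1) f0(2) by auto
  then have f1lc: "lead_coeff f1 \<notin> p" using f1(3) by auto
  have f1min: "degree f1 \<le> degree g" if "g \<in> P" "g \<notin> E" for g using f0min[OF that] f1(2) by simp
  obtain g0 where g0: "g0 \<in> Q" "g0 \<notin> P"
    and g0min: "\<And>g. g \<in> Q \<Longrightarrow> g \<notin> P \<Longrightarrow> degree g0 \<le> degree g"
    using nQP ex_has_least_nat[of "\<lambda>f. f \<in> Q \<and> f \<notin> P" _ degree] by (metis subsetI)
  obtain g1 where g1: "g0 - g1 \<in> E" "degree g1 \<le> degree g0" "g1 = 0 \<or> lead_coeff g1 \<notin> p"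
    using leading_part_mod_coeff_ideal[OF p(2), of g0] by (auto simp: E_def)
  have g1Q: "g1 \<in> Q" and g1P: "g1 \<notin> P"
    using ideal_set_diff_iff[OF prime_setD(1)[OF Q], of g0 g1]
      ideal_set_diff_iff[OF prime_setD(1)[OF P], of g0 g1] g0 g1(1) E(2) PQ by auto
  then have "g1 \<noteq> 0" using idP(1) by auto
  then have g1lc: "lead_coeff g1 \<notin> p" using g1(3) by auto
  have g1min: "degree g1 \<le> degree g" if "g \<in> Q" "g \<notin> P" for g using g0min[OF that] g1(2) by simp
  have g1deg: "degree g1 \<noteq> 0"
  proof
    assume "degree g1 = 0"
    then obtain c where c: "g1 = [:c:]" by (rule degree_eq_zeroE)
    then show False using cQ cP g1Q g1P by simp
  qed
  have pow: "c ^ k \<notin> p" if "c \<notin> p" for c k using that prime_setD(4)[OF p(1)] by blast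
  \<comment> \<open>The remainder lies in \<open>Q - P\<close>, so the minimality of \<open>g1\<close>
    forces \<open>degree g1 < degree f1\<close>.\<close>
  obtain q r where "pseudo_divmod g1 f1 = (q, r)" by force
  note div1 = pseudo_divmod[OF \<open>f1 \<noteq> 0\<close> this]
  let ?a = "lead_coeff f1 ^ (Suc (degree g1) - degree f1)"
  have r: "r = [:?a:] * g1 - f1 * q" using div1(1) by simp
  have rQ: "r \<in> Q" unfolding r using g1Q f1P PQ by (intro idQ(6) idQ(3) idQ(4)) auto
  have rP: "r \<notin> P"
  proof
    assume "r \<in> P"
    then have "r + f1 * q \<in> P" using f1P by (intro idP(2) idP(4)) auto
    then have "[:?a:] * g1 \<in> P" by (simp add: r)
    then have "[:?a:] \<in> P \<or> g1 \<in> P" by (rule prime_setD(3)[OF P])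
    then show False using g1P cP pow[OF f1lc] by blast
  qed
  then have "r \<noteq> 0" using idP(1) by auto
  then have deg: "degree g1 < degree f1" using div1(2) g1min[OF rQ rP] by simp
  \<comment> \<open>Now the remainder lies in \<open>P\<close> and has degree below that of
    \<open>f1\<close>, so it lies in \<open>E\<close>; the same follows for the quotient,
    and then for \<open>f1\<close>.\<close>
  obtain q' r' where "pseudo_divmod f1 g1 = (q', r')" by force
  note div2 = pseudo_divmod[OF \<open>g1 \<noteq> 0\<close> this]
  let ?b = "lead_coeff g1 ^ (Suc (degree f1) - degree g1)"
  have r': "r' = [:?b:] * f1 - g1 * q'" using div2(1) by simp
  have r'Q: "r' \<in> Q" unfolding r' using g1Q f1P PQ by (intro idQ(6) idQ(3) idQ(4)) auto
  have r'deg: "r' = 0 \<or> degree r' < degree g1" by (rule div2(2))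
  have r'P: "r' \<in> P" using g1min[OF r'Q] r'deg idP(1) by fastforce
  have r'E: "r' \<in> E" using f1min[OF r'P] r'deg idE(1) deg by fastforce
  have "[:?b:] * f1 - r' \<in> P" using f1P r'P by (intro idP(6) idP(3))
  then have "g1 * q' \<in> P" by (simp add: r')
  then have q'P: "q' \<in> P" using prime_setD(3)[OF P] g1P by blast
  have q'E: "q' \<in> E"
  proof (rule ccontr)
    assume q'E: "q' \<notin> E"
    obtain s where s: "q' - s \<in> E" "degree s \<le> degree q'" "s = 0 \<or> lead_coeff s \<notin> p"
      using leading_part_mod_coeff_ideal[OF p(2), of q'] by (auto simp: E_def)
    have "s \<noteq> 0" using s(1) q'E by auto
    then have slc: "lead_coeff s \<notin> p" using s(3) by auto
    have sP: "s \<in> P"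
      using ideal_set_diff_iff[OF prime_setD(1)[OF P], of q' s] q'P s(1) E(2) by auto
    have "s \<notin> E" using slc by (auto simp: E_def coeff_ideal_def)
    then have sdeg: "degree f1 \<le> degree s" using f1min[OF sP] by simp
    let ?n = "degree g1 + degree s"
    have "g1 * (q' - s) \<in> E" using s(1) by (rule idE(3))
    then have 1: "coeff (g1 * (q' - s)) ?n \<in> p" by (simp add: E_def coeff_ideal_def)
    have "degree f1 < ?n" "degree r' < ?n" using sdeg g1deg r'deg deg by auto
    then have "coeff ([:?b:] * f1 - r') ?n = 0" by (simp add: coeff_eq_0)
    then have "coeff (g1 * q') ?n = 0" by (simp add: r')
    then have "coeff (g1 * s) ?n = - coeff (g1 * (q' - s)) ?n" by (simp add: algebra_simps)
    then have "lead_coeff g1 * lead_coeff s \<in> p"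
      using ideal_setD(5)[OF p(2) 1] by (simp add: coeff_mult_degree_sum)
    then show False using prime_setD(3)[OF p(1)] g1lc slc by blast
  qed
  have "g1 * q' + r' \<in> E" using q'E r'E by (intro idE(2) idE(3))
  then have "smult ?b f1 \<in> E" by (simp add: r')
  then have "?b * lead_coeff f1 \<in> p" unfolding E_def coeff_ideal_def by (metis (mono_tags, lifting) coeff_smult mem_Collect_eq)
  then show False using prime_setD(3)[OF p(1)] pow[OF g1lc] f1lc by blast
qed

section \<open>Double monic polynomials\<close>

text \<open>
  Up to powers of \<open>X\<close>, the Laurent polynomials whose highest and lowest
  coefficients are one. The powers of \<open>X\<close> belong to the set, so the primes
  disjoint from it correspond to primes of the Laurent polynomial ring.
\<close>
definition double_monic :: "'r::comm_ring_1 poly set" where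
  "double_monic = {monom 1 t * g | t g. lead_coeff g = 1 \<and> coeff g 0 = 1}"

lemma double_monic_monom: "monom 1 t \<in> double_monic"
  unfolding double_monic_def by (intro CollectI exI[of _ t] exI[of _ 1]) auto

lemma double_monic_one: "1 \<in> double_monic"
  using double_monic_monom[of 0] by (simp add: monom_0 one_pCons)

lemma double_monic_mult:
  assumes "x \<in> double_monic" "y \<in> double_monic"
  shows "x * y \<in> double_monic"
proof -
  obtain t g t' g' where g: "x = monom 1 t * g" "lead_coeff g = 1" "coeff g 0 = 1"
    and g': "y = monom 1 t' * g'" "lead_coeff g' = 1" "coeff g' 0 = 1"
    using assms by (auto simp: double_monic_def)
  have top: "coeff (g * g') (degree g + degree g') = 1"
    using g g' by (simp add: coeff_mult_degree_sum)
  then have "degree (g * g') = degree g + degree g'"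
    using degree_mult_le[of g g'] le_degree[of "g * g'" "degree g + degree g'"] by simp
  then have "lead_coeff (g * g') = 1" using top by simp
  moreover have "coeff (g * g') 0 = 1" using g g' by (simp add: coeff_mult_0)
  moreover have "x * y = monom 1 (t + t') * (g * g')"
  proof -
    have "monom 1 (t + t') = monom (1::'a) t * monom 1 t'" by (simp add: mult_monom)
    then show ?thesis using g(1) g'(1) by (simp add: algebra_simps)
  qed
  ultimately show ?thesis unfolding double_monic_def by blast
qed

text \<open>
  Let \<open>coeff f t\<close> and \<open>coeff f N\<close> be the lowest and the highest
  coefficient outside \<open>m\<close>, with inverses \<open>\<beta>\<close> and
  \<open>\<alpha>\<close> modulo \<open>m\<close>. The two inverses differ in general; the
  factor \<open>\<beta> + \<alpha> * X\<close> normalizes both ends at once, since modulo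
  \<open>m\<close> the lowest coefficient of the product involves only
  \<open>\<beta>\<close> and the highest only \<open>\<alpha>\<close>.
\<close>
lemma double_monic_mod_maximal:
  assumes m: "ideal_set m" and inv: "\<And>c. c \<notin> m \<Longrightarrow> \<exists>c'. 1 - c' * c \<in> m"
    and f: "f \<notin> coeff_ideal m"
  shows "\<exists>h. \<exists>g\<in>double_monic. h * f - g \<in> coeff_ideal m"
proof -
  define A where "A = {i. coeff f i \<notin> m}"
  have "A \<subseteq> {..degree f}"
    using ideal_setD(1)[OF m] by (auto simp: A_def intro: le_degree)
  then have fin: "finite A" by (rule finite_subset) simp
  have ne: "A \<noteq> {}" using f by (auto simp: A_def coeff_ideal_def)
  define N where "N = Max A"
  define t where "t = Min A"
  have NA: "N \<in> A" "t \<in> A" using fin ne by (auto simp: N_def t_def)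
  have tN: "t \<le> N" and out: "\<And>i. i < t \<Longrightarrow> coeff f i \<in> m" "\<And>i. N < i \<Longrightarrow> coeff f i \<in> m"
  proof -
    show "t \<le> N" using fin NA by (simp add: N_def)
    show "coeff f i \<in> m" if "i < t" for i
    proof (rule ccontr)
      assume "coeff f i \<notin> m"
      then have "t \<le> i" unfolding t_def by (intro Min_le fin) (simp add: A_def)
      then show False using that by simp
    qed
    show "coeff f i \<in> m" if "N < i" for i
    proof (rule ccontr)
      assume "coeff f i \<notin> m"
      then have "i \<le> N" unfolding N_def by (intro Max_ge fin) (simp add: A_def)
      then show False using that by simp
    qed
  qed
  obtain \<alpha> \<beta> where \<alpha>: "1 - \<alpha> * coeff f N \<in> m" and \<beta>: "1 - \<beta> * coeff f t \<in> m"
    using NA inv[of "coeff f N"] inv[of "coeff f t"] unfolding A_def by blast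
  define h where "h = [:\<beta>, \<alpha>:]"
  have hf: "coeff (h * f) i = \<beta> * coeff f i + (if i = 0 then 0 else \<alpha> * coeff f (i - 1))" for i
    by (cases i) (auto simp: h_def)
  \<comment> \<open>The coefficients of \<open>h * f\<close>, corrected by elements of \<open>m\<close> at
    and outside the two ends.\<close>
  define e where "e i = (if i = t \<or> i = Suc N then 1 else if t < i \<and> i < Suc N then coeff (h * f) i else 0)" for i
  define g where "g = (\<Sum>j\<le>Suc N - t. monom (e (t + j)) j)"
  have cg: "coeff g j = (if j \<le> Suc N - t then e (t + j) else 0)" for j
    unfolding g_def by (simp add: coeff_sum)
  have "coeff g (Suc N - t) = 1" using tN by (simp add: cg e_def)
  moreover have "degree g \<le> Suc N - t" by (intro degree_le) (simp add: cg)
  ultimately have "lead_coeff g = 1" using le_degree[of g "Suc N - t"] by simp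
  moreover have "coeff g 0 = 1" by (simp add: cg e_def)
  ultimately have "monom 1 t * g \<in> double_monic" unfolding double_monic_def by blast
  moreover have "h * f - monom 1 t * g \<in> coeff_ideal m"
    unfolding coeff_ideal_def
  proof (intro CollectI allI)
    fix i
    note id = ideal_setD[OF m]
    have eq: "coeff (monom 1 t * g) i = e i"
    proof (cases "i < t")
      case True
      then show ?thesis using tN by (simp add: coeff_monom_mult e_def)
    next
      case False
      then show ?thesis by (auto simp: coeff_monom_mult cg e_def)
    qed
    have "coeff (h * f) i - e i \<in> m"
    proof -
      consider "i < t" | "i = t" | "t < i" "i < Suc N" | "i = Suc N" | "Suc N < i" by linarith
      then show ?thesis
      proof cases
        case 1
        then show ?thesis using tN by (auto simp: e_def hf intro!: id(1,2,3) out(1))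
      next
        case 2
        have "(if i = 0 then 0 else \<alpha> * coeff f (i - 1)) \<in> m"
          using 2 by (auto intro!: id(1,3) out(1))
        from id(6)[OF this \<beta>] show ?thesis unfolding hf e_def using 2 tN by (simp add: algebra_simps)
      next
        case 3
        then show ?thesis by (simp add: e_def id)
      next
        case 4
        have "\<beta> * coeff f i \<in> m" using 4 by (intro id(3) out(2)) simp
        from id(6)[OF this \<alpha>] show ?thesis unfolding hf e_def using 4 tN by (simp add: algebra_simps)
      next
        case 5
        then show ?thesis using tN by (auto simp: e_def hf intro!: id(1,2,3) out(2))
      qed
    qed
    then show "coeff (h * f - monom 1 t * g) i \<in> m" by (simp add: eq)
  qed
  ultimately show ?thesis by blast
qed

lemma maximal_inverse:
  assumes m: "ideal_set m" and max: "\<And>K. ideal_set K \<Longrightarrow> m \<subset> K \<Longrightarrow> 1 \<in> K" and c: "c \<notin> m"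
  shows "\<exists>c'. 1 - c' * c \<in> m"
proof -
  have "m \<subset> adjoin m {()} (\<lambda>_. c)"
    using adjoin_base[OF m, of "{()}" "\<lambda>_. c"] adjoin_gen[OF m, of "{()}" "()" "\<lambda>_. c"] c by auto
  then have "1 \<in> adjoin m {()} (\<lambda>_. c)" using max ideal_adjoin[OF m] by blast
  then show ?thesis by (auto simp: adjoin_def)
qed

text \<open>
  Every prime of the chain contains \<open>f\<close>, and \<open>f\<close> does not lie in
  the extension of any prime of the base ring, so incomparability applies to each step.
\<close>
lemma strict_chain_contraction:
  assumes I: "ideal_set I" and P: "strict_chain X k P" and X: "X \<subseteq> primes_over J U"
    and J: "coeff_ideal I \<subseteq> J"
    and f: "f \<in> J" "\<And>p. p \<in> primes_over I {} \<Longrightarrow> f \<notin> coeff_ideal p"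
  shows "strict_chain (primes_over I {}) k (\<lambda>i. contraction (P i))"
proof -
  have Pi: "prime_set (P i)" "J \<subseteq> P i" if "i \<le> k" for i
    using that P X by (auto simp: strict_chain_def primes_over_def)
  have pi: "contraction (P i) \<in> primes_over I {}" if "i \<le> k" for i
  proof -
    have "[:c:] \<in> coeff_ideal I" if "c \<in> I" for c
      using that ideal_setD(1)[OF I] by (auto simp: coeff_ideal_def coeff_pCons split: nat.split)
    then have "I \<subseteq> contraction (P i)" using J Pi[OF that] by (auto simp: contraction_def)
    then show ?thesis using prime_contraction[OF Pi(1)[OF that]] by (simp add: primes_over_def)
  qed
  have "contraction (P i) \<subset> contraction (P (Suc i))" if i: "i < k" for i
  proof -
    have lt: "P i \<subset> P (Suc i)" using P i by (auto simp: strict_chain_def)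
    then have "contraction (P i) \<subseteq> contraction (P (Suc i))" by (auto simp: contraction_def)
    moreover have "\<not> contraction (P (Suc i)) \<subseteq> contraction (P i)"
    proof
      assume "contraction (P (Suc i)) \<subseteq> contraction (P i)"
      then have "P (Suc i) \<subseteq> P i"
        using primes_incomparable[of "P i" "P (Suc i)" f] Pi[of i] Pi[of "Suc i"] f pi[of i] lt i
        by auto
      then show False using lt by blast
    qed
    ultimately show ?thesis by blast
  qed
  then show ?thesis using pi by (auto simp: strict_chain_def)
qed

text \<open>
  The primes containing \<open>f\<close> form chains of length at most \<open>d\<close>, as
  they contract to strict chains. A chain of length exactly \<open>d\<close> ends over a
  prime that is maximal, since otherwise its contraction could be prolonged. Modulo this
  maximal ideal a multiple of \<open>f\<close> is double monic, so the last prime of the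
  chain meets the double monic polynomials. Inverting these therefore lowers the dimension
  by one, which is what allows rows of length \<open>d + 2\<close> instead of
  \<open>d + 3\<close>.
\<close>
lemma no_long_chain_double_monic:
  assumes I: "ideal_set I" and dim: "\<nexists>p. strict_chain (primes_over I {}) (Suc d) p"
    and J: "coeff_ideal I \<subseteq> J"
    and f: "f \<in> J" "\<And>p. p \<in> primes_over I {} \<Longrightarrow> f \<notin> coeff_ideal p"
  shows "\<nexists>P. strict_chain (primes_over J double_monic) d P"
proof
  assume "\<exists>P. strict_chain (primes_over J double_monic) d P"
  then obtain P where P: "strict_chain (primes_over J double_monic) d P" ..
  define p where "p i = contraction (P i)" for i
  have p: "strict_chain (primes_over I {}) d p"
    unfolding p_def by (rule strict_chain_contraction[OF I P order.refl J f])
  have Pd: "prime_set (P d)" "J \<subseteq> P d" "P d \<inter> double_monic = {}"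
    and pd: "p d \<in> primes_over I {}" "prime_set (p d)" "I \<subseteq> p d"
    using P p by (auto simp: strict_chain_def primes_over_def)
  have max: "1 \<in> K" if K: "ideal_set K" "p d \<subset> K" for K
  proof (rule ccontr)
    assume "1 \<notin> K"
    then obtain Q where Q: "prime_set Q" "K \<subseteq> Q"
      using ideal_in_prime[OF K(1)] by blast
    then have "Q \<in> primes_over I {}" "p d \<subset> Q" using K pd(3) by (auto simp: primes_over_def)
    then have "strict_chain (primes_over I {}) (Suc d) (p(Suc d := Q))"
      using p by (auto simp: strict_chain_def less_Suc_eq le_Suc_eq)
    then show False using dim by blast
  qed
  note idp = prime_setD(1)[OF pd(2)]
  obtain h g where g: "g \<in> double_monic" "h * f - g \<in> coeff_ideal (p d)"
    using double_monic_mod_maximal[OF idp maximal_inverse[OF idp max] f(2)[OF pd(1)]] by blast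
  note idP = prime_setD(1)[OF Pd(1)]
  have "h * f - g \<in> P d" using g(2) coeff_ideal_contraction[OF idP] by (auto simp: p_def)
  moreover have "h * f \<in> P d" using f(1) Pd(2) by (intro ideal_setD(3)[OF idP]) auto
  ultimately have "g \<in> P d" using ideal_set_diff_iff[OF idP] by blast
  then show False using g(1) Pd(3) by blast
qed

text \<open>
  Multiplication by sufficiently spaced powers of \<open>X\<close> keeps the coefficients of
  the different polynomials apart, so that each of them is a coefficient of the sum.
\<close>
lemma primitive_combination:
  fixes F :: "nat \<Rightarrow> 'r::comm_ring_1 poly"
  shows "\<exists>D. \<forall>p. (\<Sum>i<n. monom 1 (D * i) * F i) \<in> coeff_ideal p \<longrightarrow> (\<forall>i<n. F i \<in> coeff_ideal p)"
proof -
  define D where "D = Suc (\<Sum>i<n. degree (F i))"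
  have D: "degree (F i) < D" if "i < n" for i
    unfolding D_def using member_le_sum[of i "{..<n}" "\<lambda>i. degree (F i)"] that by simp
  have "F i \<in> coeff_ideal p" if sum: "(\<Sum>i<n. monom 1 (D * i) * F i) \<in> coeff_ideal p" and i: "i < n" for p i
    unfolding coeff_ideal_def
  proof (intro CollectI allI)
    fix j
    show "coeff (F i) j \<in> p"
    proof (cases "j < D")
      case j: True
      have "coeff (monom 1 (D * k) * F k) (D * i + j) = (if k = i then coeff (F i) j else 0)"
        if k: "k < n" for k
      proof -
        consider "k = i" | "k < i" | "i < k" by linarith
        then show ?thesis
        proof cases
          case 2
          then obtain l where l: "i = Suc (k + l)" using less_imp_Suc_add by blast
          have "D \<le> D * i + j - D * k" unfolding l by (simp add: algebra_simps)
          then have "degree (F k) < D * i + j - D * k" using D[OF k] by simp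
          then show ?thesis using 2 by (simp add: coeff_monom_mult coeff_eq_0)
        next
          case 3
          then obtain l where l: "k = Suc (i + l)" using less_imp_Suc_add by blast
          have "D * i + j < D * k" unfolding l using j by (simp add: algebra_simps)
          then show ?thesis using 3 by (simp add: coeff_monom_mult)
        qed (simp add: coeff_monom_mult)
      qed
      then have "coeff (\<Sum>k<n. monom 1 (D * k) * F k) (D * i + j) = (\<Sum>k<n. if k = i then coeff (F i) j else 0)"
        unfolding coeff_sum by (intro sum.cong) auto
      also have "\<dots> = coeff (F i) j" using i by simp
      finally have "coeff (\<Sum>k<n. monom 1 (D * k) * F k) (D * i + j) = coeff (F i) j" .
      moreover have "coeff (\<Sum>k<n. monom 1 (D * k) * F k) (D * i + j) \<in> p"
        using sum unfolding coeff_ideal_def by blast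
      ultimately show ?thesis by metis
    next
      case False
      have "coeff (\<Sum>k<n. monom 1 (D * k) * F k) (degree (\<Sum>k<n. monom 1 (D * k) * F k) + 1) = 0"
        by (intro coeff_eq_0) simp
      then have "0 \<in> p" using sum unfolding coeff_ideal_def by (metis (mono_tags, lifting) mem_Collect_eq)
      then show ?thesis using False D[OF i] by (simp add: coeff_eq_0)
    qed
  qed
  then show ?thesis by blast
qed

section \<open>Constants in ideals that contain a monic polynomial\<close>

lemma smult_sum_right: "smult a (\<Sum>i\<in>A. f i) = (\<Sum>i\<in>A. smult a (f i))"
  using sum_distrib_left[of "[:a:]" f A] by simp

text \<open>
  Nakayama's lemma for the submodule generated by the \<open>y i\<close> modulo
  \<open>K\<close>, localized at \<open>m\<close>. The last generator is eliminated from the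
  other relations; the factors \<open>s i\<close>, which are units after localization, make
  the statement stable under this elimination.
\<close>
lemma nakayama:
  fixes K :: "'r::comm_ring_1 poly set" and N :: nat
  assumes K: "ideal_set K" and m: "prime_set m"
    and "\<And>i. i < N \<Longrightarrow> s i \<notin> m \<and> smult (s i) (y i) - (\<Sum>j<N. smult (\<mu> i j) (y j)) \<in> K"
    and "\<And>i j. i < N \<Longrightarrow> j < N \<Longrightarrow> \<mu> i j \<in> m"
  shows "\<exists>c. c \<notin> m \<and> (\<forall>i<N. smult c (y i) \<in> K)"
  using assms(3,4)
proof (induction N arbitrary: s \<mu>)
  case 0
  then show ?case using prime_setD(2)[OF m] by auto
next
  case (Suc N)
  note idm = ideal_setD[OF prime_setD(1)[OF m]] and idK = ideal_setD[OF K]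
  define u where "u = s N - \<mu> N N"
  have u: "u \<notin> m"
    using Suc.prems(1)[of N] Suc.prems(2)[of N N] ideal_set_diff_iff[OF prime_setD(1)[OF m], of "s N" u]
    by (simp add: u_def)
  have uN: "smult u (y N) - (\<Sum>j<N. smult (\<mu> N j) (y j)) \<in> K"
    using Suc.prems(1)[of N] by (simp add: u_def smult_diff_left algebra_simps)
  \<comment> \<open>The relation for \<open>y i\<close>, times \<open>u\<close>, with \<open>y N\<close>
    replaced by means of its own relation.\<close>
  define \<nu> where "\<nu> i j = u * \<mu> i j + \<mu> i N * \<mu> N j" for i j
  have "\<exists>c. c \<notin> m \<and> (\<forall>i<N. smult c (y i) \<in> K)"
  proof (rule Suc.IH[of "\<lambda>i. u * s i" \<nu>])
    fix i assume i: "i < N"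
    have "u * s i \<notin> m" using prime_setD(3)[OF m] u Suc.prems(1)[of i] i by auto
    moreover have "smult u (smult (s i) (y i) - (\<Sum>j<Suc N. smult (\<mu> i j) (y j)))
        + smult (\<mu> i N) (smult u (y N) - (\<Sum>j<N. smult (\<mu> N j) (y j))) \<in> K"
      using Suc.prems(1)[of i] i uN idK(3)[of _ "[:_:]"] by (intro idK(2)) auto
    moreover have "smult u (smult (s i) (y i) - (\<Sum>j<Suc N. smult (\<mu> i j) (y j)))
        + smult (\<mu> i N) (smult u (y N) - (\<Sum>j<N. smult (\<mu> N j) (y j)))
      = smult (u * s i) (y i) - (\<Sum>j<N. smult (\<nu> i j) (y j))"
      by (simp add: \<nu>_def smult_diff_right smult_add_right smult_add_left smult_sum_right sum.distrib
          sum_subtractf mult.commute)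
    ultimately show "u * s i \<notin> m \<and> smult (u * s i) (y i) - (\<Sum>j<N. smult (\<nu> i j) (y j)) \<in> K"
      by simp
  next
    fix i j assume "i < N" "j < N"
    then show "\<nu> i j \<in> m" unfolding \<nu>_def using Suc.prems(2) by (intro idm(2,3)) auto
  qed
  then obtain c where c: "c \<notin> m" "\<And>i. i < N \<Longrightarrow> smult c (y i) \<in> K" by blast
  have "smult (c * u) (y i) \<in> K" if "i < Suc N" for i
  proof (cases "i < N")
    case True
    then show ?thesis using idK(3)[OF c(2)[OF True], of "[:u:]"] by (simp add: mult.commute)
  next
    case False
    then have i: "i = N" using that by simp
    have "(\<Sum>j<N. smult (c * \<mu> N j) (y j)) \<in> K"
    proof (rule ideal_set_sum[OF K])
      fix j assume "j \<in> {..<N}"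
      then show "smult (c * \<mu> N j) (y j) \<in> K"
        using idK(3)[OF c(2)[of j], of "[:\<mu> N j:]"] by (simp add: mult.commute)
    qed
    moreover have "smult (c * u) (y N) - (\<Sum>j<N. smult (c * \<mu> N j) (y j)) \<in> K"
      using idK(3)[OF uN, of "[:c:]"] by (simp add: smult_diff_right smult_sum_right)
    ultimately show ?thesis using ideal_set_diff_iff[OF K] i by blast
  qed
  moreover have "c * u \<notin> m" using prime_setD(3)[OF m] u c(1) by blast
  ultimately show ?case by blast
qed

text \<open>
  Each step of the division by the monic \<open>f\<close> subtracts a multiple of
  \<open>f\<close> by a term whose coefficient is the leading coefficient at that stage,
  hence lies in \<open>m\<close>.
\<close>
lemma monic_remainder:
  assumes K: "ideal_set K" and f: "f \<in> K" "lead_coeff f = 1" and m: "ideal_set m"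
    and w: "w \<in> coeff_ideal m"
  shows "\<exists>r\<in>coeff_ideal m. (r = 0 \<or> degree r < degree f) \<and> w - r \<in> K"
  using w
proof (induction "degree w" arbitrary: w rule: less_induct)
  case less
  note idK = ideal_setD[OF K] and idm = ideal_setD[OF m]
  show ?case
  proof (cases "degree w < degree f")
    case True
    then show ?thesis using less.prems idK(1) by (intro bexI[of _ w]) auto
  next
    case False
    define n where "n = degree w - degree f"
    define w' where "w' = w - monom (lead_coeff w) n * f"
    have wK: "w - w' \<in> K" unfolding w'_def using idK(3)[OF f(1)] by simp
    have "monom (lead_coeff w) n * f \<in> coeff_ideal m"
      using less.prems idm by (auto simp: coeff_ideal_def coeff_monom_mult)
    then have w': "w' \<in> coeff_ideal m"
      unfolding w'_def using less.prems by (intro ideal_setD(6)[OF ideal_coeff_ideal[OF m]])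
    have "degree (monom (lead_coeff w) n * f) \<le> degree w"
      using degree_mult_le[of "monom (lead_coeff w) n" f] degree_monom_le[of "lead_coeff w" n] False
      by (simp add: n_def)
    then have "degree w' \<le> degree w" unfolding w'_def by (intro degree_diff_le) auto
    moreover have "coeff w' (degree w) = 0"
      using False f(2) by (simp add: w'_def coeff_monom_mult n_def)
    ultimately consider "w' = 0" | "degree w' < degree w"
      using eq_zero_or_degree_less by blast
    then obtain r where r: "r \<in> coeff_ideal m" "r = 0 \<or> degree r < degree f" "w' - r \<in> K"
    proof cases
      case 1
      then show ?thesis using that[of 0] w' idK(1) by simp
    next
      case 2
      then show ?thesis using less.hyps[OF 2 w'] that by blast
    qed
    have "w - r \<in> K" using idK(2)[OF wK r(3)] by simp
    then show ?thesis using r by blast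
  qed
qed

text \<open>
  The quotient by \<open>K\<close> is generated, as a module over the base ring, by the
  powers of \<open>X\<close> below the degree of the monic polynomial \<open>f\<close>. The
  hypothesis on \<open>v\<close> says that it equals \<open>m\<close> times itself, so by
  Nakayama's lemma an element outside \<open>m\<close> annihilates it, in particular its
  element \<open>1\<close>.
\<close>
lemma monic_ideal_contains_constant:
  fixes K :: "'r::comm_ring_1 poly set"
  assumes K: "ideal_set K" and f: "f \<in> K" "lead_coeff f = 1" and m: "prime_set m"
    and v: "v \<in> coeff_ideal m" "1 - v \<in> K"
  shows "\<exists>c. c \<notin> m \<and> [:c:] \<in> K"
proof -
  note idm = ideal_setD[OF prime_setD(1)[OF m]] and idK = ideal_setD[OF K]
  define N where "N = degree f"
  have f0: "f \<noteq> 0" using f(2) by auto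
  have red: "\<exists>\<mu>. (\<forall>j. \<mu> j \<in> m) \<and> w - (\<Sum>j<N. smult (\<mu> j) (monom 1 j)) \<in> K"
    if "w \<in> coeff_ideal m" for w
  proof -
    obtain r where r: "\<forall>j. coeff r j \<in> m" "r = 0 \<or> degree r < N" "w - r \<in> K"
      using monic_remainder[OF K f prime_setD(1)[OF m] \<open>w \<in> coeff_ideal m\<close>]
      by (auto simp: N_def coeff_ideal_def)
    have "(\<Sum>j<N. smult (coeff r j) (monom 1 j)) = r"
    proof (rule poly_eqI)
      fix k
      have "coeff (\<Sum>j<N. smult (coeff r j) (monom 1 j)) k = (\<Sum>j<N. if j = k then coeff r k else 0)"
        unfolding coeff_sum by (intro sum.cong) auto
      also have "\<dots> = coeff r k" using r(2) by (auto simp: coeff_eq_0)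
      finally show "coeff (\<Sum>j<N. smult (coeff r j) (monom 1 j)) k = coeff r k" .
    qed
    then show ?thesis using r by (intro exI[of _ "coeff r"]) simp
  qed
  have "\<exists>\<mu>. (\<forall>j. \<mu> j \<in> m) \<and> smult 1 (monom 1 i) - (\<Sum>j<N. smult (\<mu> j) (monom 1 j)) \<in> K" for i
  proof -
    have "monom 1 i * v \<in> coeff_ideal m"
      using v(1) ideal_setD(3)[OF ideal_coeff_ideal[OF prime_setD(1)[OF m]]] by blast
    from red[OF this] obtain \<mu> where \<mu>: "\<forall>j. \<mu> j \<in> m"
      "monom 1 i * v - (\<Sum>j<N. smult (\<mu> j) (monom 1 j)) \<in> K" by blast
    have "monom 1 i * (1 - v) + (monom 1 i * v - (\<Sum>j<N. smult (\<mu> j) (monom 1 j))) \<in> K"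
      using v(2) \<mu>(2) by (intro idK(2) idK(3))
    then show ?thesis using \<mu>(1) by (intro exI[of _ \<mu>]) (simp add: algebra_simps)
  qed
  then obtain \<mu> where \<mu>: "\<And>i j. \<mu> i j \<in> m"
    "\<And>i. smult 1 (monom 1 i) - (\<Sum>j<N. smult (\<mu> i j) (monom 1 j)) \<in> K" by metis
  obtain c where c: "c \<notin> m" "\<And>i. i < N \<Longrightarrow> smult c (monom 1 i) \<in> K"
    using nakayama[OF K m, of N "\<lambda>_. 1" "monom 1" \<mu>] \<mu> prime_setD(2)[OF m] by blast
  show ?thesis
  proof (cases "N = 0")
    case True
    then have "f = [:1:]" using f(2) by (auto simp: N_def elim: degree_eq_zeroE)
    then show ?thesis using f(1) prime_setD(2)[OF m] by blast
  next
    case False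
    then have "smult c (monom 1 0) \<in> K" using c(2) by blast
    then show ?thesis using c(1) by (auto simp: monom_0)
  qed
qed

section \<open>Divided differences\<close>

text \<open>
  The quotient of \<open>p(b') - p(b)\<close> by \<open>b' - b\<close>, given by a formula
  that makes sense when \<open>b' - b\<close> is a zero divisor: \<open>p - p(b)\<close> is
  divided by \<open>X - b\<close>, and the quotient is evaluated at \<open>b'\<close>.
\<close>
definition divdiff :: "'r::comm_ring_1 poly \<Rightarrow> 'r poly \<Rightarrow> 'r poly \<Rightarrow> 'r poly" where
  "divdiff b b' p = poly (synthetic_div (map_poly (\<lambda>c. [:c:]) p) b) b'"

lemma synthetic_div_mult:
  fixes p q :: "'t::comm_ring_1 poly"
  shows "synthetic_div (p * q) c = synthetic_div p c * q + smult (poly p c) (synthetic_div q c)"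
proof -
  let ?s = "synthetic_div p c * q + smult (poly p c) (synthetic_div q c)"
  have "[:- c, 1:] * ?s + [:poly p c * poly q c:]
      = ([:- c, 1:] * synthetic_div p c + [:poly p c:]) * q
        + smult (poly p c) ([:- c, 1:] * synthetic_div q c + [:poly q c:] - q)"
    by (simp add: algebra_simps smult_add_right smult_diff_right)
  also have "\<dots> = p * q" unfolding synthetic_div_correct' by simp
  finally have "p * q = [:- c, 1:] * ?s + [:poly p c * poly q c:]" ..
  moreover have "[:- c, 1:] * s + [:r:] + smult c s = pCons r s" for r s
    by simp
  ultimately have "p * q + smult c ?s = pCons (poly p c * poly q c) ?s" by metis
  then show ?thesis using synthetic_div_unique by metis
qed

lemma synthetic_div_add:
  fixes p q :: "'t::comm_ring_1 poly"
  shows "synthetic_div (p + q) c = synthetic_div p c + synthetic_div q c"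
proof -
  have "(p + smult c (synthetic_div p c)) + (q + smult c (synthetic_div q c))
      = pCons (poly p c + poly q c) (synthetic_div p c + synthetic_div q c)"
    unfolding synthetic_div_correct by simp
  then have "p + q + smult c (synthetic_div p c + synthetic_div q c)
      = pCons (poly p c + poly q c) (synthetic_div p c + synthetic_div q c)"
    by (simp add: smult_add_right algebra_simps)
  then show ?thesis using synthetic_div_unique by metis
qed

lemma lift_const_mult:
  fixes p q :: "'r::comm_ring_1 poly"
  shows "map_poly (\<lambda>c. [:c:]) (p * q) = map_poly (\<lambda>c. [:c:]) p * map_poly (\<lambda>c. [:c:]) q"
proof (rule poly_eqI)
  fix k
  have "(\<Sum>i\<in>A. [:f i:]) = [:sum f A:]" for f :: "nat \<Rightarrow> 'r" and A
    by (induction A rule: infinite_finite_induct) auto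
  then show "coeff (map_poly (\<lambda>c. [:c:]) (p * q)) k
    = coeff (map_poly (\<lambda>c. [:c:]) p * map_poly (\<lambda>c. [:c:]) q) k"
    by (simp add: coeff_mult coeff_map_poly mult.commute)
qed

lemma divdiff_mult: "divdiff b b' (p * q) = divdiff b b' p * (q \<circ>\<^sub>p b') + (p \<circ>\<^sub>p b) * divdiff b b' q"
  by (simp add: divdiff_def lift_const_mult synthetic_div_mult pcompose_altdef)

lemma divdiff_add: "divdiff b b' (p + q) = divdiff b b' p + divdiff b b' q"
proof -
  have "map_poly (\<lambda>c. [:c:]) (p + q) = map_poly (\<lambda>c. [:c:]) p + map_poly (\<lambda>c. [:c:]) q"
    by (rule poly_eqI) (simp add: coeff_map_poly)
  then show ?thesis by (simp add: divdiff_def synthetic_div_add)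
qed

lemma divdiff_const: "divdiff b b' [:c:] = 0"
  by (cases "c = 0") (simp_all add: divdiff_def map_poly_pCons)

lemma pcompose_diff_divdiff: "p \<circ>\<^sub>p b' - p \<circ>\<^sub>p b = (b' - b) * divdiff b b' p"
proof -
  let ?P = "map_poly (\<lambda>c. [:c:]) p"
  have "poly ([:- b, 1:] * synthetic_div ?P b + [:poly ?P b:]) b' = poly ?P b'"
    unfolding synthetic_div_correct' ..
  then show ?thesis by (simp add: pcompose_altdef divdiff_def algebra_simps)
qed

section \<open>Reduction of unimodular rows\<close>

text \<open>
  Rows of length \<open>n\<close> over the Laurent polynomial ring of the quotient by
  \<open>I\<close>, represented by polynomials. The predicate \<open>good\<close> stands for
  a property of rows that is invariant under automorphisms and holds for the last basis
  vector. The assumption \<open>two_by_two\<close> covers congruence modulo \<open>I\<close>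
  and all changes of two entries by a matrix whose determinant divides a power of
  \<open>X\<close>, hence is a unit; \<open>shift\<close> covers the inverse of
  multiplication by a power of \<open>X\<close>, which is not a matrix of polynomials.
\<close>
locale row_reduction =
  fixes I :: "'r::comm_ring_1 set" and n :: nat and good :: "(nat \<Rightarrow> 'r poly) \<Rightarrow> bool"
  assumes ideal_I: "ideal_set I" and n2: "2 \<le> n"
    and two_by_two: "\<lbrakk>i < n; j < n; i \<noteq> j; (a * e - b * c) * s - monom 1 N \<in> coeff_ideal I; good G;
      \<And>k. k < n \<Longrightarrow> G k - (F(i := a * F i + b * F j, j := c * F i + e * F j)) k \<in> coeff_ideal I\<rbrakk>
      \<Longrightarrow> good F"
    and shift: "\<lbrakk>i < n; good F\<rbrakk> \<Longrightarrow> good (F(i := monom 1 t * F i))"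
    and last: "good (\<lambda>i. if i = n - 1 then 1 else 0)"
begin

lemmas id_I = ideal_setD[OF ideal_coeff_ideal[OF ideal_I]]

lemma good_cong_mod:
  assumes "good G" "\<And>k. k < n \<Longrightarrow> G k - F k \<in> coeff_ideal I"
  shows "good F"
proof (rule two_by_two[of 0 1 1 1 0 0 1 0 G])
  show "(1 * 1 - 0 * 0) * 1 - monom 1 0 \<in> coeff_ideal I" using id_I(1) by (simp add: monom_0 one_pCons)
qed (use assms n2 in auto)

lemma good_cong:
  assumes "good G" "\<And>k. k < n \<Longrightarrow> G k = F k"
  shows "good F"
  using assms id_I(1) by (intro good_cong_mod[OF assms(1)]) simp

lemma good_transform:
  assumes "i < n" "j < n" "i \<noteq> j" "a * e - b * c = 1"
    and "good (F(i := a * F i + b * F j, j := c * F i + e * F j))"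
  shows "good F"
  by (rule two_by_two[OF assms(1-3) _ assms(5), of a e b c 1 0])
    (use assms(4) id_I(1) in \<open>simp_all add: monom_0 one_pCons\<close>)

lemma good_add:
  assumes "i < n" "j < n" "i \<noteq> j" "good (F(i := F i + q * F j))"
  shows "good F"
proof -
  have "F(i := F i + q * F j) = F(i := 1 * F i + q * F j, j := 0 * F i + 1 * F j)"
    using assms(3) by (auto simp: fun_eq_iff)
  then show ?thesis using good_transform[of i j 1 1 q 0 F] assms by simp
qed

lemma good_scale:
  assumes "i < n" "good (F(i := monom 1 t * F i))"
  shows "good F"
proof -
  obtain j where j: "j < n" "i \<noteq> j" using n2 by (metis Suc_1 less_le_trans one_less_numeral_iff semiring_norm(76) zero_less_Suc zero_neq_one)
  have "F(i := monom 1 t * F i) = F(i := monom 1 t * F i + 0 * F j, j := 0 * F i + 1 * F j)"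
    using j by (auto simp: fun_eq_iff)
  then show ?thesis
    using two_by_two[of i j "monom 1 t" 1 0 0 1 t "F(i := monom 1 t * F i)" F] assms j id_I(1) by simp
qed

lemma good_add_sum:
  assumes "i < n" "S \<subseteq> {..<n}" "i \<notin> S" "good (F(i := F i + (\<Sum>j\<in>S. q j * F j)))"
  shows "good F"
proof -
  have "finite S" using assms(2) finite_subset by blast
  then show ?thesis using assms
  proof (induction S arbitrary: F)
    case (insert s S)
    define F' where "F' = F(i := F i + q s * F s)"
    have "(\<Sum>j\<in>S. q j * F' j) = (\<Sum>j\<in>S. q j * F j)"
      using insert.prems by (intro sum.cong) (auto simp: F'_def)
    then have "F'(i := F' i + (\<Sum>j\<in>S. q j * F' j)) = F(i := F i + (\<Sum>j\<in>insert s S. q j * F j))"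
      using insert.hyps by (simp add: F'_def algebra_simps)
    then have "good F'" using insert.prems insert.IH[of F'] by simp
    then show ?case using good_add[of i s F "q s"] insert.prems by (auto simp: F'_def)
  qed simp
qed

lemma good_add_to_many:
  assumes "l < n" "S \<subseteq> {..<n}" "l \<notin> S" "good (\<lambda>k. if k \<in> S then F k + q k * F l else F k)"
  shows "good F"
proof -
  have "finite S" using assms(2) finite_subset by blast
  then show ?thesis using assms
  proof (induction S arbitrary: F)
    case (insert s S)
    define F' where "F' = F(s := F s + q s * F l)"
    have "(\<lambda>k. if k \<in> S then F' k + q k * F' l else F' k)
      = (\<lambda>k. if k \<in> insert s S then F k + q k * F l else F k)"
      using insert.prems insert.hyps by (auto simp: fun_eq_iff F'_def)
    then have "good F'" using insert.prems insert.IH[of F'] by simp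
    then show ?case using good_add[of s l F "q s"] insert.prems by (auto simp: F'_def)
  qed simp
qed

text \<open>
  Suslin's matrix. Let \<open>N(b)\<close> have the rows
  \<open>(\<alpha>(b), \<beta>(b))\<close> and \<open>(- g(b), f(b))\<close>. It has
  determinant \<open>c\<close> and sends the column \<open>(f(b), g(b))\<close> to
  \<open>(c, 0)\<close>. Therefore the product of the adjugate of \<open>N(b')\<close> with
  \<open>N(b)\<close> sends \<open>(f(b), g(b))\<close> to \<open>c\<close> times
  \<open>(f(b'), g(b'))\<close>, and as \<open>b'\<close> is congruent to \<open>b\<close>
  modulo \<open>c\<close> the product is formally divisible by \<open>c\<close>. Because
  \<open>c\<close> may be a zero divisor, the quotient, with entries \<open>A\<close>,
  \<open>B\<close>, \<open>C\<close>, \<open>E\<close>, is written down with divided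
  differences, and the Leibniz rule for these replaces the cancellation of \<open>c\<close>.
\<close>
lemma good_move_pair:
  assumes ij: "i < n" "j < n" "i \<noteq> j"
    and c: "f * \<alpha> + g * \<beta> = [:c:]" and b': "b' = b + smult c x"
    and F: "F i = f \<circ>\<^sub>p b" "F j = g \<circ>\<^sub>p b"
    and good: "good (F(i := f \<circ>\<^sub>p b', j := g \<circ>\<^sub>p b'))"
  shows "good F"
proof -
  define f0 g0 a0 b0 where "f0 = f \<circ>\<^sub>p b" and "g0 = g \<circ>\<^sub>p b" and "a0 = \<alpha> \<circ>\<^sub>p b" and "b0 = \<beta> \<circ>\<^sub>p b"
  define f1 g1 a1 b1 where "f1 = f \<circ>\<^sub>p b'" and "g1 = g \<circ>\<^sub>p b'" and "a1 = \<alpha> \<circ>\<^sub>p b'" and "b1 = \<beta> \<circ>\<^sub>p b'"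
  define df dg da db where "df = divdiff b b' f" and "dg = divdiff b b' g"
    and "da = divdiff b b' \<alpha>" and "db = divdiff b b' \<beta>"
  have bb: "b' - b = [:c:] * x" by (simp add: b')
  have f0: "f0 = f1 - [:c:] * x * df" and g0: "g0 = g1 - [:c:] * x * dg"
    using pcompose_diff_divdiff[of f b' b] pcompose_diff_divdiff[of g b' b]
    by (simp_all only: bb f0_def f1_def df_def g0_def g1_def dg_def) (simp_all add: algebra_simps)
  have c1: "f1 * a1 + g1 * b1 = [:c:]"
    using arg_cong[OF c, of "\<lambda>p. p \<circ>\<^sub>p b'"]
    by (simp add: pcompose_add pcompose_mult f1_def g1_def a1_def b1_def)
  have leib: "df * a1 + f0 * da + (dg * b1 + g0 * db) = 0"
    using arg_cong[OF c, of "divdiff b b'"]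
    by (simp add: divdiff_add divdiff_mult divdiff_const f0_def g0_def a1_def b1_def
        df_def dg_def da_def db_def)
  define A where "A = 1 - x * (f1 * da + b1 * dg)"
  define B where "B = - x * (f1 * db - b1 * df)"
  define C where "C = - x * (g1 * da - a1 * dg)"
  define E where "E = 1 - x * (g1 * db + a1 * df)"
  define k where "k = [:c:]"
  note f0' = f0[folded k_def] and g0' = g0[folded k_def] and c1' = c1[folded k_def]
  have "A * E - B * C = 1 - x * (f1 * da + b1 * dg + g1 * db + a1 * df)
      + x * x * ((f1 * a1 + g1 * b1) * (da * df + db * dg))"
    by (simp add: A_def B_def C_def E_def algebra_simps)
  also have "\<dots> = 1 - x * (df * a1 + f0 * da + (dg * b1 + g0 * db))"
    unfolding c1' f0' g0' by (simp add: algebra_simps)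
  finally have det: "A * E - B * C = 1" by (simp add: leib)
  have v: "da * f0 + db * g0 = - (df * a1 + dg * b1)" using leib by (simp add: algebra_simps eq_neg_iff_add_eq_0)
  have v2: "df * g0 - dg * f0 = df * g1 - dg * f1" unfolding f0' g0' by (simp add: algebra_simps)
  have "A * f0 + B * g0 = f0 - x * (f1 * (da * f0 + db * g0) - b1 * (df * g0 - dg * f0))"
    by (simp add: A_def B_def algebra_simps)
  also have "\<dots> = f0 + x * df * (f1 * a1 + g1 * b1)" unfolding v v2 by (simp add: algebra_simps)
  also have "\<dots> = f1" unfolding c1' f0' by (simp add: algebra_simps)
  finally have 1: "A * f0 + B * g0 = f1" .
  have "C * f0 + E * g0 = g0 - x * (g1 * (da * f0 + db * g0) + a1 * (df * g0 - dg * f0))"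
    by (simp add: C_def E_def algebra_simps)
  also have "\<dots> = g0 + x * dg * (f1 * a1 + g1 * b1)" unfolding v v2 by (simp add: algebra_simps)
  also have "\<dots> = g1" unfolding c1' g0' by (simp add: algebra_simps)
  finally have 2: "C * f0 + E * g0 = g1" .
  show ?thesis
    by (rule good_transform[OF ij det]) (use good 1 2 F in \<open>simp add: f0_def g0_def f1_def g1_def\<close>)
qed

text \<open>
  The ideal generated by the values of \<open>G l\<close> and \<open>w\<close> at
  \<open>b\<close> contains \<open>c\<close>, hence the differences between the values of
  the other entries at \<open>b\<close> and at \<open>b + c * x\<close>. So these entries
  can be moved by elementary operations, after the entry \<open>0\<close> has been changed
  to \<open>w\<close>; the pair of \<open>G l\<close> and \<open>w\<close> is moved by
  Suslin's matrix.
\<close>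
lemma good_if_good_at_congruent:
  assumes l: "l = n - 1" and S: "S = {1..<n - 1}"
    and c: "G l * \<alpha> + w * \<beta> = [:c:]" and w: "w = G 0 + (\<Sum>i\<in>S. u i * G i)"
    and good: "good (\<lambda>i. G i \<circ>\<^sub>p (b + smult c x))"
  shows "good (\<lambda>i. G i \<circ>\<^sub>p b)"
proof -
  define b' where "b' = b + smult c x"
  have idx: "0 < n" "l < n" "l \<noteq> 0" "S \<subseteq> {..<n}" "0 \<notin> S" "l \<notin> S" "\<And>k. k < n \<Longrightarrow> k \<in> S \<or> k = 0 \<or> k = l"
    using n2 by (auto simp: l S)
  define A where "A k = divdiff b b' (G k) * x * (\<alpha> \<circ>\<^sub>p b)" for k
  define B where "B k = divdiff b b' (G k) * x * (\<beta> \<circ>\<^sub>p b)" for k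
  define R1 where "R1 = (\<lambda>i. G i \<circ>\<^sub>p b)(0 := w \<circ>\<^sub>p b)"
  define R2 where "R2 = (\<lambda>k. if k \<in> S then R1 k + A k * R1 l else R1 k)"
  define R3 where "R3 = (\<lambda>k. if k \<in> S then R2 k + B k * R2 0 else R2 k)"
  define R4 where "R4 = R3(l := G l \<circ>\<^sub>p b', 0 := w \<circ>\<^sub>p b')"
  have cb: "(G l \<circ>\<^sub>p b) * (\<alpha> \<circ>\<^sub>p b) + (w \<circ>\<^sub>p b) * (\<beta> \<circ>\<^sub>p b) = [:c:]"
    using arg_cong[OF c, of "\<lambda>p. p \<circ>\<^sub>p b"] by (simp add: pcompose_add pcompose_mult)
  have R3S: "R3 k = G k \<circ>\<^sub>p b'" if k: "k \<in> S" for k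
  proof -
    have "k \<noteq> 0" using k idx(5) by metis
    then have "R3 k = G k \<circ>\<^sub>p b + divdiff b b' (G k) * x * ((G l \<circ>\<^sub>p b) * (\<alpha> \<circ>\<^sub>p b) + (w \<circ>\<^sub>p b) * (\<beta> \<circ>\<^sub>p b))"
      using k idx(3,5,6) by (simp add: R3_def R2_def R1_def A_def B_def algebra_simps)
    also have "\<dots> = G k \<circ>\<^sub>p b + (b' - b) * divdiff b b' (G k)"
      unfolding cb by (simp add: b'_def algebra_simps)
    also have "\<dots> = G k \<circ>\<^sub>p b'" by (simp add: pcompose_diff_divdiff[symmetric])
    finally show ?thesis .
  qed
  have R3l: "R3 l = G l \<circ>\<^sub>p b" and R30: "R3 0 = w \<circ>\<^sub>p b"
    using idx(3,5,6) by (simp_all add: R3_def R2_def R1_def)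
  have "good R4"
  proof (rule good_add_sum[of 0 S R4 "\<lambda>i. - (u i \<circ>\<^sub>p b')"])
    show "good (R4(0 := R4 0 + (\<Sum>j\<in>S. - (u j \<circ>\<^sub>p b') * R4 j)))"
    proof (rule good_cong)
      show "good (\<lambda>i. G i \<circ>\<^sub>p b')" using good by (simp add: b'_def)
      have R4S: "R4 k = G k \<circ>\<^sub>p b'" if "k \<in> S" for k
        using that idx(5,6) R3S by (auto simp: R4_def)
      have "(\<Sum>j\<in>S. - (u j \<circ>\<^sub>p b') * R4 j) = - (\<Sum>j\<in>S. (u j \<circ>\<^sub>p b') * (G j \<circ>\<^sub>p b'))"
        using R4S by (simp add: sum_negf)
      then have 0: "R4 0 + (\<Sum>j\<in>S. - (u j \<circ>\<^sub>p b') * R4 j) = G 0 \<circ>\<^sub>p b'"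
        by (simp add: R4_def w pcompose_add pcompose_sum pcompose_mult)
      show "G k \<circ>\<^sub>p b' = (R4(0 := R4 0 + (\<Sum>j\<in>S. - (u j \<circ>\<^sub>p b') * R4 j))) k" if "k < n" for k
      proof (cases "k \<in> S")
        case True
        then have "k \<noteq> 0" using idx(5) by metis
        then show ?thesis using R4S[OF True] by simp
      next
        case False
        then have "k = 0 \<or> k = l" using idx(7)[OF that] by blast
        then show ?thesis using 0 idx(3) by (auto simp: R4_def)
      qed
    qed
  qed (use idx in auto)
  then have "good R3"
    unfolding R4_def using idx c R3l R30 by (intro good_move_pair[of l 0 "G l" \<alpha> w \<beta> c b' b x R3]) (auto simp: b'_def)
  then have "good R2" unfolding R3_def using idx by (intro good_add_to_many[of 0 S R2 B]) auto
  then have "good R1" unfolding R2_def using idx by (intro good_add_to_many[of l S R1 A]) auto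
  moreover have "R1 = (\<lambda>i. G i \<circ>\<^sub>p b)(0 := G 0 \<circ>\<^sub>p b + (\<Sum>j\<in>S. (u j \<circ>\<^sub>p b) * (G j \<circ>\<^sub>p b)))"
    by (simp add: R1_def w pcompose_add pcompose_sum pcompose_mult)
  ultimately show ?thesis
    using good_add_sum[of 0 S "\<lambda>i. G i \<circ>\<^sub>p b" "\<lambda>j. u j \<circ>\<^sub>p b"] idx by simp
qed

text \<open>
  The set \<open>C\<close> of all \<open>c\<close> such that congruence modulo
  \<open>c\<close> of the points of evaluation preserves \<open>good\<close> is an ideal. If
  it is the unit ideal, the row at \<open>X\<close> can be compared with the row at
  \<open>0\<close>, which contains the entry \<open>1\<close>. Suppose \<open>C\<close> lies
  in a maximal ideal \<open>m\<close>. Modulo \<open>m\<close> and \<open>G l\<close> all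
  primes are maximal, so a single application of the stable range theorem changes
  \<open>G 0\<close> to some \<open>w\<close> that generates the unit ideal together with
  \<open>G l\<close> modulo \<open>m\<close>. Then the ideal of \<open>G l\<close> and
  \<open>w\<close> contains a constant outside \<open>m\<close>, which belongs to
  \<open>C\<close>.
\<close>
lemma good_if_monic:
  assumes monic: "lead_coeff (G (n - 1)) = 1" and const: "coeff (G (n - 1)) 0 = 1"
    and um: "1 \<in> adjoin (coeff_ideal I) {..<n} G"
  shows "good G"
proof -
  define l where "l = n - 1"
  define S where "S = {1..<n - 1}"
  have idx: "0 < n" "l < n" "l \<noteq> 0" "S \<subseteq> {..<n}" "0 \<notin> S" "l \<notin> S" "{..<n} = insert 0 (insert l S)"
    using n2 by (auto simp: l_def S_def)
  define C where "C = {c. \<forall>b x. good (\<lambda>i. G i \<circ>\<^sub>p (b + smult c x)) \<longrightarrow> good (\<lambda>i. G i \<circ>\<^sub>p b)}"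
  have C: "ideal_set C"
    unfolding ideal_set_def
  proof (intro conjI ballI allI)
    show "0 \<in> C" by (simp add: C_def)
    fix c assume c: "c \<in> C"
    show "r * c \<in> C" for r
      unfolding C_def
    proof (intro CollectI allI impI)
      fix b x assume "good (\<lambda>i. G i \<circ>\<^sub>p (b + smult (r * c) x))"
      then have "good (\<lambda>i. G i \<circ>\<^sub>p (b + smult c (smult r x)))" by (simp add: mult.commute)
      then show "good (\<lambda>i. G i \<circ>\<^sub>p b)" using c unfolding C_def by blast
    qed
    fix c' assume c': "c' \<in> C"
    show "c + c' \<in> C"
      unfolding C_def
    proof (intro CollectI allI impI)
      fix b x assume "good (\<lambda>i. G i \<circ>\<^sub>p (b + smult (c + c') x))"
      then have "good (\<lambda>i. G i \<circ>\<^sub>p (b + smult c x + smult c' x))" by (simp add: smult_add_left add.assoc)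
      then have "good (\<lambda>i. G i \<circ>\<^sub>p (b + smult c x))" using c' unfolding C_def by blast
      then show "good (\<lambda>i. G i \<circ>\<^sub>p b)" using c unfolding C_def by blast
    qed
  qed
  have IC: "I \<subseteq> C"
  proof
    fix c assume c: "c \<in> I"
    show "c \<in> C"
      unfolding C_def
    proof (intro CollectI allI impI)
      fix b x assume g: "good (\<lambda>i. G i \<circ>\<^sub>p (b + smult c x))"
      have "smult c y \<in> coeff_ideal I" for y
        using c ideal_setD(4)[OF ideal_I] by (simp add: coeff_ideal_def)
      then have "G k \<circ>\<^sub>p (b + smult c x) - G k \<circ>\<^sub>p b \<in> coeff_ideal I" for k
        by (simp add: pcompose_diff_divdiff)
      then show "good (\<lambda>i. G i \<circ>\<^sub>p b)" by (intro good_cong_mod[OF g])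
    qed
  qed
  obtain q where q: "1 - (\<Sum>i<n. q i * G i) \<in> coeff_ideal I" using um by (auto simp: adjoin_def)
  have "1 \<in> C"
  proof (rule ccontr)
    assume "1 \<notin> C"
    then obtain m where m: "prime_set m" "C \<subseteq> m"
      and max: "\<And>K. ideal_set K \<Longrightarrow> m \<subseteq> K \<Longrightarrow> 1 \<notin> K \<Longrightarrow> K = m"
      using ideal_in_maximal[OF C] by blast
    note idm = prime_setD(1)[OF m(1)]
    define J where "J = adjoin (coeff_ideal m) {()} (\<lambda>_. G l)"
    have J: "ideal_set J" "coeff_ideal m \<subseteq> J" "G l \<in> J"
      using ideal_adjoin[OF ideal_coeff_ideal[OF idm], of "{()}" "\<lambda>_. G l"]
        adjoin_base[OF ideal_coeff_ideal[OF idm], of "{()}" "\<lambda>_. G l"]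
        adjoin_gen[OF ideal_coeff_ideal[OF idm], of "{()}" "()" "\<lambda>_. G l"] by (auto simp: J_def)
    have nochain: "\<nexists>P. strict_chain (primes_over J {1}) 1 P"
    proof
      assume "\<exists>P. strict_chain (primes_over J {1}) 1 P"
      then obtain P where P: "strict_chain (primes_over J {1}) 1 P" ..
      have "G l \<notin> coeff_ideal p" if p: "p \<in> primes_over m {}" for p
      proof
        assume "G l \<in> coeff_ideal p"
        then have "lead_coeff (G l) \<in> p" unfolding coeff_ideal_def by blast
        then show False using monic p prime_setD(2) by (auto simp: l_def primes_over_def)
      qed
      then have ch: "strict_chain (primes_over m {}) 1 (\<lambda>i. contraction (P i))"
        by (rule strict_chain_contraction[OF idm P order.refl J(2,3)])
      have "contraction (P i) = m" if "i \<le> 1" for i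
      proof -
        have "contraction (P i) \<in> primes_over m {}" using ch that unfolding strict_chain_def by blast
        then have "prime_set (contraction (P i))" "m \<subseteq> contraction (P i)" by (auto simp: primes_over_def)
        then show ?thesis using max prime_setD(1,2) by blast
      qed
      then show False using ch by (auto simp: strict_chain_def)
    qed
    define e where "e = (\<Sum>i\<in>S. q i * G i)"
    obtain h where h: "\<And>P. P \<in> primes_over J {1} \<Longrightarrow> G 0 + h * e \<in> P \<Longrightarrow> e \<in> P"
      using stable_range[OF J(1) _ _ nochain, of "\<lambda>_. G 0" e] by auto
    define w where "w = G 0 + h * e"
    have w: "w = G 0 + (\<Sum>i\<in>S. (h * q i) * G i)"
      by (simp add: w_def e_def sum_distrib_left mult.assoc)
    define gens where "gens t = (if t then G l else w)" for t
    define K' where "K' = adjoin (coeff_ideal m) UNIV gens"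
    have K': "ideal_set K'" "coeff_ideal m \<subseteq> K'" "gens t \<in> K'" for t
      using ideal_adjoin[OF ideal_coeff_ideal[OF idm], of UNIV gens]
        adjoin_base[OF ideal_coeff_ideal[OF idm], of UNIV gens]
        adjoin_gen[OF ideal_coeff_ideal[OF idm], of UNIV t gens] by (auto simp: K'_def)
    have "1 \<in> K'"
    proof (rule ccontr)
      assume "1 \<notin> K'"
      then obtain P where P: "prime_set P" "K' \<subseteq> P" using ideal_in_prime[OF K'(1)] by blast
      note idP = ideal_setD[OF prime_setD(1)[OF P(1)]]
      have Gl: "G l \<in> P" and wP: "w \<in> P" using K'(3)[of True] K'(3)[of False] P(2) by (auto simp: gens_def)
      have "J \<subseteq> P"
        unfolding J_def using K'(2) P Gl prime_setD(1)[OF P(1)] by (intro adjoin_least) auto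
      then have "P \<in> primes_over J {1}" using P(1) prime_setD(2) by (auto simp: primes_over_def)
      then have eP: "e \<in> P" using h wP by (simp add: w_def)
      then have "w - h * e \<in> P" using wP by (intro idP(6) idP(3))
      then have G0: "G 0 \<in> P" by (simp add: w_def)
      have "(\<Sum>i<n. q i * G i) = q 0 * G 0 + (q l * G l + e)"
        unfolding idx(7) using idx by (simp add: e_def S_def)
      also have "\<dots> \<in> P" using G0 Gl eP by (intro idP(2) idP(3))
      finally have "1 \<in> P"
        using q ideal_set_diff_iff[OF prime_setD(1)[OF P(1)], of 1 "\<Sum>i<n. q i * G i"]
          coeff_ideal_mono[OF order.trans[OF IC m(2)]] K'(2) P(2) by blast
      then show False using prime_setD(2)[OF P(1)] by blast
    qed
    then obtain \<gamma> where "1 - (\<Sum>t\<in>UNIV. \<gamma> t * gens t) \<in> coeff_ideal m" by (auto simp: K'_def adjoin_def)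
    then have v: "1 - (\<gamma> True * G l + \<gamma> False * w) \<in> coeff_ideal m"
      by (simp add: UNIV_bool gens_def add.commute)
    define K where "K = adjoin {0} UNIV gens"
    have z: "ideal_set {0 :: 'r poly}" by (auto simp: ideal_set_def)
    have K: "ideal_set K" "\<And>t. gens t \<in> K"
      using ideal_adjoin[OF z, of UNIV gens] adjoin_gen[OF z, of UNIV _ gens] by (simp_all add: K_def)
    note idK = ideal_setD[OF K(1)]
    have "G l \<in> K" "w \<in> K" using K(2)[of True] K(2)[of False] by (auto simp: gens_def)
    then have "\<gamma> True * G l + \<gamma> False * w \<in> K" by (intro idK(2) idK(3))
    then have "\<exists>c. c \<notin> m \<and> [:c:] \<in> K"
      using monic_ideal_contains_constant[OF K(1) \<open>G l \<in> K\<close> _ m(1) v] monic by (simp add: l_def)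
    then obtain c where c: "c \<notin> m" "[:c:] \<in> K" by blast
    then obtain \<delta> where "[:c:] - (\<Sum>t\<in>UNIV. \<delta> t * gens t) = 0" by (auto simp: K_def adjoin_def)
    then have "G l * \<delta> True + w * \<delta> False = [:c:]"
      by (simp add: UNIV_bool gens_def algebra_simps)
    then have "c \<in> C"
      unfolding C_def using good_if_good_at_congruent[OF l_def S_def _ w] by blast
    then show False using c(1) m(2) by blast
  qed
  moreover have "good (\<lambda>i. G i \<circ>\<^sub>p ([:0, 1:] + smult 1 [:0, - 1:]))"
  proof (rule good_add_to_many[of l "{..<n} - {l}" _ "\<lambda>k. - (G k \<circ>\<^sub>p ([:0, 1:] + smult 1 [:0, - 1:]))"])
    show "good (\<lambda>k. if k \<in> {..<n} - {l} then G k \<circ>\<^sub>p ([:0, 1:] + smult 1 [:0, - 1:])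
        + - (G k \<circ>\<^sub>p ([:0, 1:] + smult 1 [:0, - 1:])) * (G l \<circ>\<^sub>p ([:0, 1:] + smult 1 [:0, - 1:]))
        else G k \<circ>\<^sub>p ([:0, 1:] + smult 1 [:0, - 1:]))"
      by (rule good_cong[OF last]) (use const in \<open>auto simp: l_def pcompose_0' one_pCons\<close>)
  qed (use idx in auto)
  ultimately have "good (\<lambda>i. G i \<circ>\<^sub>p [:0, 1:])" unfolding C_def by blast
  then show ?thesis by simp
qed

text \<open>
  The entry \<open>0\<close> is replaced by the primitive combination \<open>f\<close>, and
  multiples of the last entry are added to the entries between them, such that the entries
  other than the last generate a double monic \<open>X ^ t * g\<close>. The last entry
  \<open>F l\<close> then becomes \<open>X ^ t * z\<close>, where
  \<open>z = X * F l + (1 + X ^ M) * g\<close> is monic because \<open>M\<close> is large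
  and has constant term one because \<open>g\<close> has. Divided by \<open>X ^ t\<close>,
  the row has a monic last entry that is coprime to \<open>X\<close>, so that it is
  unimodular over the polynomial ring itself.
\<close>
theorem good_if_unimodular:
  assumes dim: "\<nexists>p. strict_chain (primes_over I {}) (Suc d) p" and nd: "d + 2 \<le> n"
    and um: "(\<Sum>i<n. q i * F i) - monom 1 N \<in> coeff_ideal I"
  shows "good F"
proof -
  define l where "l = n - 1"
  define S where "S = {1..<n - 1}"
  have idx: "0 < n" "l < n" "l \<noteq> 0" "S \<subseteq> {..<n}" "0 \<notin> S" "l \<notin> S" "{..<n} = insert 0 (insert l S)"
    "{..<n - 1} = insert 0 S" "{1..<n} = insert l S"
    using n2 by (auto simp: l_def S_def)
  have finS: "finite S" by (simp add: S_def)
  have all_in: "monom 1 N \<in> P" if "ideal_set P" "coeff_ideal I \<subseteq> P" "\<And>i. i < n \<Longrightarrow> F i \<in> P" for P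
  proof -
    have "(\<Sum>i<n. q i * F i) \<in> P" using that(3) by (intro ideal_set_sum[OF that(1)] ideal_setD(3)[OF that(1)]) auto
    then show ?thesis using ideal_set_diff_iff[OF that(1)] um that(2) by blast
  qed
  obtain D where D: "\<And>p i. (\<Sum>i<n. monom 1 (D * i) * F i) \<in> coeff_ideal p \<Longrightarrow> i < n \<Longrightarrow> F i \<in> coeff_ideal p"
    using primitive_combination[of F n] by blast
  define f where "f = (\<Sum>i<n. monom 1 (D * i) * F i)"
  have f_eq: "f = F 0 + (\<Sum>i\<in>insert l S. monom 1 (D * i) * F i)"
    unfolding f_def idx(7) using idx finS by (simp add: monom_0 one_pCons[symmetric])
  have prim: "f \<notin> coeff_ideal p" if p: "p \<in> primes_over I {}" for p
  proof
    assume "f \<in> coeff_ideal p"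
    moreover have "ideal_set p" "1 \<notin> p" "I \<subseteq> p" using p prime_setD by (auto simp: primes_over_def)
    ultimately have "monom 1 N \<in> coeff_ideal p"
      using D by (intro all_in ideal_coeff_ideal coeff_ideal_mono) (auto simp: f_def)
    then have "coeff (monom 1 N) N \<in> p" unfolding coeff_ideal_def by blast
    then show False using \<open>1 \<notin> p\<close> by simp
  qed
  define J where "J = adjoin (coeff_ideal I) {()} (\<lambda>_. f)"
  note cI = ideal_coeff_ideal[OF ideal_I]
  have J: "ideal_set J" "coeff_ideal I \<subseteq> J" "f \<in> J"
    using ideal_adjoin[OF cI, of "{()}" "\<lambda>_. f"] adjoin_base[OF cI, of "{()}" "\<lambda>_. f"]
      adjoin_gen[OF cI, of "{()}" "()" "\<lambda>_. f"] by (auto simp: J_def)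
  have "\<nexists>P. strict_chain (primes_over J double_monic) (n - 2) P"
  proof -
    have "d \<le> n - 2" using nd by simp
    then show ?thesis
      using no_long_chain_double_monic[OF ideal_I dim J(2,3) prim] strict_chain_prefix by blast
  qed
  from stable_range[OF J(1) double_monic_one double_monic_mult this, of "\<lambda>i. F (Suc i)" "F l"]
  obtain h where h: "\<And>P. P \<in> primes_over J double_monic \<Longrightarrow>
      (\<forall>i<n - 2. F (Suc i) + h i * F l \<in> P) \<Longrightarrow> F l \<in> P" by blast
  define F1 where "F1 = F(0 := f)"
  define F2 where "F2 = (\<lambda>k. if k \<in> S then F1 k + h (k - 1) * F1 l else F1 k)"
  have F2: "F2 0 = f" "F2 l = F l" "\<And>k. k \<in> S \<Longrightarrow> F2 k = F k + h (k - 1) * F l"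
    using idx(3,5,6) by (auto simp: F2_def F1_def)
  \<comment> \<open>The operations performed so far are invertible: the new row, together with
    \<open>F l\<close>, generates the same ideal as the old one.\<close>
  have recover: "monom 1 N \<in> P" if P: "prime_set P" "coeff_ideal I \<subseteq> P" "F l \<in> P"
    and F2P: "\<And>k. k < n - 1 \<Longrightarrow> F2 k \<in> P" for P
  proof -
    note idP = prime_setD(1)[OF P(1)]
    have FS: "F k \<in> P" if k: "k \<in> S" for k
    proof -
      have "F2 k - h (k - 1) * F l \<in> P"
        using F2P[of k] k P(3) by (intro ideal_setD(6)[OF idP] ideal_setD(3)[OF idP]) (auto simp: S_def)
      then show ?thesis using F2(3)[OF k] by simp
    qed
    have "(\<Sum>i\<in>insert l S. monom 1 (D * i) * F i) \<in> P"
      using FS P(3) by (intro ideal_set_sum[OF idP] ideal_setD(3)[OF idP]) auto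
    moreover have "f \<in> P" using F2P[of 0] F2(1) idx(3) by (simp add: l_def)
    ultimately have "F 0 \<in> P" using ideal_set_diff_iff[OF idP, of f "F 0"] by (simp add: f_eq)
    show ?thesis
    proof (rule all_in[OF idP P(2)])
      fix i assume "i < n"
      then have "i \<in> insert 0 (insert l S)" unfolding idx(7)[symmetric] by simp
      then show "F i \<in> P" using \<open>F 0 \<in> P\<close> FS P(3) by auto
    qed
  qed
  define J' where "J' = adjoin (coeff_ideal I) {..<n - 1} F2"
  have J': "ideal_set J'" "coeff_ideal I \<subseteq> J'" "\<And>k. k < n - 1 \<Longrightarrow> F2 k \<in> J'"
    using ideal_adjoin[OF cI, of "{..<n - 1}" F2] adjoin_base[OF cI, of "{..<n - 1}" F2]
      adjoin_gen[OF cI, of "{..<n - 1}" _ F2] by (simp_all add: J'_def)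
  have "J' \<inter> double_monic \<noteq> {}"
  proof
    assume disj: "J' \<inter> double_monic = {}"
    obtain P where P: "prime_set P" "J' \<subseteq> P" "P \<inter> double_monic = {}"
      using ideal_disjoint_prime[OF J'(1) double_monic_one double_monic_mult disj] by metis
    note idP = prime_setD(1)[OF P(1)]
    have F2P: "F2 k \<in> P" if "k < n - 1" for k using J'(3)[OF that] P(2) by blast
    have cP: "coeff_ideal I \<subseteq> P" using J'(2) P(2) by blast
    have "f \<in> P" using F2P[of 0] F2(1) idx(3) by (simp add: l_def)
    then have "J \<subseteq> P" unfolding J_def using cP by (intro adjoin_least[OF idP]) auto
    then have "P \<in> primes_over J double_monic" using P by (auto simp: primes_over_def)
    moreover have "F (Suc i) + h i * F l \<in> P" if "i < n - 2" for i
      using F2P[of "Suc i"] F2(3)[of "Suc i"] that by (simp add: S_def)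
    ultimately have "F l \<in> P" using h by blast
    then have "monom 1 N \<in> P" using recover[OF P(1) cP _ F2P] by blast
    then show False using P(3) double_monic_monom by blast
  qed
  then obtain t g where g: "monom 1 t * g \<in> J'" "lead_coeff g = 1" "coeff g 0 = 1"
    by (auto simp: double_monic_def)
  then obtain p where p: "monom 1 t * g - (\<Sum>i<n - 1. p i * F2 i) \<in> coeff_ideal I"
    by (auto simp: J'_def adjoin_def)
  \<comment> \<open>The degree of \<open>X ^ M * g\<close> exceeds the degrees of \<open>X * F l\<close>
    and of \<open>g\<close>.\<close>
  define M where "M = Suc (degree (monom 1 1 * F l) + degree g)"
  define z where "z = monom 1 1 * F l + (1 + monom 1 M) * g"
  have z_alt: "z = monom 1 1 * F l + g + monom 1 M * g" by (simp add: z_def algebra_simps)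
  have "coeff (monom 1 1 * F l) (M + degree g) = 0" "coeff g (M + degree g) = 0"
    by (intro coeff_eq_0; simp add: M_def)+
  then have "coeff z (M + degree g) = 1"
    using g(2) by (simp add: z_alt coeff_monom_mult[of _ M])
  moreover have "degree z \<le> M + degree g"
    unfolding z_alt using degree_mult_le[of "monom 1 M" g] degree_monom_le[of "1::'r" M]
    by (intro degree_add_le) (auto simp: M_def)
  ultimately have z1: "lead_coeff z = 1" using le_degree[of z "M + degree g"] by simp
  have z0: "coeff z 0 = 1" using g(3) by (simp add: z_alt coeff_monom_mult M_def)
  have z_cong: "1 - z \<in> P" if "ideal_set P" "monom 1 1 \<in> P" for P
  proof -
    obtain y where "z = pCons 1 y" using z0 by (cases z) auto
    then have "1 - z = monom 1 1 * (- y)" by (simp add: one_pCons monom_altdef)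
    then show ?thesis using ideal_setD(4)[OF that] by metis
  qed
  define T where "T = adjoin (coeff_ideal I) {..<n} (F2(l := z))"
  have T: "ideal_set T" "coeff_ideal I \<subseteq> T" "\<And>k. k < n \<Longrightarrow> (F2(l := z)) k \<in> T"
    using ideal_adjoin[OF cI, of "{..<n}" "F2(l := z)"] adjoin_base[OF cI, of "{..<n}" "F2(l := z)"]
      adjoin_gen[OF cI, of "{..<n}" _ "F2(l := z)"] unfolding T_def by simp_all
  have "1 \<in> T"
  proof (rule ccontr)
    assume "1 \<notin> T"
    then obtain P where P: "prime_set P" "T \<subseteq> P" using ideal_in_prime[OF T(1)] by blast
    note idP = prime_setD(1)[OF P(1)] and idPs = ideal_setD[OF prime_setD(1)[OF P(1)]]
    have zP: "z \<in> P" using T(3)[OF idx(2)] P(2) by auto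
    have F2P: "F2 k \<in> P" if "k < n - 1" for k using T(3)[of k] that P(2) by (auto simp: l_def)
    have cP: "coeff_ideal I \<subseteq> P" using T(2) P(2) by blast
    have X: "monom 1 1 \<notin> P"
      using z_cong[OF idP] ideal_set_diff_iff[OF idP, of 1 z] zP prime_setD(2)[OF P(1)] by blast
    have Xpow: "monom 1 k \<notin> P" for k
      using prime_setD(4)[OF P(1), of "monom 1 1" k] X by (auto simp: monom_power)
    have "(\<Sum>i<n - 1. p i * F2 i) \<in> P" using F2P by (intro ideal_set_sum[OF idP] idPs(3)) auto
    then have "monom 1 t * g \<in> P" using ideal_set_diff_iff[OF idP] p cP by blast
    then have "g \<in> P" using prime_setD(3)[OF P(1)] Xpow by blast
    then have "z - (1 + monom 1 M) * g \<in> P" using zP by (intro idPs(6) idPs(3))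
    then have "monom 1 1 * F l \<in> P" by (simp add: z_def)
    then have "F l \<in> P" using prime_setD(3)[OF P(1)] X by blast
    then have "monom 1 N \<in> P" using recover[OF P(1) cP _ F2P] by blast
    then show False using Xpow by blast
  qed
  then have "good (F2(l := z))"
    unfolding T_def using z1 z0 by (intro good_if_monic) (simp_all add: l_def)
  then have "good ((F2(l := z))(l := monom 1 t * (F2(l := z)) l))" by (rule shift[OF idx(2)])
  then have "good (F2(l := monom 1 t * z))" by simp
  moreover define F3 where "F3 = F2(l := monom 1 (Suc t) * F2 l)"
  moreover define p' where "p' i = (1 + monom 1 M) * p i" for i
  ultimately have "good (F3(l := F3 l + (\<Sum>i<n - 1. p' i * F3 i)))"
  proof (rule_tac good_cong_mod)
    fix k assume "k < n"
    have "(\<Sum>i<n - 1. p' i * F3 i) = (1 + monom 1 M) * (\<Sum>i<n - 1. p i * F2 i)"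
      unfolding sum_distrib_left p'_def F3_def by (intro sum.cong) (auto simp: l_def mult.assoc)
    then have "monom 1 t * z - (F3 l + (\<Sum>i<n - 1. p' i * F3 i))
      = (1 + monom 1 M) * (monom 1 t * g - (\<Sum>i<n - 1. p i * F2 i))"
      using mult_monom[of "1::'r" t 1 1] by (simp add: z_def F3_def F2(2) algebra_simps)
    also have "\<dots> \<in> coeff_ideal I" using p by (rule id_I(3))
    finally show "(F2(l := monom 1 t * z)) k - (F3(l := F3 l + (\<Sum>i<n - 1. p' i * F3 i))) k \<in> coeff_ideal I"
      using id_I(1) by (simp add: F3_def)
  qed
  then have "good F3" using idx by (intro good_add_sum[of l "{..<n - 1}" F3 p']) (auto simp: l_def)
  then have "good F2" unfolding F3_def by (rule good_scale[OF idx(2)])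
  then have "good F1" unfolding F2_def using idx by (intro good_add_to_many[of l S F1 "\<lambda>k. h (k - 1)"]) auto
  then show ?thesis
    unfolding F1_def f_eq using idx n2
    by (intro good_add_sum[of 0 "insert l S" F "\<lambda>i. monom 1 (D * i)"]) auto
qed

end

section \<open>Rows over a commutative ring and cancellation of free summands\<close>

context cring begin

abbreviation rows :: "nat \<Rightarrow> ('a, nat \<Rightarrow> 'a) module" where
  "rows n \<equiv> func_space {..<n}"

definition unit_row :: "nat \<Rightarrow> nat \<Rightarrow> nat \<Rightarrow> 'a" where
  "unit_row n j = (\<lambda>i\<in>{..<n}. if i = j then \<one> else \<zero>)"

text \<open>
  For positive \<open>n\<close> equivalently, \<open>v\<close> belongs to a basis of
  \<open>rows n\<close>.
\<close>
definition completable :: "nat \<Rightarrow> (nat \<Rightarrow> 'a) \<Rightarrow> bool" where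
  "completable n v \<longleftrightarrow> (\<exists>g\<in>module_hom R (rows n) (rows n).
     bij_betw g (carrier (rows n)) (carrier (rows n)) \<and> g v = unit_row n (n - 1))"

lemma rows_simps:
  "carrier (rows n) = {..<n} \<rightarrow>\<^sub>E carrier R"
  "\<zero>\<^bsub>rows n\<^esub> = (\<lambda>i\<in>{..<n}. \<zero>)"
  "x \<oplus>\<^bsub>rows n\<^esub> y = (\<lambda>i\<in>{..<n}. x i \<oplus> y i)"
  "c \<odot>\<^bsub>rows n\<^esub> y = (\<lambda>i\<in>{..<n}. c \<otimes> y i)"
  by (simp_all add: func_space_def)

lemma rows_closed: "y \<in> carrier (rows n) \<Longrightarrow> i < n \<Longrightarrow> y i \<in> carrier R"
  by (auto simp: rows_simps)

lemma rows_eqI: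
  "x \<in> carrier (rows n) \<Longrightarrow> y \<in> carrier (rows n) \<Longrightarrow> (\<And>i. i < n \<Longrightarrow> x i = y i) \<Longrightarrow> x = y"
  unfolding rows_simps by (rule PiE_ext) auto

lemma restrict_in_rows: "(\<And>i. i < n \<Longrightarrow> f i \<in> carrier R) \<Longrightarrow> restrict f {..<n} \<in> carrier (rows n)"
  by (auto simp: rows_simps)

lemma unit_row_closed: "unit_row n j \<in> carrier (rows n)"
  unfolding unit_row_def by (rule restrict_in_rows) auto

lemma rows_module: "module R (rows n)"
  by (rule func_space_is_module)

lemma module_homI:
  assumes "\<And>x. x \<in> carrier M \<Longrightarrow> f x \<in> carrier N"
    and "\<And>x y. x \<in> carrier M \<Longrightarrow> y \<in> carrier M \<Longrightarrow> f (x \<oplus>\<^bsub>M\<^esub> y) = f x \<oplus>\<^bsub>N\<^esub> f y"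
    and "\<And>c x. c \<in> carrier R \<Longrightarrow> x \<in> carrier M \<Longrightarrow> f (c \<odot>\<^bsub>M\<^esub> x) = c \<odot>\<^bsub>N\<^esub> f x"
  shows "f \<in> module_hom R M N"
  using assms by (auto simp: module_hom_def)

lemma module_hom_comp:
  "f \<in> module_hom R M N \<Longrightarrow> g \<in> module_hom R N L \<Longrightarrow> (\<lambda>x. g (f x)) \<in> module_hom R M L"
  by (auto simp: module_hom_def Pi_iff)

lemma module_hom_inverse:
  assumes f: "f \<in> module_hom R M N" and bij: "bij_betw f (carrier M) (carrier N)"
    and M: "module R M"
  shows "inv_into (carrier M) f \<in> module_hom R N M"
proof (rule module_homI)
  interpret M: module R M by fact
  let ?g = "inv_into (carrier M) f"
  have g: "?g y \<in> carrier M" "f (?g y) = y" if "y \<in> carrier N" for y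
    using that bij by (auto simp: bij_betw_def inv_into_into f_inv_into_f)
  have gf: "?g (f x) = x" if "x \<in> carrier M" for x
    using that bij by (simp add: bij_betw_def)
  show "?g y \<in> carrier M" if "y \<in> carrier N" for y using g that by simp
  show "?g (x \<oplus>\<^bsub>N\<^esub> y) = ?g x \<oplus>\<^bsub>M\<^esub> ?g y" if "x \<in> carrier N" "y \<in> carrier N" for x y
    using gf[of "?g x \<oplus>\<^bsub>M\<^esub> ?g y"] g[OF that(1)] g[OF that(2)] module_hom_add[OF f] by simp
  show "?g (c \<odot>\<^bsub>N\<^esub> x) = c \<odot>\<^bsub>M\<^esub> ?g x" if "c \<in> carrier R" "x \<in> carrier N" for c x
    using gf[of "c \<odot>\<^bsub>M\<^esub> ?g x"] g[OF that(2)] module_hom_smult[OF f] that(1) by simp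
qed

text \<open>
  The statement is about additive maps into abelian groups so that it applies both to module
  homomorphisms and to coordinate functions with values in the ring.
\<close>
lemma additive_expand:
  assumes N: "abelian_group N" and f: "\<And>y. y \<in> carrier (rows n) \<Longrightarrow> f y \<in> carrier N"
    and add: "\<And>x y. x \<in> carrier (rows n) \<Longrightarrow> y \<in> carrier (rows n) \<Longrightarrow>
      f (x \<oplus>\<^bsub>rows n\<^esub> y) = f x \<oplus>\<^bsub>N\<^esub> f y"
    and y: "y \<in> carrier (rows n)"
  shows "f y = (\<Oplus>\<^bsub>N\<^esub>i\<in>{..<n}. f (y i \<odot>\<^bsub>rows n\<^esub> unit_row n i))"
proof -
  interpret N: abelian_group N by fact
  interpret V: module R "rows n" by (rule rows_module)
  have yi: "y i \<in> carrier R" if "i < n" for i using rows_closed[OF y that] .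
  have summand: "y i \<odot>\<^bsub>rows n\<^esub> unit_row n i \<in> carrier (rows n)" if "i < n" for i
    using yi[OF that] unit_row_closed by (rule V.smult_closed)
  have f0: "f \<zero>\<^bsub>rows n\<^esub> = \<zero>\<^bsub>N\<^esub>"
  proof -
    have "f \<zero>\<^bsub>rows n\<^esub> = f \<zero>\<^bsub>rows n\<^esub> \<oplus>\<^bsub>N\<^esub> f \<zero>\<^bsub>rows n\<^esub>"
      using add[OF V.zero_closed V.zero_closed] by (simp only: V.M.l_zero V.zero_closed)
    then show ?thesis
      using N.add.l_cancel_one[of "f \<zero>\<^bsub>rows n\<^esub>" "f \<zero>\<^bsub>rows n\<^esub>"] f[OF V.zero_closed] by simp
  qed
  define part where "part k = (\<lambda>i\<in>{..<n}. if i < k then y i else \<zero>)" for k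
  have part: "part k \<in> carrier (rows n)" for k
    unfolding part_def by (rule restrict_in_rows) (use yi in auto)
  have "f (part k) = (\<Oplus>\<^bsub>N\<^esub>i\<in>{..<k}. f (y i \<odot>\<^bsub>rows n\<^esub> unit_row n i))" if "k \<le> n" for k
    using that
  proof (induction k)
    case 0
    have "part 0 = \<zero>\<^bsub>rows n\<^esub>" unfolding part_def rows_simps by (rule restrict_ext) simp
    then show ?case using f0 by simp
  next
    case (Suc k)
    have "part (Suc k) = (y k \<odot>\<^bsub>rows n\<^esub> unit_row n k) \<oplus>\<^bsub>rows n\<^esub> part k"
      using Suc.prems yi by (auto simp: part_def rows_simps unit_row_def fun_eq_iff less_Suc_eq)
    then have "f (part (Suc k))
      = f (y k \<odot>\<^bsub>rows n\<^esub> unit_row n k) \<oplus>\<^bsub>N\<^esub> (\<Oplus>\<^bsub>N\<^esub>i\<in>{..<k}. f (y i \<odot>\<^bsub>rows n\<^esub> unit_row n i))"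
      using Suc add[OF summand part] by simp
    also have "\<dots> = (\<Oplus>\<^bsub>N\<^esub>i\<in>insert k {..<k}. f (y i \<odot>\<^bsub>rows n\<^esub> unit_row n i))"
      using Suc.prems f[OF summand] by (intro N.finsum_insert[symmetric]) auto
    finally show ?case by (simp add: lessThan_Suc)
  qed
  from this[of n] show ?thesis
    using rows_eqI[OF part y, of n] by (simp add: part_def)
qed

lemma direct_sum_simps:
  "carrier (direct_sum M N) = carrier M \<times> carrier N"
  "x \<oplus>\<^bsub>direct_sum M N\<^esub> y = (fst x \<oplus>\<^bsub>M\<^esub> fst y, snd x \<oplus>\<^bsub>N\<^esub> snd y)"
  "c \<odot>\<^bsub>direct_sum M N\<^esub> x = (c \<odot>\<^bsub>M\<^esub> fst x, c \<odot>\<^bsub>N\<^esub> snd x)"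
  by (simp_all add: direct_sum_def)

text \<open>
  Quotients by the last basis vector on both sides, in coordinates: restricting
  \<open>F\<close> to the vectors with last coordinate zero and forgetting the last
  coordinate of the value loses nothing, because changing the last coordinate of the
  argument changes only the last coordinate of the value.
\<close>
lemma drop_last_coordinate:
  assumes M: "module R M" and F: "F \<in> module_hom R (direct_sum M (rows (Suc m))) (rows (Suc k))"
    and bij: "bij_betw F (carrier (direct_sum M (rows (Suc m)))) (carrier (rows (Suc k)))"
    and last: "F (\<zero>\<^bsub>M\<^esub>, unit_row (Suc m) m) = unit_row (Suc k) k"
  shows "module_isomorphic R (direct_sum M (rows m)) (rows k)"
proof -
  interpret M: module R M by fact
  interpret D: module R "direct_sum M (rows (Suc m))"
    by (rule direct_sum_is_module[OF M rows_module])
  define ext where "ext c u = (\<lambda>i\<in>{..<Suc m}. if i < m then u i else c)" for c :: 'a and u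
  have ext: "ext c u \<in> carrier (rows (Suc m))" if "c \<in> carrier R" "u \<in> carrier (rows m)" for c u
    unfolding ext_def by (rule restrict_in_rows) (use that rows_closed in auto)
  define G where "G = (\<lambda>p. restrict (F (fst p, ext \<zero> (snd p))) {..<k})"
  note Fc = module_hom_closed[OF F, THEN funcset_mem] and Fadd = module_hom_add[OF F]
    and Fsm = module_hom_smult[OF F]
  have inD: "(x, ext c u) \<in> carrier (direct_sum M (rows (Suc m)))"
    if "x \<in> carrier M" "c \<in> carrier R" "u \<in> carrier (rows m)" for x c u
    using that ext by (simp add: direct_sum_simps)
  have Fval: "F (x, ext \<zero> u) i \<in> carrier R" if "x \<in> carrier M" "u \<in> carrier (rows m)" "i < Suc k" for x u i
    using rows_closed[OF Fc[OF inD[OF that(1) zero_closed that(2)]] that(3)] .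
  have split: "F (x, ext c u) i = F (x, ext \<zero> u) i \<oplus> (if i = k then c else \<zero>)"
    if x: "x \<in> carrier M" and c: "c \<in> carrier R" and u: "u \<in> carrier (rows m)" and i: "i < Suc k" for x c u i
  proof -
    have e: "(\<zero>\<^bsub>M\<^esub>, unit_row (Suc m) m) \<in> carrier (direct_sum M (rows (Suc m)))"
      using unit_row_closed by (simp add: direct_sum_simps)
    have "(x, ext c u) = (x, ext \<zero> u) \<oplus>\<^bsub>direct_sum M (rows (Suc m))\<^esub>
        (c \<odot>\<^bsub>direct_sum M (rows (Suc m))\<^esub> (\<zero>\<^bsub>M\<^esub>, unit_row (Suc m) m))"
      using x c rows_closed[OF u]
      by (auto simp: direct_sum_simps rows_simps ext_def unit_row_def fun_eq_iff less_Suc_eq)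
    then have "F (x, ext c u) = F (x, ext \<zero> u) \<oplus>\<^bsub>rows (Suc k)\<^esub> (c \<odot>\<^bsub>rows (Suc k)\<^esub> unit_row (Suc k) k)"
      using Fadd[OF inD[OF x zero_closed u] D.smult_closed[OF c e]] Fsm[OF c e] last by simp
    then show ?thesis using i c by (simp add: rows_simps unit_row_def)
  qed
  have "G \<in> module_hom R (direct_sum M (rows m)) (rows k)"
  proof (rule module_homI)
    fix p assume p: "p \<in> carrier (direct_sum M (rows m))"
    then have p': "fst p \<in> carrier M" "snd p \<in> carrier (rows m)" by (auto simp: direct_sum_simps)
    show "G p \<in> carrier (rows k)"
      unfolding G_def using Fval[OF p'] by (intro restrict_in_rows) auto
    show "G (c \<odot>\<^bsub>direct_sum M (rows m)\<^esub> p) = c \<odot>\<^bsub>rows k\<^esub> G p" if c: "c \<in> carrier R" for c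
    proof -
      have "(c \<odot>\<^bsub>M\<^esub> fst p, ext \<zero> (c \<odot>\<^bsub>rows m\<^esub> snd p))
        = c \<odot>\<^bsub>direct_sum M (rows (Suc m))\<^esub> (fst p, ext \<zero> (snd p))"
        using c by (auto simp: direct_sum_simps rows_simps ext_def fun_eq_iff)
      then have "F (c \<odot>\<^bsub>M\<^esub> fst p, ext \<zero> (c \<odot>\<^bsub>rows m\<^esub> snd p)) = c \<odot>\<^bsub>rows (Suc k)\<^esub> F (fst p, ext \<zero> (snd p))"
        using Fsm[OF c inD[OF p'(1) zero_closed p'(2)]] by simp
      then show ?thesis by (auto simp: G_def direct_sum_simps rows_simps fun_eq_iff)
    qed
    fix q assume q: "q \<in> carrier (direct_sum M (rows m))"
    then have q': "fst q \<in> carrier M" "snd q \<in> carrier (rows m)" by (auto simp: direct_sum_simps)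
    have "(fst p \<oplus>\<^bsub>M\<^esub> fst q, ext \<zero> (snd p \<oplus>\<^bsub>rows m\<^esub> snd q))
      = (fst p, ext \<zero> (snd p)) \<oplus>\<^bsub>direct_sum M (rows (Suc m))\<^esub> (fst q, ext \<zero> (snd q))"
      by (auto simp: direct_sum_simps rows_simps ext_def fun_eq_iff)
    then have "F (fst p \<oplus>\<^bsub>M\<^esub> fst q, ext \<zero> (snd p \<oplus>\<^bsub>rows m\<^esub> snd q))
      = F (fst p, ext \<zero> (snd p)) \<oplus>\<^bsub>rows (Suc k)\<^esub> F (fst q, ext \<zero> (snd q))"
      using Fadd[OF inD[OF p'(1) zero_closed p'(2)] inD[OF q'(1) zero_closed q'(2)]] by simp
    then show "G (p \<oplus>\<^bsub>direct_sum M (rows m)\<^esub> q) = G p \<oplus>\<^bsub>rows k\<^esub> G q"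
      by (auto simp: G_def direct_sum_simps rows_simps fun_eq_iff)
  qed
  moreover have "bij_betw G (carrier (direct_sum M (rows m))) (carrier (rows k))"
    unfolding bij_betw_def
  proof
    show "inj_on G (carrier (direct_sum M (rows m)))"
    proof (rule inj_onI)
      fix p q assume p: "p \<in> carrier (direct_sum M (rows m))" and q: "q \<in> carrier (direct_sum M (rows m))"
        and eq: "G p = G q"
      have p': "fst p \<in> carrier M" "snd p \<in> carrier (rows m)"
        and q': "fst q \<in> carrier M" "snd q \<in> carrier (rows m)"
        using p q by (auto simp: direct_sum_simps)
      let ?P = "F (fst p, ext \<zero> (snd p))" and ?Q = "F (fst q, ext \<zero> (snd q))"
      define c where "c = ?P k \<ominus> ?Q k"
      have c: "c \<in> carrier R" using Fval[OF p'] Fval[OF q'] by (simp add: c_def)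
      have "F (fst q, ext c (snd q)) = ?P"
      proof (rule rows_eqI[OF Fc[OF inD[OF q'(1) c q'(2)]] Fc[OF inD[OF p'(1) zero_closed p'(2)]]])
        fix i assume i: "i < Suc k"
        show "F (fst q, ext c (snd q)) i = ?P i"
        proof (cases "i = k")
          case True
          have "?Q k \<oplus> (?P k \<ominus> ?Q k) = ?P k" using Fval[OF p', of k] Fval[OF q', of k]
            by (simp add: a_minus_def a_lcomm r_neg)
          then show ?thesis using split[OF q'(1) c q'(2) i] True by (simp add: c_def)
        next
          case False
          then have "G p i = ?P i" "G q i = ?Q i" using i by (auto simp: G_def)
          then have "?P i = ?Q i" using eq by simp
          then show ?thesis using split[OF q'(1) c q'(2) i] False Fval[OF q' i] by simp
        qed
      qed
      then have "(fst q, ext c (snd q)) = (fst p, ext \<zero> (snd p))"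
        using bij inD[OF q'(1) c q'(2)] inD[OF p'(1) zero_closed p'(2)]
        by (auto simp: bij_betw_def dest: inj_onD)
      then have "fst q = fst p" and e: "ext c (snd q) = ext \<zero> (snd p)" by auto
      moreover have "snd q = snd p"
      proof (rule rows_eqI[OF q'(2) p'(2)])
        show "snd q i = snd p i" if "i < m" for i
          using fun_cong[OF e, of i] that by (simp add: ext_def)
      qed
      ultimately show "p = q" by (simp add: prod_eq_iff)
    qed
    show "G ` carrier (direct_sum M (rows m)) = carrier (rows k)"
    proof
      show "G ` carrier (direct_sum M (rows m)) \<subseteq> carrier (rows k)"
        using module_hom_closed[OF \<open>G \<in> _\<close>] by auto
      show "carrier (rows k) \<subseteq> G ` carrier (direct_sum M (rows m))"
      proof
        fix y assume y: "y \<in> carrier (rows k)"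
        have "(\<lambda>i\<in>{..<Suc k}. if i < k then y i else \<zero>) \<in> carrier (rows (Suc k))"
          by (rule restrict_in_rows) (use rows_closed[OF y] in auto)
        then have "(\<lambda>i\<in>{..<Suc k}. if i < k then y i else \<zero>) \<in> F ` (carrier M \<times> carrier (rows (Suc m)))"
          using bij by (simp only: bij_betw_def direct_sum_simps)
        then obtain x u where xu: "x \<in> carrier M" "u \<in> carrier (rows (Suc m))"
          and Fxu: "F (x, u) = (\<lambda>i\<in>{..<Suc k}. if i < k then y i else \<zero>)"
          by (elim imageE SigmaE) simp
        define u' where "u' = restrict u {..<m}"
        have u': "u' \<in> carrier (rows m)"
          unfolding u'_def by (rule restrict_in_rows) (use rows_closed[OF xu(2)] in auto)
        have um: "u m \<in> carrier R" using rows_closed[OF xu(2)] by simp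
        have "u = ext (u m) u'"
          by (rule rows_eqI[OF xu(2) ext[OF um u']]) (auto simp: ext_def u'_def less_Suc_eq)
        then have "G (x, u') = y"
        proof (intro rows_eqI[OF _ y])
          show "G (x, u') \<in> carrier (rows k)"
            using module_hom_closed[OF \<open>G \<in> _\<close>] xu(1) u' by (auto simp: direct_sum_simps)
          fix i assume i: "i < k" and ueq: "u = ext (u m) u'"
          have "F (x, ext (u m) u') i = F (x, ext \<zero> u') i"
            using split[OF xu(1) um u', of i] Fval[OF xu(1) u', of i] i by simp
          then show "G (x, u') i = y i"
            using Fxu i by (simp add: G_def ueq[symmetric])
        qed
        then show "y \<in> G ` carrier (direct_sum M (rows m))"
          using xu(1) u' by (auto simp: direct_sum_simps intro!: rev_image_eqI[of "(x, u')"])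
      qed
    qed
  qed
  ultimately show ?thesis unfolding module_isomorphic_def by blast
qed

text \<open>
  The image \<open>v\<close> of the last basis vector is unimodular: the last coordinate of
  the inverse isomorphism is a linear form with value one at \<open>v\<close>. Completing
  \<open>v\<close> to a basis moves it to the last basis vector, and that coordinate is
  dropped.
\<close>
lemma cancel_free_summand:
  assumes M: "module R M"
    and comp: "\<And>n v w. r < n \<Longrightarrow> v \<in> carrier (rows n) \<Longrightarrow> w \<in> carrier (rows n) \<Longrightarrow>
      (\<Oplus>i\<in>{..<n}. v i \<otimes> w i) = \<one> \<Longrightarrow> completable n v"
    and iso: "module_isomorphic R (direct_sum M (rows m)) (rows (m + r))"
  shows "module_isomorphic R (direct_sum M (rows 0)) (rows r)"
  using iso
proof (induction m)
  case (Suc m)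
  interpret M: module R M by fact
  let ?D = "direct_sum M (rows (Suc m))" and ?n = "Suc (m + r)"
  interpret D: module R ?D by (rule direct_sum_is_module[OF M rows_module])
  obtain F where F: "F \<in> module_hom R ?D (rows ?n)" "bij_betw F (carrier ?D) (carrier (rows ?n))"
    using Suc.prems by (auto simp: module_isomorphic_def)
  note H = module_hom_inverse[OF F D.module_axioms]
  let ?H = "inv_into (carrier ?D) F"
  define e where "e = (\<zero>\<^bsub>M\<^esub>, unit_row (Suc m) m)"
  have e: "e \<in> carrier ?D" using unit_row_closed by (simp add: e_def direct_sum_simps)
  define l where "l y = snd (?H y) m" for y
  have Hc: "?H y \<in> carrier ?D" if "y \<in> carrier (rows ?n)" for y
    using module_hom_closed[OF H] that by auto
  have lc: "l y \<in> carrier R" if "y \<in> carrier (rows ?n)" for y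
    using Hc[OF that] rows_closed[of _ "Suc m" m] by (auto simp: l_def direct_sum_simps)
  have Fe: "F e \<in> carrier (rows ?n)" using module_hom_closed[OF F(1)] e by auto
  define w where "w = (\<lambda>i\<in>{..<?n}. l (unit_row ?n i))"
  have w: "w \<in> carrier (rows ?n)"
    unfolding w_def by (rule restrict_in_rows) (rule lc[OF unit_row_closed])
  have "l (F e) = (\<Oplus>i\<in>{..<?n}. l (F e i \<odot>\<^bsub>rows ?n\<^esub> unit_row ?n i))"
  proof (rule additive_expand[OF _ lc _ Fe])
    show "abelian_group R" ..
    show "l (x \<oplus>\<^bsub>rows ?n\<^esub> y) = l x \<oplus> l y" if "x \<in> carrier (rows ?n)" "y \<in> carrier (rows ?n)" for x y
      using module_hom_add[OF H that] by (simp add: l_def direct_sum_simps rows_simps)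
  qed
  also have "\<dots> = (\<Oplus>i\<in>{..<?n}. F e i \<otimes> w i)"
  proof (rule finsum_cong')
    fix i assume i: "i \<in> {..<?n}"
    show "l (F e i \<odot>\<^bsub>rows ?n\<^esub> unit_row ?n i) = F e i \<otimes> w i"
      using module_hom_smult[OF H rows_closed[OF Fe] unit_row_closed, of i] i
      by (simp add: l_def w_def direct_sum_simps rows_simps)
  qed (use rows_closed[OF Fe] rows_closed[OF w] in auto)
  also have "l (F e) = \<one>"
    using F(2) e by (simp add: l_def bij_betw_def) (simp add: e_def unit_row_def)
  finally have "completable ?n (F e)" using comp[OF _ Fe w] by simp
  then obtain g where g: "g \<in> module_hom R (rows ?n) (rows ?n)"
    "bij_betw g (carrier (rows ?n)) (carrier (rows ?n))" "g (F e) = unit_row ?n (m + r)"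
    by (auto simp: completable_def)
  have "bij_betw (\<lambda>x. g (F x)) (carrier ?D) (carrier (rows ?n))"
    using bij_betw_trans[OF F(2) g(2)] unfolding comp_def .
  then have "module_isomorphic R (direct_sum M (rows m)) (rows (m + r))"
    by (rule drop_last_coordinate[OF M module_hom_comp[OF F(1) g(1)]]) (use g(3) in \<open>simp add: e_def\<close>)
  then show ?case by (rule Suc.IH)
qed simp

text \<open>
  The basis consists of the images of the basis vectors. Over the zero ring these coincide,
  and the empty set is a basis instead.
\<close>
lemma free_if_isomorphic_to_rows:
  assumes M: "module R M" and iso: "module_isomorphic R (direct_sum M (rows 0)) (rows r)"
  shows "free_module R M"
proof -
  interpret M: module R M by fact
  interpret V: module R "rows r" by (rule rows_module)
  let ?D = "direct_sum M (rows 0)"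
  interpret D: module R ?D by (rule direct_sum_is_module[OF M rows_module])
  have rows0: "carrier (func_space ({} :: nat set)) = {\<lambda>i. undefined}" by (simp add: func_space_def)
  obtain F where F: "F \<in> module_hom R ?D (rows r)" "bij_betw F (carrier ?D) (carrier (rows r))"
    using iso by (auto simp: module_isomorphic_def)
  define G where "G y = fst (inv_into (carrier ?D) F y)" for y
  note H = module_hom_inverse[OF F D.module_axioms]
  have G: "G \<in> module_hom R (rows r) M"
    using module_hom_closed[OF H] module_hom_add[OF H] module_hom_smult[OF H]
    by (intro module_homI) (auto simp: G_def direct_sum_simps Pi_iff)
  have "bij_betw (inv_into (carrier ?D) F) (carrier (rows r)) (carrier ?D)"
    by (rule bij_betw_inv_into[OF F(2)])
  moreover have "bij_betw fst (carrier ?D) (carrier M)"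
    by (rule bij_betwI[of _ _ _ "\<lambda>x. (x, \<lambda>i. undefined)"]) (auto simp: direct_sum_simps rows0)
  ultimately have bijG: "bij_betw G (carrier (rows r)) (carrier M)"
    using bij_betw_trans unfolding G_def comp_def by blast
  note Gc = module_hom_closed[OF G, THEN funcset_mem]
  define b where "b i = G (unit_row r i)" for i
  have b: "b i \<in> carrier M" for i unfolding b_def by (rule Gc[OF unit_row_closed])
  have expand: "G y = (\<Oplus>\<^bsub>M\<^esub>i\<in>{..<r}. y i \<odot>\<^bsub>M\<^esub> b i)" if y: "y \<in> carrier (rows r)" for y
  proof -
    have "G y = (\<Oplus>\<^bsub>M\<^esub>i\<in>{..<r}. G (y i \<odot>\<^bsub>rows r\<^esub> unit_row r i))"
      by (rule additive_expand[OF M.abelian_group_axioms Gc module_hom_add[OF G] y])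
    also have "\<dots> = (\<Oplus>\<^bsub>M\<^esub>i\<in>{..<r}. y i \<odot>\<^bsub>M\<^esub> b i)"
      using module_hom_smult[OF G rows_closed[OF y] unit_row_closed] rows_closed[OF y] b
      by (intro M.finsum_cong') (auto simp: b_def)
    finally show ?thesis .
  qed
  show ?thesis
  proof (cases "\<one> = \<zero>")
    case True
    have "x = \<zero>\<^bsub>M\<^esub>" if "x \<in> carrier M" for x
      using M.smult_one[OF that] M.lmult_0[OF that] True by simp
    then have "carrier M = {\<zero>\<^bsub>M\<^esub>}" by auto
    moreover have "M.span {} = {\<zero>\<^bsub>M\<^esub>}" by (auto simp: M.span_def M.lincomb_def)
    moreover have "\<not> M.lin_dep {}" by (auto simp: M.lin_dep_def)
    ultimately show ?thesis unfolding free_module_def by (intro exI[of _ "{}"]) auto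
  next
    case False
    have inj: "inj_on b {..<r}"
    proof (rule inj_onI)
      fix i j assume ij: "i \<in> {..<r}" "j \<in> {..<r}" "b i = b j"
      then have "unit_row r i = unit_row r j"
        using bijG unit_row_closed by (auto simp: b_def bij_betw_def dest: inj_onD)
      from fun_cong[OF this, of i] show "i = j" using ij False by (auto simp: unit_row_def split: if_splits)
    qed
    have lin: "M.lincomb a (b ` {..<r}) = G (\<lambda>i\<in>{..<r}. a (b i))"
      if a: "\<And>i. i < r \<Longrightarrow> a (b i) \<in> carrier R" for a
    proof -
      have "M.lincomb a (b ` {..<r}) = (\<Oplus>\<^bsub>M\<^esub>i\<in>{..<r}. a (b i) \<odot>\<^bsub>M\<^esub> b i)"
        unfolding M.lincomb_def using inj a b by (intro M.add.finprod_reindex) auto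
      also have "\<dots> = (\<Oplus>\<^bsub>M\<^esub>i\<in>{..<r}. (\<lambda>i\<in>{..<r}. a (b i)) i \<odot>\<^bsub>M\<^esub> b i)"
        using a b by (intro M.finsum_cong') auto
      also have "\<dots> = G (\<lambda>i\<in>{..<r}. a (b i))"
        using expand[OF restrict_in_rows, of "\<lambda>i. a (b i)"] a by simp
      finally show ?thesis .
    qed
    have "\<not> M.lin_dep (b ` {..<r})"
    proof
      assume "M.lin_dep (b ` {..<r})"
      then obtain A a v where A: "finite A" "A \<subseteq> b ` {..<r}" "a \<in> A \<rightarrow> carrier R"
        "M.lincomb a A = \<zero>\<^bsub>M\<^esub>" "v \<in> A" "a v \<noteq> \<zero>"
        by (auto simp: M.lin_dep_def)
      define a' where "a' x = (if x \<in> A then a x else \<zero>)" for x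
      have a': "a' x \<in> carrier R" for x using A(3) by (auto simp: a'_def)
      have "M.lincomb a A = M.lincomb a' (b ` {..<r})"
        unfolding M.lincomb_def
        by (rule M.add.finprod_mono_neutral_cong_left) (use A a' b in \<open>auto simp: a'_def\<close>)
      then have "G (\<lambda>i\<in>{..<r}. a' (b i)) = \<zero>\<^bsub>M\<^esub>" using A(4) lin[of a'] a' by simp
      moreover have "G \<zero>\<^bsub>rows r\<^esub> = \<zero>\<^bsub>M\<^esub>"
        using module_hom_smult[OF G zero_closed V.zero_closed] Gc[OF V.zero_closed] by simp
      ultimately have "(\<lambda>i\<in>{..<r}. a' (b i)) = \<zero>\<^bsub>rows r\<^esub>"
        using bijG restrict_in_rows[of r "\<lambda>i. a' (b i)"] a'
        by (intro inj_onD[of G "carrier (rows r)"] V.zero_closed) (simp_all add: bij_betw_def)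
      moreover obtain i where "i < r" "v = b i" using A(2,5) by auto
      ultimately have "a' v = \<zero>" by (auto simp: rows_simps dest: fun_cong[of _ _ i])
      then show False using A(5,6) by (simp add: a'_def)
    qed
    moreover have "M.span (b ` {..<r}) = carrier M"
    proof
      show "M.span (b ` {..<r}) \<subseteq> carrier M"
        using b by (auto simp: M.span_def intro!: M.lincomb_closed)
      show "carrier M \<subseteq> M.span (b ` {..<r})"
      proof
        fix x assume "x \<in> carrier M"
        then obtain y where y: "y \<in> carrier (rows r)" "x = G y" using bijG by (auto simp: bij_betw_def)
        define a where "a v = y (inv_into {..<r} b v)" for v
        have ab: "a (b i) = y i" if "i < r" for i using that inj by (simp add: a_def)
        have "(\<lambda>i\<in>{..<r}. a (b i)) = y"
          by (rule rows_eqI[OF restrict_in_rows y(1)]) (use ab rows_closed[OF y(1)] in auto)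
        then have "M.lincomb a (b ` {..<r}) = x" using lin[of a] ab rows_closed[OF y(1)] y(2) by simp
        then show "x \<in> M.span (b ` {..<r})"
          unfolding M.span_def using ab rows_closed[OF y(1)]
          by (intro CollectI exI[of _ a] exI[of _ "b ` {..<r}"]) auto
      qed
    qed
    ultimately show ?thesis unfolding free_module_def using b by (intro exI[of _ "b ` {..<r}"]) auto
  qed
qed

lemma completable_transform:
  assumes "T \<in> module_hom R (rows n) (rows n)" "bij_betw T (carrier (rows n)) (carrier (rows n))"
    and "completable n (T v)"
  shows "completable n v"
proof -
  obtain g where g: "g \<in> module_hom R (rows n) (rows n)"
    "bij_betw g (carrier (rows n)) (carrier (rows n))" "g (T v) = unit_row n (n - 1)"
    using assms(3) by (auto simp: completable_def)
  then show ?thesis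
    unfolding completable_def
    using module_hom_comp[OF assms(1) g(1)] bij_betw_trans[OF assms(2) g(2)]
    by (intro bexI[of _ "\<lambda>x. g (T x)"]) (simp_all add: comp_def)
qed

lemma completable_scale:
  assumes x: "x \<in> carrier R" "u \<in> carrier R" "x \<otimes> u = \<one>" and v: "completable n (x \<odot>\<^bsub>rows n\<^esub> v)"
  shows "completable n v"
proof (rule completable_transform[of "\<lambda>y. x \<odot>\<^bsub>rows n\<^esub> y" n v, OF _ _ v])
  interpret V: module R "rows n" by (rule rows_module)
  show "(\<lambda>y. x \<odot>\<^bsub>rows n\<^esub> y) \<in> module_hom R (rows n) (rows n)"
    using x(1) by (intro module_homI) (simp_all add: V.smult_r_distr V.smult_assoc1[symmetric] m_comm)
  have "u \<odot>\<^bsub>rows n\<^esub> (x \<odot>\<^bsub>rows n\<^esub> y) = y" "x \<odot>\<^bsub>rows n\<^esub> (u \<odot>\<^bsub>rows n\<^esub> y) = y"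
    if "y \<in> carrier (rows n)" for y
    using x that m_comm[OF x(1,2)] by (simp_all add: V.smult_assoc1[symmetric])
  then show "bij_betw (\<lambda>y. x \<odot>\<^bsub>rows n\<^esub> y) (carrier (rows n)) (carrier (rows n))"
    using x by (intro bij_betwI[of _ _ _ "\<lambda>y. u \<odot>\<^bsub>rows n\<^esub> y"]) auto
qed

definition pair_map :: "nat \<Rightarrow> nat \<Rightarrow> nat \<Rightarrow> 'a \<Rightarrow> 'a \<Rightarrow> 'a \<Rightarrow> 'a \<Rightarrow> (nat \<Rightarrow> 'a) \<Rightarrow> nat \<Rightarrow> 'a" where
  "pair_map n i j a b c e y = (\<lambda>k\<in>{..<n}. if k = i then a \<otimes> y i \<oplus> b \<otimes> y j
     else if k = j then c \<otimes> y i \<oplus> e \<otimes> y j else y k)"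

lemma pair_map_closed:
  assumes "i < n" "j < n" "a \<in> carrier R" "b \<in> carrier R" "c \<in> carrier R" "e \<in> carrier R"
    and "y \<in> carrier (rows n)"
  shows "pair_map n i j a b c e y \<in> carrier (rows n)"
  unfolding pair_map_def by (rule restrict_in_rows) (use assms rows_closed[OF assms(7)] in auto)

lemma pair_map_inverse:
  assumes ij: "i < n" "j < n" "i \<noteq> j"
    and abce: "a \<in> carrier R" "b \<in> carrier R" "c \<in> carrier R" "e \<in> carrier R"
    and abce': "a' \<in> carrier R" "b' \<in> carrier R" "c' \<in> carrier R" "e' \<in> carrier R"
    and inv: "a' \<otimes> a \<oplus> b' \<otimes> c = \<one>" "a' \<otimes> b \<oplus> b' \<otimes> e = \<zero>"
      "c' \<otimes> a \<oplus> e' \<otimes> c = \<zero>" "c' \<otimes> b \<oplus> e' \<otimes> e = \<one>"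
    and y: "y \<in> carrier (rows n)"
  shows "pair_map n i j a' b' c' e' (pair_map n i j a b c e y) = y"
proof (rule rows_eqI[OF pair_map_closed[OF ij(1,2) abce' pair_map_closed[OF ij(1,2) abce y]] y])
  fix k assume k: "k < n"
  have yi: "y i \<in> carrier R" and yj: "y j \<in> carrier R" using rows_closed[OF y] ij by auto
  have lin: "s \<otimes> (a \<otimes> y i \<oplus> b \<otimes> y j) \<oplus> t \<otimes> (c \<otimes> y i \<oplus> e \<otimes> y j)
    = (s \<otimes> a \<oplus> t \<otimes> c) \<otimes> y i \<oplus> (s \<otimes> b \<oplus> t \<otimes> e) \<otimes> y j"
    if "s \<in> carrier R" "t \<in> carrier R" for s t
    using that abce yi yj by algebra
  show "pair_map n i j a' b' c' e' (pair_map n i j a b c e y) k = y k"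
    using k ij yi yj lin[OF abce'(1,2)] lin[OF abce'(3,4)] by (auto simp: pair_map_def inv)
qed

text \<open>
  The inverse automorphism is given by the adjugate matrix times \<open>u\<close>.
\<close>
lemma completable_pair_map:
  assumes ij: "i < n" "j < n" "i \<noteq> j"
    and abce: "a \<in> carrier R" "b \<in> carrier R" "c \<in> carrier R" "e \<in> carrier R"
    and u: "u \<in> carrier R" "(a \<otimes> e \<ominus> b \<otimes> c) \<otimes> u = \<one>"
    and v: "completable n (pair_map n i j a b c e v)"
  shows "completable n v"
proof (rule completable_transform[of "pair_map n i j a b c e" n v, OF _ _ v])
  show "pair_map n i j a b c e \<in> module_hom R (rows n) (rows n)"
  proof (rule module_homI)
    fix x assume x: "x \<in> carrier (rows n)"
    have xc: "x k \<in> carrier R" if "k < n" for k using rows_closed[OF x that] .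
    show "pair_map n i j a b c e x \<in> carrier (rows n)" by (rule pair_map_closed[OF ij(1,2) abce x])
    show "pair_map n i j a b c e (s \<odot>\<^bsub>rows n\<^esub> x) = s \<odot>\<^bsub>rows n\<^esub> pair_map n i j a b c e x"
      if s: "s \<in> carrier R" for s
    proof -
      have "a' \<otimes> (s \<otimes> x i) \<oplus> b' \<otimes> (s \<otimes> x j) = s \<otimes> (a' \<otimes> x i \<oplus> b' \<otimes> x j)"
        if "a' \<in> carrier R" "b' \<in> carrier R" for a' b'
        using that s xc[OF ij(1)] xc[OF ij(2)] by algebra
      then show ?thesis using ij abce by (auto simp: pair_map_def rows_simps fun_eq_iff)
    qed
    fix y assume y: "y \<in> carrier (rows n)"
    have yc: "y k \<in> carrier R" if "k < n" for k using rows_closed[OF y that] .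
    have "a' \<otimes> (x i \<oplus> y i) \<oplus> b' \<otimes> (x j \<oplus> y j) = (a' \<otimes> x i \<oplus> b' \<otimes> x j) \<oplus> (a' \<otimes> y i \<oplus> b' \<otimes> y j)"
      if "a' \<in> carrier R" "b' \<in> carrier R" for a' b'
      using that xc[OF ij(1)] xc[OF ij(2)] yc[OF ij(1)] yc[OF ij(2)] by algebra
    then show "pair_map n i j a b c e (x \<oplus>\<^bsub>rows n\<^esub> y)
      = pair_map n i j a b c e x \<oplus>\<^bsub>rows n\<^esub> pair_map n i j a b c e y"
      using ij abce by (auto simp: pair_map_def rows_simps fun_eq_iff)
  qed
  define T' where "T' = pair_map n i j (u \<otimes> e) (\<ominus> (u \<otimes> b)) (\<ominus> (u \<otimes> c)) (u \<otimes> a)"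
  have cl: "u \<otimes> e \<in> carrier R" "\<ominus> (u \<otimes> b) \<in> carrier R" "\<ominus> (u \<otimes> c) \<in> carrier R" "u \<otimes> a \<in> carrier R"
    using abce u by auto
  have eqs: "u \<otimes> e \<otimes> a \<oplus> \<ominus> (u \<otimes> b) \<otimes> c = (a \<otimes> e \<ominus> b \<otimes> c) \<otimes> u"
    "u \<otimes> e \<otimes> b \<oplus> \<ominus> (u \<otimes> b) \<otimes> e = \<zero>" "\<ominus> (u \<otimes> c) \<otimes> a \<oplus> u \<otimes> a \<otimes> c = \<zero>"
    "\<ominus> (u \<otimes> c) \<otimes> b \<oplus> u \<otimes> a \<otimes> e = (a \<otimes> e \<ominus> b \<otimes> c) \<otimes> u"
    "a \<otimes> (u \<otimes> e) \<oplus> b \<otimes> \<ominus> (u \<otimes> c) = (a \<otimes> e \<ominus> b \<otimes> c) \<otimes> u"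
    "a \<otimes> \<ominus> (u \<otimes> b) \<oplus> b \<otimes> (u \<otimes> a) = \<zero>" "c \<otimes> (u \<otimes> e) \<oplus> e \<otimes> \<ominus> (u \<otimes> c) = \<zero>"
    "c \<otimes> \<ominus> (u \<otimes> b) \<oplus> e \<otimes> (u \<otimes> a) = (a \<otimes> e \<ominus> b \<otimes> c) \<otimes> u"
    using abce u(1) by algebra+
  show "bij_betw (pair_map n i j a b c e) (carrier (rows n)) (carrier (rows n))"
  proof (rule bij_betwI[of _ _ _ T'])
    show "pair_map n i j a b c e \<in> carrier (rows n) \<rightarrow> carrier (rows n)"
      "T' \<in> carrier (rows n) \<rightarrow> carrier (rows n)"
      using pair_map_closed[OF ij(1,2) abce] pair_map_closed[OF ij(1,2) cl] by (auto simp: T'_def)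
    show "T' (pair_map n i j a b c e y) = y" if "y \<in> carrier (rows n)" for y
      unfolding T'_def by (rule pair_map_inverse[OF ij abce cl]) (simp_all only: eqs u(2) that)
    show "pair_map n i j a b c e (T' y) = y" if "y \<in> carrier (rows n)" for y
      unfolding T'_def by (rule pair_map_inverse[OF ij cl abce]) (simp_all only: eqs u(2) that)
  qed
qed

end

section \<open>A commutative ring as a quotient of a free one\<close>

text \<open>
  Polynomials with integer coefficients in variables indexed by the type \<open>'a\<close>;
  a monomial is the multiset of its variables.
\<close>
type_synonym 'a free_ring = "'a multiset \<Rightarrow>\<^sub>0 int"

lemma free_ring_induct [case_names zero single add]:
  fixes p :: "'a free_ring"
  assumes "P 0" "\<And>m c. P (Poly_Mapping.single m c)" "\<And>p q. P p \<Longrightarrow> P q \<Longrightarrow> P (p + q)"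
  shows "P p"
proof (induction p rule: Poly_Mapping.update_induct)
  case const
  then show ?case by (rule assms(1))
next
  case (update f a b)
  have "Poly_Mapping.update a b f = f + Poly_Mapping.single a b"
    using update(1) by (intro poly_mapping_eqI) (auto simp: lookup_update lookup_add lookup_single in_keys_iff when_def)
  then show ?case using assms(2,3) update(3) by simp
qed

context cring begin

text \<open>
  Elements of the type outside the carrier index variables as well and need some value in
  the carrier; \<open>\<one>\<close> is an arbitrary choice.
\<close>
definition monomial_value :: "'a multiset \<Rightarrow> 'a" where
  "monomial_value m = (\<Otimes>x\<in>set_mset m. (if x \<in> carrier R then x else \<one>) [^] count m x)"

definition free_value :: "'a free_ring \<Rightarrow> 'a" where
  "free_value p = (\<Oplus>m\<in>Poly_Mapping.keys p. [Poly_Mapping.lookup p m] \<cdot> monomial_value m)"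

lemma monomial_value_closed: "monomial_value m \<in> carrier R"
  unfolding monomial_value_def by (rule finprod_closed) auto

lemma monomial_value_superset:
  assumes "finite A" "set_mset m \<subseteq> A"
  shows "monomial_value m = (\<Otimes>x\<in>A. (if x \<in> carrier R then x else \<one>) [^] count m x)"
  unfolding monomial_value_def
  by (rule finprod_mono_neutral_cong_left) (use assms in \<open>auto simp: not_in_iff\<close>)

lemma monomial_value_add: "monomial_value (m + m') = monomial_value m \<otimes> monomial_value m'"
proof -
  let ?A = "set_mset m \<union> set_mset m'" and ?g = "\<lambda>x. if x \<in> carrier R then x else \<one>"
  have "monomial_value (m + m') = (\<Otimes>x\<in>?A. ?g x [^] count m x \<otimes> ?g x [^] count m' x)"
    unfolding monomial_value_def by (rule finprod_cong') (auto simp: nat_pow_mult)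
  also have "\<dots> = monomial_value m \<otimes> monomial_value m'"
    by (subst finprod_multf) (auto simp: monomial_value_superset[of ?A m] monomial_value_superset[of ?A m'])
  finally show ?thesis .
qed

lemma free_value_superset:
  assumes "finite A" "Poly_Mapping.keys p \<subseteq> A"
  shows "free_value p = (\<Oplus>m\<in>A. [Poly_Mapping.lookup p m] \<cdot> monomial_value m)"
  unfolding free_value_def
  by (rule add.finprod_mono_neutral_cong_left)
    (use assms monomial_value_closed in \<open>auto simp: in_keys_iff add_pow_int_ge\<close>)

lemma free_value_closed: "free_value p \<in> carrier R"
  unfolding free_value_def by (rule finsum_closed) (auto simp: monomial_value_closed)

lemma free_value_single: "free_value (Poly_Mapping.single m c) = [c] \<cdot> monomial_value m"
  by (subst free_value_superset[of "{m}"]) (auto simp: monomial_value_closed)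

lemma free_value_zero: "free_value 0 = \<zero>"
  by (simp add: free_value_def)

lemma free_value_add: "free_value (p + q) = free_value p \<oplus> free_value q"
proof -
  let ?A = "Poly_Mapping.keys p \<union> Poly_Mapping.keys q"
  have "free_value (p + q) = (\<Oplus>m\<in>?A. [Poly_Mapping.lookup p m] \<cdot> monomial_value m
      \<oplus> [Poly_Mapping.lookup q m] \<cdot> monomial_value m)"
    using keys_add[of p q] monomial_value_closed
    by (subst free_value_superset[of ?A]) (auto simp: lookup_add add.int_pow_mult intro!: finsum_cong')
  also have "\<dots> = free_value p \<oplus> free_value q"
    using monomial_value_closed
    by (subst finsum_addf) (auto simp: free_value_superset[of ?A p] free_value_superset[of ?A q])
  finally show ?thesis .
qed

lemma free_value_mult: "free_value (p * q) = free_value p \<otimes> free_value q"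
proof (induction p rule: free_ring_induct)
  case zero
  then show ?case using free_value_closed by (simp add: free_value_zero)
next
  case (add p p')
  then show ?case using free_value_closed by (simp add: distrib_right free_value_add l_distr)
next
  case (single m c)
  show ?case
  proof (induction q rule: free_ring_induct)
    case zero
    then show ?case using free_value_closed by (simp add: free_value_zero)
  next
    case (add p p')
    then show ?case using free_value_closed by (simp add: distrib_left free_value_add r_distr)
  next
    case (single m' c')
    note closed = monomial_value_closed[of m] monomial_value_closed[of m']
    have "add_pow R (c * c') (monomial_value m \<otimes> monomial_value m') = ([c] \<cdot> monomial_value m) \<otimes> ([c'] \<cdot> monomial_value m')"
      using closed by (simp add: add_pow_ldistr_int add_pow_rdistr_int add.int_pow_pow mult.commute)
    then show ?case by (simp add: mult_single free_value_single monomial_value_add)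
  qed
qed

lemma free_value_one: "free_value 1 = \<one>"
proof -
  have "free_value (Poly_Mapping.single {#} 1) = \<one>"
    unfolding free_value_single by (simp add: monomial_value_def)
  then show ?thesis by simp
qed

lemma free_value_surj:
  assumes "x \<in> carrier R"
  shows "\<exists>p. free_value p = x"
proof -
  have "monomial_value {#x#} = x" using assms by (simp add: monomial_value_def)
  then have "free_value (Poly_Mapping.single {#x#} 1) = x" using assms by (simp add: free_value_single add_pow_int_ge)
  then show ?thesis ..
qed

lemma free_value_uminus: "free_value (- p) = \<ominus> free_value p"
proof (rule minus_equality[symmetric])
  show "free_value (- p) \<oplus> free_value p = \<zero>"
    using free_value_add[of "- p" p] by (simp add: free_value_zero)
qed (rule free_value_closed)+

lemma free_value_diff: "free_value (p - q) = free_value p \<ominus> free_value q"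
  using free_value_add[of p "- q"] by (simp add: free_value_uminus a_minus_def)

lemma free_value_sum: "free_value (sum f A) = (\<Oplus>i\<in>A. free_value (f i))" if "finite A"
  using that by (induction A rule: finite_induct) (auto simp: free_value_zero free_value_add free_value_closed)

text \<open>
  The kernel of the surjection from the free ring, so that the quotient by it is
  \<open>R\<close>.
\<close>
definition relations :: "'a free_ring set" where
  "relations = {p. free_value p = \<zero>}"

lemma ideal_relations: "ideal_set relations"
  using free_value_closed by (auto simp: ideal_set_def relations_def free_value_zero free_value_add free_value_mult)

lemma relations_diff_iff: "p - q \<in> relations \<longleftrightarrow> free_value p = free_value q"
  using free_value_closed by (simp add: relations_def free_value_diff)

text \<open>
  Correspondence of primes under the surjection \<open>free_value\<close>: a prime that
  contains the kernel is the full preimage of its image.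
\<close>
lemma primeideal_free_value_image:
  assumes P: "P \<in> primes_over relations {}"
  shows "primeideal (free_value ` P) R" "free_value p \<in> free_value ` P \<longleftrightarrow> p \<in> P"
proof -
  have prm: "prime_set P" and rel: "relations \<subseteq> P" using P by (auto simp: primes_over_def)
  note idP = ideal_setD[OF prime_setD(1)[OF prm]]
  have mem: "free_value p \<in> free_value ` P \<longleftrightarrow> p \<in> P" for p
  proof
    assume "free_value p \<in> free_value ` P"
    then obtain q where "q \<in> P" "free_value p = free_value q" by auto
    then show "p \<in> P"
      using relations_diff_iff[of p q] rel ideal_set_diff_iff[OF prime_setD(1)[OF prm], of p q] by blast
  qed simp
  show "free_value p \<in> free_value ` P \<longleftrightarrow> p \<in> P" by (rule mem)
  show "primeideal (free_value ` P) R"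
  proof (rule primeidealI[OF idealI])
    show "subgroup (free_value ` P) (add_monoid R)"
    proof (rule subgroup.intro)
      show "free_value ` P \<subseteq> carrier (add_monoid R)" using free_value_closed by auto
      show "x \<otimes>\<^bsub>add_monoid R\<^esub> y \<in> free_value ` P" if "x \<in> free_value ` P" "y \<in> free_value ` P" for x y
        using that idP(2) by (auto simp: free_value_add[symmetric])
      show "\<one>\<^bsub>add_monoid R\<^esub> \<in> free_value ` P" using idP(1) mem[of 0] by (simp add: free_value_zero)
      show "inv\<^bsub>add_monoid R\<^esub> x \<in> free_value ` P" if "x \<in> free_value ` P" for x
        using that idP(5) by (auto simp: free_value_uminus[symmetric] a_inv_def[symmetric])
    qed
    show "x \<otimes> a \<in> free_value ` P" "a \<otimes> x \<in> free_value ` P"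
      if a: "a \<in> free_value ` P" and x: "x \<in> carrier R" for a x
    proof -
      obtain p q where "a = free_value p" "p \<in> P" "x = free_value q" using a free_value_surj[OF x] by auto
      then show "x \<otimes> a \<in> free_value ` P" "a \<otimes> x \<in> free_value ` P"
        using idP(3,4) by (auto simp: free_value_mult[symmetric])
    qed
    show "carrier R \<noteq> free_value ` P"
      using mem[of 1] prime_setD(2)[OF prm] by (metis free_value_one one_closed)
    show "a \<in> free_value ` P \<or> b \<in> free_value ` P"
      if a: "a \<in> carrier R" and b: "b \<in> carrier R" and ab: "a \<otimes> b \<in> free_value ` P" for a b
    proof -
      obtain p q where pq: "a = free_value p" "b = free_value q"
        using free_value_surj[OF a] free_value_surj[OF b] by metis
      then have "p * q \<in> P" using ab mem by (simp add: free_value_mult[symmetric])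
      then show ?thesis using prime_setD(3)[OF prm] pq mem by blast
    qed
  qed (rule ring_axioms cring_axioms is_cring)+
qed

lemma no_long_chain_of_primes:
  assumes "krull_dim R \<le> ereal (real d)"
  shows "\<nexists>P. strict_chain (primes_over relations {}) (Suc d) P"
proof
  assume "\<exists>P. strict_chain (primes_over relations {}) (Suc d) P"
  then obtain P where P: "strict_chain (primes_over relations {}) (Suc d) P" ..
  have "prime_chain R (Suc d) (\<lambda>i. free_value ` P i)"
    unfolding prime_chain_def
  proof (intro conjI allI impI)
    show "primeideal (free_value ` P i) R" if "i \<le> Suc d" for i
      using P that by (intro primeideal_free_value_image(1)) (simp add: strict_chain_def)
    fix i assume i: "i < Suc d"
    then have "P i \<subset> P (Suc i)" "P i \<in> primes_over relations {}" using P by (auto simp: strict_chain_def)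
    then show "free_value ` P i \<subset> free_value ` P (Suc i)"
      using primeideal_free_value_image(2)[of "P i"] by blast
  qed
  then have "ereal (real (Suc d)) \<le> krull_dim R" unfolding krull_dim_def by (intro Sup_upper) blast
  then have "ereal (real (Suc d)) \<le> ereal (real d)" using assms by (rule order.trans)
  then show False by simp
qed

section \<open>Unimodular rows over the Laurent polynomial ring\<close>

text \<open>
  The homomorphism from polynomials over the free ring to Laurent polynomials over
  \<open>R\<close>.
\<close>
definition laurent_value :: "'a free_ring poly \<Rightarrow> int \<Rightarrow> 'a" where
  "laurent_value p = (\<lambda>k. if k < 0 then \<zero> else free_value (coeff p (nat k)))"

definition X_power :: "int \<Rightarrow> int \<Rightarrow> 'a" where
  "X_power z = (\<lambda>k. if k = z then \<one> else \<zero>)"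

lemma laurent_ring_simps:
  "carrier (laurent_ring R) = laurent_carrier R"
  "\<zero>\<^bsub>laurent_ring R\<^esub> = (\<lambda>k. \<zero>)"
  "\<one>\<^bsub>laurent_ring R\<^esub> = X_power 0"
  "f \<oplus>\<^bsub>laurent_ring R\<^esub> g = (\<lambda>k. f k \<oplus> g k)"
  by (simp_all add: laurent_ring_def X_power_def)

lemma laurent_value_closed: "laurent_value p \<in> laurent_carrier R"
proof (rule laurent_carrierI)
  show "finite (int ` {..degree p})" by simp
  show "laurent_value p k = \<zero>" if k: "k \<notin> int ` {..degree p}" for k
  proof (cases "k < 0")
    case False
    then have "nat k \<notin> {..degree p}" using k by (metis imageI int_nat_eq not_less)
    then show ?thesis using False by (simp add: laurent_value_def coeff_eq_0 free_value_zero)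
  qed (simp add: laurent_value_def)
qed (simp add: laurent_value_def free_value_closed)

lemma laurent_value_add:
  "laurent_value (p + q) = laurent_value p \<oplus>\<^bsub>laurent_ring R\<^esub> laurent_value q"
  by (auto simp: laurent_ring_simps laurent_value_def free_value_add fun_eq_iff)

lemma laurent_value_mult:
  "laurent_value (p * q) = laurent_value p \<otimes>\<^bsub>laurent_ring R\<^esub> laurent_value q"
proof
  fix k
  define M where "M = max (degree p) (nat k)"
  note closed = free_value_closed laurent_carrierD(1)[OF laurent_value_closed]
  have "{i. laurent_value p i \<noteq> \<zero>} \<subseteq> int ` {..M}"
  proof
    fix i assume "i \<in> {i. laurent_value p i \<noteq> \<zero>}"
    then have i: "\<not> i < 0" "free_value (coeff p (nat i)) \<noteq> \<zero>"
      by (auto simp: laurent_value_def split: if_splits)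
    then have "nat i \<le> degree p" by (intro le_degree) (auto simp: free_value_zero)
    then show "i \<in> int ` {..M}" using i(1) by (intro rev_image_eqI[of "nat i"]) (auto simp: M_def)
  qed
  then have "(laurent_value p \<otimes>\<^bsub>laurent_ring R\<^esub> laurent_value q) k
      = (\<Oplus>i\<in>int ` {..M}. laurent_value p i \<otimes> laurent_value q (k - i))"
    by (intro laurent_mult_eq[OF laurent_value_closed laurent_value_closed]) auto
  also have "\<dots> = (\<Oplus>i\<in>{..M}. laurent_value p (int i) \<otimes> laurent_value q (k - int i))"
    by (rule add.finprod_reindex) (use closed in auto)
  also have "\<dots> = laurent_value (p * q) k"
  proof (cases "k < 0")
    case True
    then show ?thesis
      using closed by (intro trans[OF add.finprod_one_eqI]) (auto simp: laurent_value_def)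
  next
    case False
    have "(\<Oplus>i\<in>{..M}. laurent_value p (int i) \<otimes> laurent_value q (k - int i))
      = (\<Oplus>i\<in>{..nat k}. free_value (coeff p i * coeff q (nat k - i)))"
    proof (rule add.finprod_mono_neutral_cong_right)
      show "{..nat k} \<subseteq> {..M}" by (auto simp: M_def)
      show "laurent_value p (int i) \<otimes> laurent_value q (k - int i) = \<zero>"
        if "i \<in> {..M} - {..nat k}" for i
        using that closed by (auto simp: laurent_value_def)
      show "laurent_value p (int i) \<otimes> laurent_value q (k - int i)
          = free_value (coeff p i * coeff q (nat k - i))" if "i \<in> {..nat k}" for i
      proof -
        have "nat (k - int i) = nat k - i" "\<not> k - int i < 0" using that False by auto
        then show ?thesis by (simp add: laurent_value_def free_value_mult)
      qed
    qed (use closed in auto)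
    then show ?thesis using False by (simp add: laurent_value_def coeff_mult free_value_sum)
  qed
  finally show "laurent_value (p * q) k = (laurent_value p \<otimes>\<^bsub>laurent_ring R\<^esub> laurent_value q) k" ..
qed

lemma laurent_value_monom: "laurent_value (monom 1 t) = X_power (int t)"
  by (auto simp: laurent_value_def X_power_def free_value_zero free_value_one fun_eq_iff)

lemma laurent_value_zero: "laurent_value 0 = \<zero>\<^bsub>laurent_ring R\<^esub>"
  by (auto simp: laurent_value_def free_value_zero laurent_ring_simps)

lemma laurent_value_one: "laurent_value 1 = \<one>\<^bsub>laurent_ring R\<^esub>"
  using laurent_value_monom[of 0] by (simp add: laurent_ring_simps monom_0 one_pCons)

lemma laurent_value_eq_iff: "laurent_value p = laurent_value q \<longleftrightarrow> p - q \<in> coeff_ideal relations"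
proof
  assume eq: "laurent_value p = laurent_value q"
  have "free_value (coeff p i) = free_value (coeff q i)" for i
    using fun_cong[OF eq, of "int i"] by (simp add: laurent_value_def)
  then show "p - q \<in> coeff_ideal relations" by (simp add: coeff_ideal_def relations_diff_iff)
qed (auto simp: coeff_ideal_def relations_diff_iff laurent_value_def)

lemma X_power_closed: "X_power z \<in> laurent_carrier R"
  by (rule laurent_carrierI[of _ "{z}"]) (auto simp: X_power_def)

lemma X_power_mult:
  assumes f: "f \<in> laurent_carrier R"
  shows "X_power z \<otimes>\<^bsub>laurent_ring R\<^esub> f = (\<lambda>k. f (k - z))"
proof
  fix k
  have "(X_power z \<otimes>\<^bsub>laurent_ring R\<^esub> f) k = (\<Oplus>i\<in>{z}. X_power z i \<otimes> f (k - i))"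
    by (rule laurent_mult_eq[OF X_power_closed f]) (auto simp: X_power_def)
  then show "(X_power z \<otimes>\<^bsub>laurent_ring R\<^esub> f) k = f (k - z)"
    using laurent_carrierD(1)[OF f] by (simp add: X_power_def)
qed

lemma X_power_add: "X_power y \<otimes>\<^bsub>laurent_ring R\<^esub> X_power z = X_power (y + z)"
  by (subst X_power_mult[OF X_power_closed]) (auto simp: X_power_def fun_eq_iff)

text \<open>
  A sufficiently large shift moves the support of \<open>f\<close> to the nonnegative
  exponents.
\<close>
lemma laurent_value_surj:
  assumes f: "f \<in> laurent_carrier R"
  shows "\<exists>N. \<forall>t\<ge>N. \<exists>p. laurent_value p = X_power (int t) \<otimes>\<^bsub>laurent_ring R\<^esub> f"
proof -
  define B where "B = (\<Sum>k\<in>{k. f k \<noteq> \<zero>}. nat \<bar>k\<bar>)"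
  have B: "f k = \<zero>" if "int B < \<bar>k\<bar>" for k
  proof (rule ccontr)
    assume "f k \<noteq> \<zero>"
    then have "nat \<bar>k\<bar> \<le> B"
      unfolding B_def using laurent_carrierD(2)[OF f] by (intro member_le_sum) auto
    then show False using that by simp
  qed
  define s where "s x = (SOME p. free_value p = x)" for x
  have s: "free_value (s x) = x" if "x \<in> carrier R" for x
    unfolding s_def using free_value_surj[OF that] by (rule someI_ex)
  have "\<exists>p. laurent_value p = X_power (int t) \<otimes>\<^bsub>laurent_ring R\<^esub> f" if t: "B \<le> t" for t
  proof -
    define p where "p = (\<Sum>j\<le>t + B. monom (s (f (int j - int t))) j)"
    have cp: "coeff p j = (if j \<le> t + B then s (f (int j - int t)) else 0)" for j
      by (simp add: p_def coeff_sum)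
    have "laurent_value p k = f (k - int t)" for k
    proof (cases "k < 0")
      case True
      then have "int B < \<bar>k - int t\<bar>" using t by auto
      then show ?thesis using True B by (simp add: laurent_value_def)
    next
      case False
      show ?thesis
      proof (cases "nat k \<le> t + B")
        case True
        then show ?thesis using False laurent_carrierD(1)[OF f] by (simp add: laurent_value_def cp s)
      next
        case F: False
        then have "int B < \<bar>k - int t\<bar>" using False by auto
        then show ?thesis using False F B by (simp add: laurent_value_def cp free_value_zero)
      qed
    qed
    then show ?thesis using X_power_mult[OF f] by (intro exI[of _ p]) auto
  qed
  then show ?thesis by blast
qed

text \<open>
  After multiplication by a power of \<open>X\<close>, which is a unit, the entries of
  \<open>v\<close> and \<open>w\<close> lift to polynomials over the free ring. There the
  property of giving a completable row is invariant under the operations of the locale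
  \<open>row_reduction\<close>.
\<close>
theorem laurent_unimodular_completable:
  assumes dim: "krull_dim R \<le> ereal (real d)" and n: "d + 2 \<le> n"
    and v: "v \<in> carrier (cring.rows (laurent_ring R) n)" and w: "w \<in> carrier (cring.rows (laurent_ring R) n)"
    and vw: "(\<Oplus>\<^bsub>laurent_ring R\<^esub>i\<in>{..<n}. v i \<otimes>\<^bsub>laurent_ring R\<^esub> w i) = \<one>\<^bsub>laurent_ring R\<^esub>"
  shows "cring.completable (laurent_ring R) n v"
proof -
  interpret L: cring "laurent_ring R" by (rule laurent_ring_cring)
  let ?L = "laurent_ring R"
  have Lc: "laurent_value p \<in> carrier ?L" "X_power z \<in> carrier ?L" for p z
    using laurent_value_closed X_power_closed by (simp_all add: laurent_ring_simps)
  have unit: "X_power z \<otimes>\<^bsub>?L\<^esub> X_power (- z) = \<one>\<^bsub>?L\<^esub>" for z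
    by (simp add: X_power_add laurent_ring_simps)
  have diff: "laurent_value (p - q) = laurent_value p \<ominus>\<^bsub>?L\<^esub> laurent_value q" for p q
  proof -
    have "laurent_value p = laurent_value (p - q) \<oplus>\<^bsub>?L\<^esub> laurent_value q"
      using laurent_value_add[of "p - q" q] by simp
    then show ?thesis using Lc(1)[of "p - q"] Lc(1)[of q]
      by (simp add: a_minus_def L.a_assoc L.r_neg)
  qed
  define row where "row F = (\<lambda>i\<in>{..<n}. laurent_value (F i))" for F
  have row: "row F \<in> carrier (L.rows n)" for F unfolding row_def by (rule L.restrict_in_rows) (rule Lc)
  define good where "good F \<longleftrightarrow> L.completable n (row F)" for F
  have pair: "good F" if ij: "i < n" "j < n" "i \<noteq> j"
    and abce: "a \<in> carrier ?L" "b \<in> carrier ?L" "c \<in> carrier ?L" "e \<in> carrier ?L" "u \<in> carrier ?L"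
    and det: "(a \<otimes>\<^bsub>?L\<^esub> e \<ominus>\<^bsub>?L\<^esub> b \<otimes>\<^bsub>?L\<^esub> c) \<otimes>\<^bsub>?L\<^esub> u = \<one>\<^bsub>?L\<^esub>"
    and G: "good G" "row G = L.pair_map n i j a b c e (row F)" for i j a b c e u F G
    using L.completable_pair_map[OF ij abce det, of "row F"] G by (simp add: good_def)
  interpret row_reduction relations n good
  proof
    show "ideal_set relations" by (rule ideal_relations)
    show "2 \<le> n" using n by simp
    show "good (\<lambda>i. if i = n - 1 then 1 else 0)"
      unfolding good_def L.completable_def
    proof (intro bexI conjI)
      show "row (\<lambda>i. if i = n - 1 then 1 else 0) = L.unit_row n (n - 1)"
        unfolding row_def L.unit_row_def by (rule restrict_ext) (simp add: laurent_value_one laurent_value_zero)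
      show "bij_betw (\<lambda>x. x) (carrier (L.rows n)) (carrier (L.rows n))"
        by (rule bij_betwI[of _ _ _ "\<lambda>x. x"]) auto
      show "(\<lambda>x. x) \<in> module_hom ?L (L.rows n) (L.rows n)" by (rule L.module_homI) auto
    qed
  next
    fix i j a e b c s N G and F :: "nat \<Rightarrow> 'a free_ring poly"
    assume ij: "i < n" "j < n" "i \<noteq> j" and det: "(a * e - b * c) * s - monom 1 N \<in> coeff_ideal relations"
      and G: "good G" and GF: "\<And>k. k < n \<Longrightarrow>
        G k - (F(i := a * F i + b * F j, j := c * F i + e * F j)) k \<in> coeff_ideal relations"
    define u where "u = laurent_value s \<otimes>\<^bsub>?L\<^esub> X_power (- int N)"
    have "(laurent_value a \<otimes>\<^bsub>?L\<^esub> laurent_value e \<ominus>\<^bsub>?L\<^esub> laurent_value b \<otimes>\<^bsub>?L\<^esub> laurent_value c)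
        \<otimes>\<^bsub>?L\<^esub> laurent_value s = X_power (int N)"
      using det[folded laurent_value_eq_iff] by (simp add: laurent_value_mult diff laurent_value_monom)
    then have det': "(laurent_value a \<otimes>\<^bsub>?L\<^esub> laurent_value e \<ominus>\<^bsub>?L\<^esub> laurent_value b \<otimes>\<^bsub>?L\<^esub> laurent_value c)
        \<otimes>\<^bsub>?L\<^esub> u = \<one>\<^bsub>?L\<^esub>"
      unfolding u_def using unit[of "int N"] Lc by (simp add: L.m_assoc[symmetric])
    have "row G = L.pair_map n i j (laurent_value a) (laurent_value b) (laurent_value c) (laurent_value e) (row F)"
      unfolding row_def L.pair_map_def
    proof (rule restrict_ext)
      fix k assume "k \<in> {..<n}"
      then have "laurent_value (G k) = laurent_value ((F(i := a * F i + b * F j, j := c * F i + e * F j)) k)"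
        using GF by (simp only: laurent_value_eq_iff lessThan_iff)
      then show "laurent_value (G k) = (if k = i then laurent_value a \<otimes>\<^bsub>?L\<^esub> (\<lambda>i\<in>{..<n}. laurent_value (F i)) i
            \<oplus>\<^bsub>?L\<^esub> laurent_value b \<otimes>\<^bsub>?L\<^esub> (\<lambda>i\<in>{..<n}. laurent_value (F i)) j
          else if k = j then laurent_value c \<otimes>\<^bsub>?L\<^esub> (\<lambda>i\<in>{..<n}. laurent_value (F i)) i
            \<oplus>\<^bsub>?L\<^esub> laurent_value e \<otimes>\<^bsub>?L\<^esub> (\<lambda>i\<in>{..<n}. laurent_value (F i)) j
          else (\<lambda>i\<in>{..<n}. laurent_value (F i)) k)"
        using ij \<open>k \<in> {..<n}\<close> by (auto simp: laurent_value_add laurent_value_mult)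
    qed
    then show "good F"
      using pair[OF ij Lc(1) Lc(1) Lc(1) Lc(1) _ det' G] Lc by (simp add: u_def)
  next
    fix i t and F :: "nat \<Rightarrow> 'a free_ring poly"
    assume i: "i < n" and F: "good F"
    define j where "j = (if i = 0 then 1 else 0 :: nat)"
    have j: "j < n" "i \<noteq> j" using n by (auto simp: j_def)
    let ?F = "F(i := monom 1 t * F i)"
    have "row F = L.pair_map n i j (X_power (- int t)) \<zero>\<^bsub>?L\<^esub> \<zero>\<^bsub>?L\<^esub> \<one>\<^bsub>?L\<^esub> (row ?F)"
      unfolding row_def L.pair_map_def
    proof (rule restrict_ext)
      fix k assume k: "k \<in> {..<n}"
      have "X_power (- int t) \<otimes>\<^bsub>?L\<^esub> laurent_value (monom 1 t * F i) = laurent_value (F i)"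
        using unit[of "- int t"] Lc by (simp add: laurent_value_mult laurent_value_monom L.m_assoc[symmetric])
      then show "laurent_value (F k) = (if k = i then X_power (- int t) \<otimes>\<^bsub>?L\<^esub> (\<lambda>i\<in>{..<n}. laurent_value (?F i)) i
            \<oplus>\<^bsub>?L\<^esub> \<zero>\<^bsub>?L\<^esub> \<otimes>\<^bsub>?L\<^esub> (\<lambda>i\<in>{..<n}. laurent_value (?F i)) j
          else if k = j then \<zero>\<^bsub>?L\<^esub> \<otimes>\<^bsub>?L\<^esub> (\<lambda>i\<in>{..<n}. laurent_value (?F i)) i
            \<oplus>\<^bsub>?L\<^esub> \<one>\<^bsub>?L\<^esub> \<otimes>\<^bsub>?L\<^esub> (\<lambda>i\<in>{..<n}. laurent_value (?F i)) j
          else (\<lambda>i\<in>{..<n}. laurent_value (?F i)) k)"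
        using i j k Lc by simp
    qed
    moreover have "(X_power (- int t) \<otimes>\<^bsub>?L\<^esub> \<one>\<^bsub>?L\<^esub> \<ominus>\<^bsub>?L\<^esub> \<zero>\<^bsub>?L\<^esub> \<otimes>\<^bsub>?L\<^esub> \<zero>\<^bsub>?L\<^esub>) \<otimes>\<^bsub>?L\<^esub> X_power (int t) = \<one>\<^bsub>?L\<^esub>"
      using unit[of "- int t"] Lc by (simp add: a_minus_def)
    ultimately show "good ?F"
      using pair[OF i j(1) j(2) Lc(2) L.zero_closed L.zero_closed L.one_closed Lc(2) _ F] by blast
  qed
  have lift: "\<exists>N. \<forall>t\<ge>N. \<forall>i<n. \<exists>p. laurent_value p = X_power (int t) \<otimes>\<^bsub>?L\<^esub> x i"
    if x: "x \<in> carrier (L.rows n)" for x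
  proof -
    have "\<forall>i\<in>{..<n}. \<exists>N. \<forall>t\<ge>N. \<exists>p. laurent_value p = X_power (int t) \<otimes>\<^bsub>?L\<^esub> x i"
      using laurent_value_surj L.rows_closed[OF x] by (auto simp: laurent_ring_simps)
    then obtain N where N: "\<forall>i\<in>{..<n}. \<forall>t\<ge>N i. \<exists>p. laurent_value p = X_power (int t) \<otimes>\<^bsub>?L\<^esub> x i"
      by (rule bchoice[THEN exE])
    have "N i \<le> sum N {..<n}" if "i < n" for i using that by (intro member_le_sum) auto
    then show ?thesis using N by (intro exI[of _ "sum N {..<n}"]) (meson lessThan_iff order.trans)
  qed
  obtain N1 N2 where N: "\<forall>t\<ge>N1. \<forall>i<n. \<exists>p. laurent_value p = X_power (int t) \<otimes>\<^bsub>?L\<^esub> v i"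
    "\<forall>t\<ge>N2. \<forall>i<n. \<exists>p. laurent_value p = X_power (int t) \<otimes>\<^bsub>?L\<^esub> w i"
    using lift[OF v] lift[OF w] by blast
  define t where "t = N1 + N2"
  have t: "N1 \<le> t" "N2 \<le> t" by (simp_all add: t_def)
  have "\<forall>i. \<exists>p. i < n \<longrightarrow> laurent_value p = X_power (int t) \<otimes>\<^bsub>?L\<^esub> v i"
    "\<forall>i. \<exists>p. i < n \<longrightarrow> laurent_value p = X_power (int t) \<otimes>\<^bsub>?L\<^esub> w i"
    using N(1)[rule_format, OF t(1)] N(2)[rule_format, OF t(2)] by blast+
  then obtain F W where F: "\<And>i. i < n \<Longrightarrow> laurent_value (F i) = X_power (int t) \<otimes>\<^bsub>?L\<^esub> v i"
    and W: "\<And>i. i < n \<Longrightarrow> laurent_value (W i) = X_power (int t) \<otimes>\<^bsub>?L\<^esub> w i"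
    by metis
  have vc: "v i \<in> carrier ?L" "w i \<in> carrier ?L" if "i < n" for i
    using L.rows_closed[OF v that] L.rows_closed[OF w that] by auto
  have lsum: "laurent_value (sum f A) = (\<Oplus>\<^bsub>?L\<^esub>i\<in>A. laurent_value (f i))" if "finite A"
    for f :: "nat \<Rightarrow> 'a free_ring poly" and A
    using that by (induction A rule: finite_induct) (auto simp: laurent_value_zero laurent_value_add Lc)
  have "laurent_value (\<Sum>i<n. W i * F i)
    = (\<Oplus>\<^bsub>?L\<^esub>i\<in>{..<n}. X_power (int t + int t) \<otimes>\<^bsub>?L\<^esub> (v i \<otimes>\<^bsub>?L\<^esub> w i))"
  proof (subst lsum, simp, rule L.finsum_cong')
    fix i assume i: "i \<in> {..<n}"
    have "(X_power (int t) \<otimes>\<^bsub>?L\<^esub> w i) \<otimes>\<^bsub>?L\<^esub> (X_power (int t) \<otimes>\<^bsub>?L\<^esub> v i)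
      = (X_power (int t) \<otimes>\<^bsub>?L\<^esub> X_power (int t)) \<otimes>\<^bsub>?L\<^esub> (v i \<otimes>\<^bsub>?L\<^esub> w i)"
      using vc[of i] i Lc(2) by (simp add: L.m_ac)
    then show "laurent_value (W i * F i) = X_power (int t + int t) \<otimes>\<^bsub>?L\<^esub> (v i \<otimes>\<^bsub>?L\<^esub> w i)"
      using i by (simp add: laurent_value_mult F W X_power_add)
  qed (use vc Lc in auto)
  also have "\<dots> = X_power (int t + int t) \<otimes>\<^bsub>?L\<^esub> (\<Oplus>\<^bsub>?L\<^esub>i\<in>{..<n}. v i \<otimes>\<^bsub>?L\<^esub> w i)"
    by (rule L.finsum_rdistr[symmetric]) (use vc Lc in auto)
  also have "\<dots> = laurent_value (monom 1 (t + t))" using Lc by (simp add: vw laurent_value_monom)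
  finally have "(\<Sum>i<n. W i * F i) - monom 1 (t + t) \<in> coeff_ideal relations"
    by (simp only: laurent_value_eq_iff)
  then have "good F" by (rule good_if_unimodular[OF no_long_chain_of_primes[OF dim] n])
  moreover have "row F = X_power (int t) \<odot>\<^bsub>L.rows n\<^esub> v"
    unfolding row_def L.rows_simps by (rule restrict_ext) (simp add: F)
  ultimately show ?thesis
    using L.completable_scale[OF Lc(2) Lc(2) unit, of n "int t" v] by (simp add: good_def)
qed

end

theorem corollary3p13:
  fixes R :: "('a, 'b) ring_scheme"
    and M :: "(int \<Rightarrow> 'a, 'm, 'c) module_scheme"
    and d r :: nat
  assumes "cring R"
    and "krull_dim R \<le> ereal (real d)"
    and "module (laurent_ring R) M"
    and "finitely_generated_module (laurent_ring R) M"
    and "stably_free_of_rank (laurent_ring R) M r"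
    and "r > d"
  shows "free_module (laurent_ring R) M"
proof -
  interpret R: cring R by fact
  interpret L: cring "laurent_ring R" by (rule R.laurent_ring_cring)
  obtain m where m: "module_isomorphic (laurent_ring R) (direct_sum M (L.rows m)) (L.rows (m + r))"
    using assms(5) by (auto simp: stably_free_of_rank_def)
  have "module_isomorphic (laurent_ring R) (direct_sum M (L.rows 0)) (L.rows r)"
    by (rule L.cancel_free_summand[OF assms(3) _ m])
      (rule R.laurent_unimodular_completable[OF assms(2)], use assms(6) in auto)
  then show ?thesis by (rule L.free_if_isomorphic_to_rows[OF assms(3)])
qed

end
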